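(* Let $E$ be a Hermite–Biehler function such that every polynomial belongs to the de Branges space $\mathcal{H}(E)$. Let the spectral data $((t_n),(\nu_n))$ for $\mathcal{H}(E)$ be regular and let $(t_n)$ be lacunary. Assume also that $\Phi(u)=0$ for $\mu$-a.e. $u$ in some interval $(0,\delta)$, $\delta>0$. Then $\mathbb{H}_{\Phi,\mu}$ is bounded in $\mathcal{H}(E)$ if and only if the integrals $\lambda_n=\int_0^\infty\Phi(u)u^{-n}\,d\mu(u)$ exist for all $n\in\mathbb{Z}_+$ and $C:=\sup_{n\in\mathbb{Z}_+}|\lambda_n|<\infty$. In this case, $$\|\mathbb{H}_{\Phi,\mu}\|_{\mathcal{H}(E)\to\mathcal{H}(E)}\le \mathrm{const}\cdot\sup_{n\in\mathbb{Z}_+}|\lambda_n|,$$ where the constant $\mathrm{const}$ depends on $E$ only.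
   Context: $\mu$ is a regular positive Borel measure on $(0,\infty)$ and $\Phi:(0,\infty)\to\mathbb{C}$ is $\mu$-measurable. The Hausdorff operator is $$(\mathbb{H}_{\Phi,\mu}F)(z)=\int_0^\infty \Phi(u)\,F\left(\tfrac{z}{u}\right)d\mu(u),\quad z\in\mathbb{C}.$$ $\mathbb{Z}_+=\{0,1,2,\dots\}$. An entire function $E$ is in the Hermite–Biehler class if $|E(z)|>|E^{\#}(z)|$ for $z$ in the open upper half-plane $\mathbb{C}^+$, where $F^{\#}(z):=\overline{F(\overline z)}$. The de Branges space is $\mathcal{H}(E)=\{F \text{ entire}: F/E,\ F^{\#}/E\in H^2(\mathbb{C}^+)\}$ ($H^2(\mathbb{C}^+)$ is the Hardy space of the upper half-plane), a Hilbert space with norm $\|F\|_E^2=\int_{-\infty}^\infty |F(t)/E(t)|^2dt$. "$\mathbb{H}_{\Phi,\mu}$ is bounded in $\mathcal{H}(E)$" means that $\mathbb{H}_{\Phi,\mu}F$ is defined and belongs to $\mathcal{H}(E)$ for every $F\in\mathcal{H}(E)$ and that $\mathbb{H}_{\Phi,\mu}$ is a bounded linear operator on $\mathcal{H}(E)$. Spectral data: a pair $((t_n),(\nu_n))$, indexed by a set of consecutive integers, where $(t_n)$ is an increasing sequence of reals with no finite accumulation point, $\nu_n>0$, $\sum_n\nu_n/(1+t_n^2)<\infty$, is spectral data for $\mathcal{H}(E)$ if there is an entire function $A$, real on $\mathbb{R}$, with only simple zeros, located exactly at the points $t_n$, such that the functions $\nu_n^{1/2}A(z)/(z-t_n)$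 form an orthonormal basis of $\mathcal{H}(E)$; equivalently $\mathcal{H}(E)$ consists of the functions $F(z)=A(z)\sum_n a_n\nu_n^{1/2}/(z-t_n)$, $(a_n)\in\ell^2$, with $\|F\|_E=\|(a_n)\|_{\ell^2}$. The sequence $(t_n)$ is lacunary if for some $\kappa>0$ one has $t_{n+1}-t_n\ge\kappa|t_n|$ for all $n$. The spectral data are regular if for some $c>0$ and any $n$, $$\sum_{|t_k|\le|t_n|}\nu_k+t_n^2\sum_{|t_k|>|t_n|}\frac{\nu_k}{t_k^2}\le c\,\nu_n.$$ *)

theory Defs
  imports "HOL-Complex_Analysis.Complex_Analysis" "HOL-Computational_Algebra.Polynomial"
begin

section \<open>Hermite--Biehler functions and de Branges spaces\<close>

definition entire :: "(complex \<Rightarrow> complex) \<Rightarrow> bool" where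
  "entire F \<longleftrightarrow> F holomorphic_on UNIV"

definition sharp :: "(complex \<Rightarrow> complex) \<Rightarrow> complex \<Rightarrow> complex" where
  "sharp F = (\<lambda>z. cnj (F (cnj z)))"

definition upper_half_plane :: "complex set" where
  "upper_half_plane = {z. Im z > 0}"

definition hermite_biehler :: "(complex \<Rightarrow> complex) \<Rightarrow> bool" where
  "hermite_biehler E \<longleftrightarrow>
     entire E \<and> (\<forall>z\<in>upper_half_plane. cmod (E z) > cmod (sharp E z))"

definition hardy2 :: "(complex \<Rightarrow> complex) set" where
  "hardy2 = {f. f holomorphic_on upper_half_plane \<and>
     (SUP y\<in>{0<..}. \<integral>\<^sup>+ x. ennreal ((cmod (f (Complex x y)))\<^sup>2) \<partial>lborel) < \<infinity>}"

definition de_branges :: "(complex \<Rightarrow> complex) \<Rightarrow> (complex \<Rightarrow> complex) set" where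
  "de_branges E = {F. entire F \<and> (\<lambda>z. F z / E z) \<in> hardy2 \<and> (\<lambda>z. sharp F z / E z) \<in> hardy2}"

definition db_norm :: "(complex \<Rightarrow> complex) \<Rightarrow> (complex \<Rightarrow> complex) \<Rightarrow> real" where
  "db_norm E F = sqrt (LINT t|lborel. (cmod (F (of_real t) / E (of_real t)))\<^sup>2)"

definition db_inner ::
    "(complex \<Rightarrow> complex) \<Rightarrow> (complex \<Rightarrow> complex) \<Rightarrow> (complex \<Rightarrow> complex) \<Rightarrow> complex" where
  "db_inner E F G =
     (LINT t|lborel. (F (of_real t) / E (of_real t)) * cnj (G (of_real t) / E (of_real t)))"

text \<open>A family is an orthonormal basis if it is orthonormal and its finite linear combinations
  are dense.\<close>

definition db_orthonormal_basis ::
    "(complex \<Rightarrow> complex) \<Rightarrow> 'i set \<Rightarrow> ('i \<Rightarrow> complex \<Rightarrow> complex) \<Rightarrow> bool" where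
  "db_orthonormal_basis E I g \<longleftrightarrow>
     (\<forall>n\<in>I. g n \<in> de_branges E) \<and>
     (\<forall>m\<in>I. \<forall>n\<in>I. db_inner E (g m) (g n) = (if m = n then 1 else 0)) \<and>
     (\<forall>F\<in>de_branges E. \<forall>\<epsilon>>0. \<exists>J a. finite J \<and> J \<subseteq> I \<and>
        db_norm E (\<lambda>z. F z - (\<Sum>n\<in>J. a n * g n z)) < \<epsilon>)"


section \<open>Bounded operators on a de Branges space\<close>

definition db_bounded_operator ::
    "(complex \<Rightarrow> complex) \<Rightarrow> ((complex \<Rightarrow> complex) \<Rightarrow> complex \<Rightarrow> complex) \<Rightarrow> bool" where
  "db_bounded_operator E T \<longleftrightarrow>
     (\<forall>F\<in>de_branges E. T F \<in> de_branges E) \<and>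
     (\<forall>F\<in>de_branges E. \<forall>G\<in>de_branges E. T (\<lambda>z. F z + G z) = (\<lambda>z. T F z + T G z)) \<and>
     (\<forall>F\<in>de_branges E. \<forall>c. T (\<lambda>z. c * F z) = (\<lambda>z. c * T F z)) \<and>
     (\<exists>C. \<forall>F\<in>de_branges E. db_norm E (T F) \<le> C * db_norm E F)"

text \<open>A supremum in the reals, hence meaningful only for operators satisfying
  \<^const>\<open>db_bounded_operator\<close>.\<close>

definition db_opnorm ::
    "(complex \<Rightarrow> complex) \<Rightarrow> ((complex \<Rightarrow> complex) \<Rightarrow> complex \<Rightarrow> complex) \<Rightarrow> real" where
  "db_opnorm E T = (SUP F\<in>{F \<in> de_branges E. db_norm E F \<le> 1}. db_norm E (T F))"


section \<open>Spectral data\<close>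

definition consecutive :: "int set \<Rightarrow> bool" where
  "consecutive I \<longleftrightarrow> (\<forall>a\<in>I. \<forall>b\<in>I. {a..b} \<subseteq> I)"

text \<open>The entire function \<open>\<nu>\<^sup>1\<^sup>/\<^sup>2 A(z) / (z - t)\<close>; since \<open>A\<close> vanishes at \<open>t\<close>, the removable
  singularity is filled with \<open>\<nu>\<^sup>1\<^sup>/\<^sup>2 A'(t)\<close>.\<close>

definition spectral_function ::
    "(complex \<Rightarrow> complex) \<Rightarrow> real \<Rightarrow> real \<Rightarrow> complex \<Rightarrow> complex" where
  "spectral_function A t \<nu> = (\<lambda>z. of_real (sqrt \<nu>) *
     (if z = of_real t then deriv A (of_real t) else A z / (z - of_real t)))"

definition spectral_data ::
    "(complex \<Rightarrow> complex) \<Rightarrow> int set \<Rightarrow> (int \<Rightarrow> real) \<Rightarrow> (int \<Rightarrow> real) \<Rightarrow> bool" where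
  "spectral_data E I t \<nu> \<longleftrightarrow>
     consecutive I \<and> strict_mono_on I t \<and> (\<forall>x. \<not> x islimpt t ` I) \<and>
     (\<forall>n\<in>I. \<nu> n > 0) \<and> (\<lambda>n. \<nu> n / (1 + (t n)\<^sup>2)) summable_on I \<and>
     (\<exists>A. entire A \<and> (\<forall>x::real. A (of_real x) \<in> \<real>) \<and>
        {z. A z = 0} = (\<lambda>n. of_real (t n)) ` I \<and>
        (\<forall>n\<in>I. deriv A (of_real (t n)) \<noteq> 0) \<and>
        db_orthonormal_basis E I (\<lambda>n. spectral_function A (t n) (\<nu> n)))"

definition lacunary :: "int set \<Rightarrow> (int \<Rightarrow> real) \<Rightarrow> bool" where
  "lacunary I t \<longleftrightarrow>
     (\<exists>\<kappa>>0. \<forall>n. n \<in> I \<and> n + 1 \<in> I \<longrightarrow> t (n + 1) - t n \<ge> \<kappa> * \<bar>t n\<bar>)"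

text \<open>Both sums converge for spectral data: the first is finite, and the second is dominated by
  \<open>\<Sum>\<nu>\<^sub>k / (1 + t\<^sub>k\<^sup>2)\<close> up to a constant.\<close>

definition regular_data :: "int set \<Rightarrow> (int \<Rightarrow> real) \<Rightarrow> (int \<Rightarrow> real) \<Rightarrow> bool" where
  "regular_data I t \<nu> \<longleftrightarrow>
     (\<exists>c>0. \<forall>n\<in>I.
        (\<Sum>\<^sub>\<infinity>k\<in>{k\<in>I. \<bar>t k\<bar> \<le> \<bar>t n\<bar>}. \<nu> k) +
        (t n)\<^sup>2 * (\<Sum>\<^sub>\<infinity>k\<in>{k\<in>I. \<bar>t k\<bar> > \<bar>t n\<bar>}. \<nu> k / (t k)\<^sup>2) \<le> c * \<nu> n)"


section \<open>Hausdorff operators\<close>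

text \<open>Regular Borel measures on the space \<open>(0,\<infinity>)\<close>; as usual, regularity includes finiteness
  on compact sets.\<close>

definition regular_borel_measure :: "real measure \<Rightarrow> bool" where
  "regular_borel_measure \<mu> \<longleftrightarrow>
     sets \<mu> = sets (restrict_space borel {0<..}) \<and>
     (\<forall>K. compact K \<and> K \<subseteq> {0<..} \<longrightarrow> emeasure \<mu> K < \<infinity>) \<and>
     (\<forall>B\<in>sets \<mu>.
        emeasure \<mu> B = (INF U\<in>{U. open U \<and> B \<subseteq> U \<and> U \<subseteq> {0<..}}. emeasure \<mu> U) \<and>
        emeasure \<mu> B = (SUP K\<in>{K. compact K \<and> K \<subseteq> B}. emeasure \<mu> K))"

text \<open>Since \<open>\<Phi>\<close> is only required to be measurable with respect to the completion of \<open>\<mu>\<close>, integrals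
  against \<open>\<mu>\<close> are taken with respect to the completion.\<close>

definition hausdorff_op ::
    "(real \<Rightarrow> complex) \<Rightarrow> real measure \<Rightarrow> (complex \<Rightarrow> complex) \<Rightarrow> complex \<Rightarrow> complex" where
  "hausdorff_op \<Phi> \<mu> F = (\<lambda>z. LINT u|completion \<mu>. \<Phi> u * F (z / of_real u))"

definition hausdorff_defined ::
    "(real \<Rightarrow> complex) \<Rightarrow> real measure \<Rightarrow> (complex \<Rightarrow> complex) \<Rightarrow> bool" where
  "hausdorff_defined \<Phi> \<mu> F \<longleftrightarrow>
     (\<forall>z. integrable (completion \<mu>) (\<lambda>u. \<Phi> u * F (z / of_real u)))"

definition hausdorff_bounded ::
    "(complex \<Rightarrow> complex) \<Rightarrow> (real \<Rightarrow> complex) \<Rightarrow> real measure \<Rightarrow> bool" where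
  "hausdorff_bounded E \<Phi> \<mu> \<longleftrightarrow>
     (\<forall>F\<in>de_branges E. hausdorff_defined \<Phi> \<mu> F) \<and> db_bounded_operator E (hausdorff_op \<Phi> \<mu>)"

definition moment_exists :: "(real \<Rightarrow> complex) \<Rightarrow> real measure \<Rightarrow> nat \<Rightarrow> bool" where
  "moment_exists \<Phi> \<mu> n \<longleftrightarrow> integrable (completion \<mu>) (\<lambda>u. \<Phi> u / of_real u ^ n)"

definition moment :: "(real \<Rightarrow> complex) \<Rightarrow> real measure \<Rightarrow> nat \<Rightarrow> complex" where
  "moment \<Phi> \<mu> n = (LINT u|completion \<mu>. \<Phi> u / of_real u ^ n)"

end

theory Submission
  imports Defs
begin

text \<open>
  A Hausdorff operator acts diagonally on monomials, \<open>z\<^sup>n \<mapsto> \<lambda>\<^sub>n z\<^sup>n\<close>. If the monomials, suitably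
  normalised, form an unconditional basis of the de Branges space, then such an operator is
  bounded exactly when its eigenvalues \<open>\<lambda>\<^sub>n\<close> are bounded, and its norm is controlled by their
  supremum. The proof establishes this basis property: with nodes \<open>s\<^sub>0, s\<^sub>1, \<dots>\<close> ordered by
  modulus, \<open>r\<^sub>n = |s\<^sub>n|\<close> and \<open>w\<^sub>m = r\<^sub>0 \<cdots> r\<^sub>m / \<nu>\<^sub>m\<^sup>1\<^sup>/\<^sup>2\<close>, the norm of \<open>F = \<Sum> c\<^sub>m z\<^sup>m\<close> is
  equivalent to the weighted \<open>\<ell>\<^sup>2\<close> norm of \<open>(w\<^sub>m c\<^sub>m)\<close> (\<open>energy_poly_le\<close> and \<open>taylor_energy_le\<close>).

  The two sides are related by the matrix of spectral coefficients of the monomials and by the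
  matrix of Taylor coefficients of the basis functions. After weighting, both have entries that
  decay geometrically away from the diagonal, so the Schur test bounds them. The decay has two
  sources. Regularity of the data says that \<open>\<nu>\<^sub>n\<close> grows and \<open>\<nu>\<^sub>n / r\<^sub>n\<^sup>2\<close> decays geometrically.
  Lacunarity gives sharp two-sided bounds for products of the factors \<open>(z - s\<^sub>k) / r\<^sub>k\<close>, and
  these determine the basis functions because the generating function \<open>A\<close> is, up to constants,
  the product of these factors over all \<open>k\<close>. The last fact rests on the hypothesis on
  polynomials: since the constant \<open>1\<close> lies in the space, \<open>A\<close> is bounded below on circles through
  large gaps between the nodes, and the Borel-Caratheodory inequality shows that the zero-free
  cofactor of the first \<open>N\<close> factors stays bounded above and below (\<open>cofactor_bounded\<close>).

  Two facts about the half-plane support the argument. The Hardy norm of a function continuous up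
  to the boundary is dominated by the \<open>L\<^sup>2\<close> norm on the real line
  (\<open>hardy_norm_le_boundary_norm\<close>). Hence point evaluations are locally uniformly bounded on the
  de Branges space, and pointwise limits of norm-bounded sequences stay in it whenever they are
  entire (\<open>de_branges_closed_pointwise\<close>). The latter turns the bound for polynomials into
  membership of the whole series \<open>\<Sum> \<lambda>\<^sub>m c\<^sub>m z\<^sup>m\<close>. That this series is the value of the Hausdorff
  operator at \<open>F\<close> follows by dominated convergence, since the kernel vanishes near \<open>0\<close>.
\<close>

section \<open>Functions in the Hardy space of the half-plane\<close>

lemma nn_integral_Icc_continuous:
  fixes g :: "real \<Rightarrow> real"
  assumes "continuous_on {a..b} g" and "\<And>x. x \<in> {a..b} \<Longrightarrow> 0 \<le> g x"
  shows "(\<integral>\<^sup>+x. ennreal (g x) * indicator {a..b} x \<partial>lborel) = ennreal (integral {a..b} g)"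
proof -
  have si: "set_integrable lborel {a..b} g"
    by (rule borel_integrable_atLeastAtMost'[OF assms(1)])
  have "(\<integral>\<^sup>+x. ennreal (g x) * indicator {a..b} x \<partial>lborel)
      = (\<integral>\<^sup>+x. ennreal (indicator {a..b} x *\<^sub>R g x) \<partial>lborel)"
    by (intro nn_integral_cong) (auto simp: indicator_def)
  also have "\<dots> = ennreal (LINT x|lborel. indicator {a..b} x *\<^sub>R g x)"
    using si assms(2) unfolding set_integrable_def
    by (intro nn_integral_eq_integral) (auto simp: indicator_def)
  also have "\<dots> = ennreal (integral {a..b} g)"
    using set_borel_integral_eq_integral(2)[OF si] by (simp add: set_lebesgue_integral_def)
  finally show ?thesis .
qed

lemma integral_Icc_le_of_nn_integral:
  fixes g :: "real \<Rightarrow> real"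
  assumes "continuous_on {a..b} g" and "\<And>x. x \<in> {a..b} \<Longrightarrow> 0 \<le> g x"
    and "(\<integral>\<^sup>+x. ennreal (g x) \<partial>lborel) \<le> ennreal M" and "0 \<le> M"
  shows "integral {a..b} g \<le> M"
proof -
  have "ennreal (integral {a..b} g) = (\<integral>\<^sup>+x. ennreal (g x) * indicator {a..b} x \<partial>lborel)"
    using nn_integral_Icc_continuous[OF assms(1,2)] by simp
  also have "\<dots> \<le> (\<integral>\<^sup>+x. ennreal (g x) \<partial>lborel)"
    by (intro nn_integral_mono) (auto simp: indicator_def)
  also note assms(3)
  finally show ?thesis using assms(4) by (simp add: ennreal_le_iff)
qed

lemma nn_integral_le_of_integral_Icc:
  fixes g :: "real \<Rightarrow> real"
  assumes cont: "continuous_on UNIV g" and nonneg: "\<And>x. 0 \<le> g x"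
    and bd: "\<And>R. R > 0 \<Longrightarrow> integral {-R..R} g \<le> M"
  shows "(\<integral>\<^sup>+x. ennreal (g x) \<partial>lborel) \<le> ennreal M"
proof -
  have [measurable]: "g \<in> borel_measurable borel"
    using cont by (rule borel_measurable_continuous_onI)
  have "(\<integral>\<^sup>+x. ennreal (g x) \<partial>lborel)
      = (\<integral>\<^sup>+x. (SUP n. ennreal (g x) * indicator {-real (Suc n)..real (Suc n)} x) \<partial>lborel)"
  proof (intro nn_integral_cong)
    fix x :: real
    obtain n :: nat where n: "\<bar>x\<bar> \<le> real n" using real_arch_simple by blast
    have "ennreal (g x) = ennreal (g x) * indicator {-real (Suc n)..real (Suc n)} x"
      using n by (auto simp: indicator_def)
    also have "\<dots> \<le> (SUP n. ennreal (g x) * indicator {-real (Suc n)..real (Suc n)} x)"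
      by (rule SUP_upper) simp
    finally show "ennreal (g x) = (SUP n. ennreal (g x) * indicator {-real (Suc n)..real (Suc n)} x)"
      by (intro antisym SUP_least) (auto simp: indicator_def)
  qed
  also have "\<dots> = (SUP n. \<integral>\<^sup>+x. ennreal (g x) * indicator {-real (Suc n)..real (Suc n)} x \<partial>lborel)"
    by (intro nn_integral_monotone_convergence_SUP)
       (auto simp: incseq_def le_fun_def indicator_def)
  also have "\<dots> \<le> ennreal M"
  proof (rule SUP_least)
    fix n
    have "(\<integral>\<^sup>+x. ennreal (g x) * indicator {-real (Suc n)..real (Suc n)} x \<partial>lborel)
        = ennreal (integral {-real (Suc n)..real (Suc n)} g)"
      using nonneg by (intro nn_integral_Icc_continuous continuous_on_subset[OF cont]) auto
    also have "\<dots> \<le> ennreal M" by (intro ennreal_leI bd) simp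
    finally show "(\<integral>\<^sup>+x. ennreal (g x) * indicator {-real (Suc n)..real (Suc n)} x \<partial>lborel) \<le> ennreal M" .
  qed
  finally show ?thesis .
qed

lemma open_upper_half_plane: "open upper_half_plane"
  unfolding upper_half_plane_def by (simp add: open_halfspace_Im_gt)

lemma convex_upper_half_plane: "convex upper_half_plane"
  unfolding upper_half_plane_def by (simp add: convex_halfspace_Im_gt)

abbreviation slice_energy :: "(complex \<Rightarrow> complex) \<Rightarrow> real \<Rightarrow> ennreal" where
  "slice_energy f y \<equiv> \<integral>\<^sup>+x. ennreal ((cmod (f (Complex x y)))^2) \<partial>lborel"

text \<open>
  Windows of a horizontal line are taken around an arbitrary point of the line, so that the bound
  can be used for translates of \<open>f\<close>; it is uniform in the window.
\<close>

lemma slice_integral_le: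
  fixes f :: "complex \<Rightarrow> complex"
  assumes cont: "continuous_on {w. Im w = Im z} f"
    and bd: "slice_energy f (Im z) \<le> ennreal M"
    and "0 \<le> M"
  shows "integral {a..b} (\<lambda>x. (cmod (f (z + of_real x)))^2) \<le> M"
proof (rule integral_Icc_le_of_nn_integral)
  show "continuous_on {a..b} (\<lambda>x. (cmod (f (z + of_real x)))^2)"
    by (intro continuous_intros continuous_on_compose2[OF cont]) auto
  have m: "(\<lambda>x. f (Complex x (Im z))) \<in> borel_measurable borel"
  proof (rule borel_measurable_continuous_onI)
    have "continuous_on UNIV (\<lambda>x. f (of_real x + \<i> * of_real (Im z)))"
      by (intro continuous_on_compose2[OF cont] continuous_intros) auto
    then show "continuous_on UNIV (\<lambda>x. f (Complex x (Im z)))" by (simp add: Complex_eq)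
  qed
  have "slice_energy f (Im z)
      = ennreal \<bar>1\<bar> * (\<integral>\<^sup>+x. ennreal ((cmod (f (Complex (Re z + 1 * x) (Im z))))^2) \<partial>lborel)"
    using m by (intro nn_integral_real_affine) auto
  also have "\<dots> = (\<integral>\<^sup>+x. ennreal ((cmod (f (z + of_real x)))^2) \<partial>lborel)"
  proof -
    have "Complex (Re z + x) (Im z) = z + of_real x" for x by (simp add: complex_eq_iff)
    then show ?thesis by simp
  qed
  finally show "(\<integral>\<^sup>+x. ennreal ((cmod (f (z + of_real x)))^2) \<partial>lborel) \<le> ennreal M"
    using bd by simp
qed (use assms in auto)

text \<open>
  Young's inequality in the form used to trade integrals of \<open>|f|\<close> for integrals of \<open>|f|\<^sup>2\<close>; it
  replaces the Cauchy-Schwarz inequality, the free parameter being optimised at the end.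
\<close>

lemma cmod_le_young: "\<alpha> > 0 \<Longrightarrow> x \<le> (\<alpha> + x^2 / \<alpha>) / 2" for x \<alpha> :: real
proof -
  assume a: "\<alpha> > 0"
  have "0 \<le> (x - \<alpha>)^2 / \<alpha>" using a by simp
  also have "\<dots> = \<alpha> + x^2/\<alpha> - 2 * x" using a by (simp add: power2_diff field_simps power2_eq_square)
  finally show ?thesis by simp
qed

text \<open>
  Over a window of length \<open>a \<le> Im z\<close>, the integral of \<open>f\<close> is a difference of values of a
  primitive. As a function of the base point it is holomorphic and small, so Cauchy's estimate
  makes its derivative \<open>f (z + a) - f z\<close> small. Thus \<open>f z\<close> is close to its own average, which the
  \<open>L\<^sup>2\<close> bound controls.
\<close>

lemma hardy_pointwise_bound:
  fixes f :: "complex \<Rightarrow> complex"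
  assumes hol: "f holomorphic_on upper_half_plane" and "0 \<le> M"
    and bd: "\<And>y. y > 0 \<Longrightarrow> slice_energy f y \<le> ennreal M"
    and z: "Im z > 0"
  shows "(cmod (f z))^2 * Im z \<le> 9 * M"
proof -
  define y where "y = Im z"
  have y: "y > 0" using z by (simp add: y_def)
  have cont: "continuous_on upper_half_plane f" using hol by (rule holomorphic_on_imp_continuous_on)
  have contw: "continuous_on {a..b} (\<lambda>x. f (w + of_real x))" if "Im w > 0" for w and a b :: real
    using that by (intro continuous_on_compose2[OF cont] continuous_intros)
      (auto simp: upper_half_plane_def)
  have intI: "(\<lambda>x. f (w + of_real x)) integrable_on {a..b}"
     "(\<lambda>x. cmod (f (w + of_real x))) integrable_on {a..b}"
     "(\<lambda>x. (cmod (f (w + of_real x)))^2) integrable_on {a..b}" if "Im w > 0" for w and a b :: real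
    using contw[OF that] by (auto intro!: integrable_continuous_interval continuous_intros)
  have slice: "integral {a..b} (\<lambda>x. (cmod (f (w + of_real x)))^2) \<le> M" if "Im w > 0" for w a b
    using that by (intro slice_integral_le bd continuous_on_subset[OF cont] \<open>0 \<le> M\<close>)
      (auto simp: upper_half_plane_def)
  obtain G where G: "\<And>w. w \<in> upper_half_plane \<Longrightarrow> (G has_field_derivative f w) (at w)"
  proof -
    obtain G where "\<And>x. x \<in> upper_half_plane \<Longrightarrow> (G has_field_derivative f x) (at x within upper_half_plane)"
      using holomorphic_convex_primitive'[OF convex_upper_half_plane open_upper_half_plane hol] by blast
    then show ?thesis using that open_upper_half_plane by (metis at_within_open)
  qed
  have main: "y * cmod (f z) \<le> 3 * ((y * \<alpha> + M / \<alpha>) / 2)" if \<alpha>: "\<alpha> > 0" for \<alpha>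
  proof -
    define B where "B = (y * \<alpha> + M / \<alpha>) / 2"
    have L1: "integral {0..a} (\<lambda>x. cmod (f (w + of_real x))) \<le> B"
      if w: "Im w > 0" and a: "0 \<le> a" "a \<le> y" for w a
    proof -
      have "integral {0..a} (\<lambda>x. cmod (f (w + of_real x)))
          \<le> integral {0..a} (\<lambda>x. (\<alpha> + (cmod (f (w + of_real x)))^2 / \<alpha>) / 2)"
        using w contw[OF w] \<alpha> by (intro integral_le intI cmod_le_young
              integrable_continuous_interval continuous_intros) auto
      also have "\<dots> = (a * \<alpha> + integral {0..a} (\<lambda>x. (cmod (f (w + of_real x)))^2) / \<alpha>) / 2"
      proof -
        have "((\<lambda>x. (\<alpha> + (cmod (f (w + of_real x)))^2 / \<alpha>) / 2) has_integral
            (a * \<alpha> + integral {0..a} (\<lambda>x. (cmod (f (w + of_real x)))^2) / \<alpha>) / 2) {0..a}"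
          using intI(3)[OF w, of 0 a] has_integral_const_real[of \<alpha> 0 a] a(1)
          by (intro has_integral_divide has_integral_add) (auto simp: has_integral_iff)
        then show ?thesis by (rule integral_unique)
      qed
      also have "\<dots> \<le> B"
        unfolding B_def using a \<alpha> slice[OF w, of 0 a]
        by (intro divide_right_mono add_mono mult_right_mono) auto
      finally show ?thesis .
    qed
    have GI: "((\<lambda>x. f (w + of_real x)) has_integral (G (w + of_real a) - G w)) {0..a}"
      if w: "Im w > 0" and a: "0 \<le> a" for w and a :: real
    proof -
      have "((\<lambda>x. f (w + of_real x)) has_integral
          ((\<lambda>x. G (w + of_real x)) a - (\<lambda>x. G (w + of_real x)) 0)) {0..a}"
      proof (rule fundamental_theorem_of_calculus[OF a])
        fix x
        have "((\<lambda>x. G (w + x)) has_field_derivative f (w + of_real x)) (at (of_real x))"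
          using DERIV_shift[of G "f (w + of_real x)" "of_real x" w] G[of "w + of_real x"] w
          by (simp add: upper_half_plane_def add.commute)
        then show "((\<lambda>x. G (w + of_real x)) has_vector_derivative f (w + of_real x)) (at x within {0..a})"
          using has_vector_derivative_real_field[of "\<lambda>x. G (w + x)"] by auto
      qed
      then show ?thesis by simp
    qed
    \<comment> \<open>Cauchy's estimate on the circle of radius \<open>y / 2\<close>\<close>
    have diff: "cmod (f (z + of_real a) - f z) \<le> 2 * B / y" if a: "0 \<le> a" "a \<le> y" for a
    proof -
      define h where "h = (\<lambda>w. G (w + of_real a) - G w)"
      have Gh: "((\<lambda>w. G (w + of_real a)) has_field_derivative f (w + of_real a)) (at w)"
        if "Im w > 0" for w
        using G[of "w + of_real a"] that
          DERIV_shift[of G "f (w + of_real a)" w "of_real a"] by (auto simp: upper_half_plane_def)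
      have dh: "(h has_field_derivative (f (w + of_real a) - f w)) (at w)" if "Im w > 0" for w
        unfolding h_def using that by (intro DERIV_diff Gh G) (auto simp: upper_half_plane_def)
      have pos: "Im w > 0" if "cmod (z - w) \<le> y / 2" for w
        using abs_Im_le_cmod[of "z - w"] that y unfolding y_def by simp
      have "cmod ((deriv ^^ 1) h z) \<le> fact 1 * B / (y / 2) ^ 1"
      proof (rule Cauchy_inequality)
        have "h field_differentiable at w" if "cmod (z - w) \<le> y / 2" for w
          using dh[OF pos[OF that]] by (auto simp: field_differentiable_def)
        then have "h holomorphic_on cball z (y / 2)"
          unfolding holomorphic_on_def by (metis field_differentiable_at_within mem_cball dist_norm)
        then show "h holomorphic_on ball z (y / 2)" "continuous_on (cball z (y / 2)) h"
          by (auto intro: holomorphic_on_subset holomorphic_on_imp_continuous_on)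
        show "cmod (h w) \<le> B" if "cmod (z - w) = y / 2" for w
        proof -
          have w: "Im w > 0" using pos that by simp
          have "h w = integral {0..a} (\<lambda>x. f (w + of_real x))"
            using GI[OF w a(1)] by (simp add: h_def integral_unique)
          also have "cmod \<dots> \<le> integral {0..a} (\<lambda>x. cmod (f (w + of_real x)))"
            using w by (intro integral_norm_bound_integral intI) auto
          also have "\<dots> \<le> B" by (rule L1[OF w a])
          finally show ?thesis .
        qed
      qed (use y in auto)
      moreover have "deriv h z = f (z + of_real a) - f z" by (rule DERIV_imp_deriv[OF dh[OF z]])
      ultimately show ?thesis by (simp add: mult.commute)
    qed
    have "y * cmod (f z) = cmod (integral {0..y} (\<lambda>x. f z))"
      using y by (simp add: norm_mult)
    also have "integral {0..y} (\<lambda>x. f z) = integral {0..y} (\<lambda>x. f (z + of_real x))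
         - integral {0..y} (\<lambda>x. f (z + of_real x) - f z)"
      using z by (subst integral_diff) (auto intro!: intI)
    also have "cmod \<dots> \<le> cmod (integral {0..y} (\<lambda>x. f (z + of_real x)))
         + cmod (integral {0..y} (\<lambda>x. f (z + of_real x) - f z))" by (rule norm_triangle_ineq4)
    also have "\<dots> \<le> integral {0..y} (\<lambda>x. cmod (f (z + of_real x))) + integral {0..y} (\<lambda>x. 2 * B / y)"
      using z diff by (intro add_mono integral_norm_bound_integral intI integrable_diff) auto
    also have "\<dots> \<le> B + 2 * B" using L1[OF z, of y] y by (intro add_mono) auto
    finally have "y * cmod (f z) \<le> 3 * B" by simp
    then show ?thesis by (simp only: B_def)
  qed
  show ?thesis
  proof (cases "f z = 0")
    case False
    define c where "c = cmod (f z)"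
    have c: "c > 0" using False by (simp add: c_def)
    \<comment> \<open>with \<open>c / 3\<close> for \<open>\<alpha>\<close>, half of the left-hand side absorbs the first term on the right\<close>
    have "y * c \<le> 3 * ((y * (c/3) + M / (c/3)) / 2)" using main[of "c/3"] c by (simp add: c_def)
    then have "y * c * c \<le> 9 * M" using c by (simp add: field_simps)
    then show ?thesis by (simp add: c_def y_def power2_eq_square mult_ac)
  qed (use \<open>0 \<le> M\<close> in simp)
qed

text \<open>
  Phragmen-Lindelof for bounded functions: dividing by \<open>1 - i e z\<close>, whose modulus is at least \<open>1\<close>
  and at least \<open>e |z|\<close> on the half-plane, makes the function small on large half-circles, and \<open>e\<close>
  tends to \<open>0\<close> afterwards.
\<close>

lemma half_plane_maximum_principle:
  fixes h :: "complex \<Rightarrow> complex"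
  assumes cont: "continuous_on {w. 0 \<le> Im w} h" and hol: "h holomorphic_on upper_half_plane"
    and bdd: "\<And>w. 0 \<le> Im w \<Longrightarrow> cmod (h w) \<le> B'"
    and real_line: "\<And>x. cmod (h (of_real x)) \<le> B"
    and z: "0 \<le> Im z"
  shows "cmod (h z) \<le> B"
proof -
  have B': "B' \<ge> 0" using order_trans[OF norm_ge_zero bdd[of 0]] by simp
  have B: "B \<ge> 0" using order_trans[OF norm_ge_zero real_line[of 0]] by simp
  have step: "cmod (h z) \<le> B1 * cmod (1 - \<i> * of_real e * z)" if e: "e > 0" and B1: "B1 > B" for e B1
  proof -
    define d where "d = (\<lambda>w. 1 - \<i> * of_real e * w)"
    have d_ge: "1 \<le> cmod (d w)" "e * cmod w \<le> cmod (d w)" if "0 \<le> Im w" for w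
    proof -
      have sq: "(cmod (d w))^2 = 1 + 2 * e * Im w + (e * cmod w)^2"
        unfolding d_def cmod_power2 power_mult_distrib cmod_power2[of w]
        by (simp add: algebra_simps power2_eq_square)
      have "1 \<le> (cmod (d w))^2" "(e * cmod w)^2 \<le> (cmod (d w))^2"
        unfolding sq using that e by auto
      then show "1 \<le> cmod (d w)" "e * cmod w \<le> cmod (d w)"
        using power2_le_imp_le[of 1 "cmod (d w)"] power2_le_imp_le[of "e * cmod w" "cmod (d w)"] by auto
    qed
    \<comment> \<open>beyond this radius the a priori bound is absorbed by \<open>e |w|\<close>\<close>
    define R where "R = max (cmod z) (B' / (e * B1)) + 1"
    have R: "cmod z < R" "B' / (e * B1) \<le> R" "R > 0"
      unfolding R_def using norm_ge_zero[of z] by linarith+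
    define S where "S = {w. 0 \<le> Im w} \<inter> cball (0::complex) R"
    have closedS: "closed S" unfolding S_def by (intro closed_Int closed_halfspace_Im_ge closed_cball)
    have intS: "interior S = upper_half_plane \<inter> ball 0 R"
      unfolding S_def upper_half_plane_def interior_Int
      using interior_halfspace_ge[of "\<i>::complex" 0] by (simp add: inner_complex_def)
    have dnz: "d w \<noteq> 0" if "0 \<le> Im w" for w using d_ge(1)[OF that] by auto
    have "cmod (h z / d z) \<le> B1"
    proof (rule maximum_modulus_frontier[where S = S and f = "\<lambda>w. h w / d w"])
      show "(\<lambda>w. h w / d w) holomorphic_on interior S"
        unfolding intS d_def
        by (intro holomorphic_intros holomorphic_on_subset[OF hol]) 
           (use dnz in \<open>auto simp: d_def upper_half_plane_def\<close>)
      show "continuous_on (closure S) (\<lambda>w. h w / d w)"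
        unfolding closure_closed[OF closedS] d_def
        by (intro continuous_intros continuous_on_subset[OF cont])
           (use dnz in \<open>auto simp: d_def S_def\<close>)
      show "bounded S" unfolding S_def by (simp add: bounded_Int)
      show "z \<in> S" using z R by (simp add: S_def)
      fix w assume w: "w \<in> frontier S"
      then have wS: "0 \<le> Im w" "cmod w \<le> R" using closedS by (auto simp: frontier_def S_def)
      from w have "\<not> (Im w > 0 \<and> cmod w < R)"
        unfolding frontier_def intS by (auto simp: upper_half_plane_def)
      then consider "Im w = 0" | "cmod w = R" using wS by linarith
      then show "cmod (h w / d w) \<le> B1"
      proof cases
        case 1
        then have "w = of_real (Re w)" by (simp add: complex_eq_iff)
        then have "cmod (h w) \<le> B" using real_line[of "Re w"] by simp
        moreover have "cmod (h w / d w) \<le> cmod (h w)"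
          using d_ge(1)[OF wS(1)] by (simp add: norm_divide divide_le_eq mult_le_cancel_left1 mult_left_le)
        ultimately show ?thesis using B1 by linarith
      next
        case 2
        have "cmod (h w) \<le> B'" using bdd wS by simp
        also have "\<dots> \<le> R * (e * B1)" using R(2) e B1 B by (simp add: divide_le_eq)
        also have "\<dots> = B1 * (e * cmod w)" using 2 by simp
        also have "\<dots> \<le> B1 * cmod (d w)" using d_ge(2)[OF wS(1)] B1 B by (intro mult_left_mono) auto
        finally show ?thesis using dnz[OF wS(1)] by (simp add: norm_divide divide_le_eq)
      qed
    qed
    then show ?thesis using dnz[OF z] by (simp add: norm_divide divide_le_eq d_def)
  qed
  have lim: "cmod (h z) \<le> B1" if "B1 > B" for B1
  proof (rule tendsto_lowerbound)
    show "((\<lambda>e. B1 * cmod (1 - \<i> * of_real e * z)) \<longlongrightarrow> B1) (at_right 0)"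
      by (rule tendsto_eq_intros refl | simp)+
    show "\<forall>\<^sub>F e in at_right 0. cmod (h z) \<le> B1 * cmod (1 - \<i> * of_real e * z)"
      using step[OF _ that] by (auto simp: eventually_at_right_field intro!: exI[of _ 1])
  qed auto
  show ?thesis by (rule dense_ge) (rule lim)
qed

text \<open>
  The a priori bound \<open>M\<close> only makes the maximum principle applicable and disappears from the
  conclusion. Correlating \<open>f\<close> with its own slice at height \<open>y\<close> over a window gives a bounded
  holomorphic function whose boundary values are controlled by \<open>N\<close> and whose value at \<open>i y\<close> is
  the energy of the slice in the window.
\<close>

theorem hardy_norm_le_boundary_norm:
  fixes f :: "complex \<Rightarrow> complex"
  assumes cont: "continuous_on {w. 0 \<le> Im w} f" and hol: "f holomorphic_on upper_half_plane"
    and bd: "\<And>y. y > 0 \<Longrightarrow> slice_energy f y \<le> ennreal M"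
    and boundary: "(\<integral>\<^sup>+x. ennreal ((cmod (f (of_real x)))^2) \<partial>lborel) \<le> ennreal N"
    and "0 \<le> M" "0 \<le> N" and y: "y > 0"
  shows "slice_energy f y \<le> ennreal N"
proof (rule nn_integral_le_of_integral_Icc)
  have contw: "continuous_on A (\<lambda>x. f (w + of_real x))" if "Im w \<ge> 0" for w and A :: "real set"
    using that by (intro continuous_on_compose2[OF cont] continuous_intros) auto
  define w0 where "w0 = Complex 0 y"
  have cx: "Complex x y = w0 + of_real x" for x by (simp add: complex_eq_iff w0_def)
  have w0: "Im w0 = y" by (simp add: w0_def)
  show "continuous_on UNIV (\<lambda>x. (cmod (f (Complex x y)))^2)"
    unfolding cx using y w0 by (intro continuous_intros contw) auto
  fix R :: real assume R: "R > 0"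
  define g where "g x = cnj (f (Complex x y))" for x
  have contg: "continuous_on A g" for A
    unfolding g_def cx using y w0 by (intro continuous_intros contw) auto
  define G where "G = integral {-R..R} (\<lambda>x. (cmod (g x))^2)"
  define h where "h = (\<lambda>z. integral {-R..R} (\<lambda>x. f (z + of_real x) * g x))"
  have hI: "cmod (h z) \<le> (C + G) / 2"
    if z: "0 \<le> Im z" and C: "integral {-R..R} (\<lambda>x. (cmod (f (z + of_real x)))^2) \<le> C" for z C
  proof -
    have "cmod (h z) \<le> integral {-R..R} (\<lambda>x. ((cmod (f (z + of_real x)))^2 + (cmod (g x))^2) / 2)"
      unfolding h_def
    proof (intro integral_norm_bound_integral integrable_continuous_interval continuous_intros contw contg z)
      fix x show "cmod (f (z + of_real x) * g x) \<le> ((cmod (f (z + of_real x)))^2 + (cmod (g x))^2) / 2"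
        using sum_squares_bound[of "cmod (f (z + of_real x))" "cmod (g x)"] by (simp add: norm_mult)
    qed auto
    also have "\<dots> = (integral {-R..R} (\<lambda>x. (cmod (f (z + of_real x)))^2) + G) / 2"
      unfolding G_def
      by (rule integral_unique, intro has_integral_divide has_integral_add integrable_integral
            integrable_continuous_interval continuous_intros contw contg z)
    finally show ?thesis using C by simp
  qed
  have sliceM: "integral {-R..R} (\<lambda>x. (cmod (f (z + of_real x)))^2) \<le> M" if "Im z > 0" for z
    using that by (intro slice_integral_le bd continuous_on_subset[OF cont] \<open>0 \<le> M\<close>) auto
  have sliceN: "integral {-R..R} (\<lambda>x. (cmod (f (z + of_real x)))^2) \<le> N" if "Im z = 0" for z
  proof (intro slice_integral_le continuous_on_subset[OF cont] \<open>0 \<le> N\<close>)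
    show "slice_energy f (Im z) \<le> ennreal N"
      using boundary that by (simp add: complex_of_real_def)
  qed (use that in auto)
  have hz: "cmod (h w0) \<le> (N + G) / 2"
  proof (rule half_plane_maximum_principle[where h = h and z = w0 and B' = "(max M N + G) / 2"])
    show "continuous_on {w. 0 \<le> Im w} h"
      unfolding h_def cbox_interval[symmetric]
    proof (rule integral_continuous_on_param)
      have "continuous_on ({w. 0 \<le> Im w} \<times> cbox (- R) R) (\<lambda>p. f (fst p + of_real (snd p)))"
        by (rule continuous_on_compose2[OF cont]) (auto intro!: continuous_intros simp del: cbox_interval)
      moreover have "continuous_on ({w. 0 \<le> Im w} \<times> cbox (- R) R) (\<lambda>p. g (snd p))"
        by (rule continuous_on_compose2[OF contg[of UNIV]]) (auto intro!: continuous_intros)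
      ultimately have "continuous_on ({w. 0 \<le> Im w} \<times> cbox (- R) R) (\<lambda>p. f (fst p + of_real (snd p)) * g (snd p))"
        by (rule continuous_on_mult)
      then show "continuous_on ({w. 0 \<le> Im w} \<times> cbox (- R) R) (\<lambda>(w, x). f (w + of_real x) * g x)"
        by (simp add: case_prod_unfold)
    qed
    have dcont: "continuous_on upper_half_plane (deriv f)"
      using hol open_upper_half_plane by (intro holomorphic_on_imp_continuous_on holomorphic_deriv)
    show "h holomorphic_on upper_half_plane"
      unfolding h_def cbox_interval[symmetric]
    proof (rule leibniz_rule_holomorphic[where fx = "\<lambda>w x. deriv f (w + of_real x) * g x"])
      fix w and x :: real assume w: "w \<in> upper_half_plane"
      then have "w + of_real x \<in> upper_half_plane" by (simp add: upper_half_plane_def)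
      then have "(f has_field_derivative deriv f (w + of_real x)) (at (w + of_real x))"
        by (rule holomorphic_derivI[OF hol open_upper_half_plane])
      then have "((\<lambda>w. f (w + of_real x)) has_field_derivative deriv f (w + of_real x)) (at w)"
        using DERIV_shift[of f "deriv f (w + of_real x)" w "of_real x"] by blast
      then show "((\<lambda>w. f (w + of_real x) * g x) has_field_derivative deriv f (w + of_real x) * g x)
          (at w within upper_half_plane)"
        using DERIV_cmult_right has_field_derivative_at_within by blast
      show "(\<lambda>x. f (w + of_real x) * g x) integrable_on cbox (- R) R"
        using w unfolding cbox_interval
        by (intro integrable_continuous_interval continuous_intros contw contg) (auto simp: upper_half_plane_def)
    next
      have "continuous_on (upper_half_plane \<times> cbox (- R) R) (\<lambda>p. deriv f (fst p + of_real (snd p)))"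
        by (rule continuous_on_compose2[OF dcont]) (auto intro!: continuous_intros simp: upper_half_plane_def)
      moreover have "continuous_on (upper_half_plane \<times> cbox (- R) R) (\<lambda>p. g (snd p))"
        by (rule continuous_on_compose2[OF contg[of UNIV]]) (auto intro!: continuous_intros)
      ultimately have "continuous_on (upper_half_plane \<times> cbox (- R) R) (\<lambda>p. deriv f (fst p + of_real (snd p)) * g (snd p))"
        by (rule continuous_on_mult)
      then show "continuous_on (upper_half_plane \<times> cbox (- R) R) (\<lambda>(w, x). deriv f (w + of_real x) * g x)"
        by (simp add: case_prod_unfold)
    qed (rule convex_upper_half_plane)
    show "cmod (h w) \<le> (max M N + G) / 2" if "0 \<le> Im w" for w
    proof (rule hI[OF that])
      show "integral {-R..R} (\<lambda>x. (cmod (f (w + of_real x)))^2) \<le> max M N"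
        using sliceM[of w] sliceN[of w] that by (cases "Im w = 0") (auto simp: le_max_iff_disj)
    qed
    show "cmod (h (of_real x)) \<le> (N + G) / 2" for x
      by (intro hI sliceN) auto
  qed (use y w0 in simp)
  \<comment> \<open>evaluation at \<open>i y\<close>, where \<open>f\<close> meets its own conjugate\<close>
  have "h w0 = integral {-R..R} (\<lambda>x. of_real ((cmod (g x))^2))"
    unfolding h_def
  proof (rule integral_cong)
    fix x
    have "f (w0 + of_real x) * g x = of_real (cmod (f (w0 + of_real x)) ^ 2)"
      unfolding g_def cx complex_norm_square ..
    then show "f (w0 + of_real x) * g x = of_real ((cmod (g x))^2)"
      unfolding g_def cx complex_mod_cnj .
  qed
  also have "\<dots> = of_real G"
    unfolding G_def by (rule integral_unique, rule has_integral_of_real, rule integrable_integral,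
      intro integrable_continuous_interval continuous_intros contg)
  finally have "cmod (h w0) \<ge> G" using abs_ge_self[of G] by simp
  then have "G \<le> N" using hz by simp
  then show "integral {-R..R} (\<lambda>x. (cmod (f (Complex x y)))^2) \<le> N" by (simp add: G_def g_def)
qed auto

section \<open>De Branges spaces containing the polynomials\<close>

text \<open>
  Fatou's lemma, in the form used for limits of functions of bounded energy.
\<close>

lemma nn_integral_le_of_tendsto:
  fixes u :: "nat \<Rightarrow> 'a \<Rightarrow> real"
  assumes [measurable]: "\<And>n. u n \<in> borel_measurable M"
    and lim: "\<And>x. x \<in> space M \<Longrightarrow> (\<lambda>n. u n x) \<longlonglongrightarrow> v x"
    and bd: "\<And>n. (\<integral>\<^sup>+x. ennreal (u n x) \<partial>M) \<le> B"
  shows "(\<integral>\<^sup>+x. ennreal (v x) \<partial>M) \<le> B"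
proof -
  have "(\<integral>\<^sup>+x. ennreal (v x) \<partial>M) = (\<integral>\<^sup>+x. liminf (\<lambda>n. ennreal (u n x)) \<partial>M)"
    by (intro nn_integral_cong lim_imp_Liminf[symmetric] tendsto_ennrealI lim) auto
  also have "\<dots> \<le> liminf (\<lambda>n. \<integral>\<^sup>+x. ennreal (u n x) \<partial>M)"
    by (intro nn_integral_liminf) auto
  also have "\<dots> \<le> liminf (\<lambda>n. B)" by (intro Liminf_mono always_eventually allI bd)
  also have "\<dots> = B" by (simp add: Liminf_const)
  finally show ?thesis .
qed

lemma hardy2D:
  assumes "f \<in> hardy2"
  obtains M where "0 \<le> M" "f holomorphic_on upper_half_plane"
    "\<And>y. y > 0 \<Longrightarrow> slice_energy f y \<le> ennreal M"
proof -
  let ?S = "SUP y\<in>{0<..}. \<integral>\<^sup>+ x. ennreal ((cmod (f (Complex x y)))^2) \<partial>lborel"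
  have "f holomorphic_on upper_half_plane" and fin: "?S < \<infinity>" using assms by (auto simp: hardy2_def)
  moreover have "slice_energy f y \<le> ennreal (enn2real ?S)"
    if "y > 0" for y
  proof -
    have "slice_energy f y \<le> ?S"
      using that by (intro SUP_upper) auto
    then show ?thesis using fin by simp
  qed
  ultimately show ?thesis using that[of "enn2real ?S"] by (simp add: enn2real_nonneg)
qed

lemma hardy2I:
  assumes "f holomorphic_on upper_half_plane"
    "\<And>y. y > 0 \<Longrightarrow> slice_energy f y \<le> ennreal M"
  shows "f \<in> hardy2"
proof -
  have "(SUP y\<in>{0<..}. \<integral>\<^sup>+ x. ennreal ((cmod (f (Complex x y)))^2) \<partial>lborel) \<le> ennreal M"
    using assms(2) by (intro SUP_least) auto
  also have "\<dots> < \<infinity>" by simp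
  finally show ?thesis using assms(1) by (simp add: hardy2_def)
qed

lemma entire_sharp: "entire F \<Longrightarrow> entire (sharp F)"
  unfolding entire_def sharp_def using holomorphic_on_compose_cnj_cnj[of F UNIV]
  by (simp add: o_def image_cnj_conv_vimage_cnj)

lemma entire_continuous_on: "entire F \<Longrightarrow> continuous_on A F"
  unfolding entire_def by (metis holomorphic_on_imp_continuous_on continuous_on_subset subset_UNIV)

lemma sharp_sharp [simp]: "sharp (sharp F) = F"
  by (simp add: sharp_def)

lemma cmod_sharp_of_real [simp]: "cmod (sharp F (of_real x)) = cmod (F (of_real x))"
  by (simp add: sharp_def)

lemma de_branges_entire: "F \<in> de_branges E \<Longrightarrow> entire F"
  by (simp add: de_branges_def)

lemma de_branges_sharp: "F \<in> de_branges E \<Longrightarrow> sharp F \<in> de_branges E"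
  by (simp add: de_branges_def entire_sharp)

text \<open>
  The square of the norm. Constant factors are immaterial for the estimates below, so the
  elementary \<open>(a + b)\<^sup>2 \<le> 2 a\<^sup>2 + 2 b\<^sup>2\<close> takes the place of the triangle inequality.
\<close>

definition energy :: "(complex \<Rightarrow> complex) \<Rightarrow> (complex \<Rightarrow> complex) \<Rightarrow> real" where
  "energy E F = (LINT t|lborel. (cmod (F (of_real t) / E (of_real t)))^2)"

lemma energy_nonneg [simp]: "0 \<le> energy E F"
  by (simp add: energy_def)

lemma db_norm_eq_sqrt_energy: "db_norm E F = sqrt (energy E F)"
  by (simp add: db_norm_def energy_def)

lemma energy_sharp [simp]: "energy E (sharp F) = energy E F"
  by (simp add: energy_def norm_divide)

locale polynomial_de_branges =
  fixes E :: "complex \<Rightarrow> complex"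
  assumes hermite_biehler: "hermite_biehler E"
    and poly_mem: "\<And>p :: complex poly. poly p \<in> de_branges E"
begin

abbreviation quot :: "(complex \<Rightarrow> complex) \<Rightarrow> complex \<Rightarrow> complex" where
  "quot F \<equiv> \<lambda>z. F z / E z"

lemma E_entire: "entire E"
  using hermite_biehler by (simp add: hermite_biehler_def)

lemma E_nonzero_upper: "Im z > 0 \<Longrightarrow> E z \<noteq> 0"
  using hermite_biehler by (fastforce simp: hermite_biehler_def upper_half_plane_def)

text \<open>
  The constant function \<open>1\<close> lies in the space, so \<open>1 / E\<close> grows at most like \<open>y\<^sup>-\<^sup>1\<^sup>/\<^sup>2\<close> towards
  the real line, which excludes even a simple zero.
\<close>

lemma E_nonzero_real: "E (of_real x) \<noteq> 0"
proof
  assume E0: "E (of_real x) = 0"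
  have "poly [:1:] \<in> de_branges E" by (rule poly_mem)
  then have "(\<lambda>z. 1 / E z) \<in> hardy2" by (simp add: de_branges_def)
  then obtain M where M: "0 \<le> M" "(\<lambda>z. 1 / E z) holomorphic_on upper_half_plane"
    "\<And>y. y > 0 \<Longrightarrow> slice_energy (\<lambda>z. 1 / E z) y \<le> ennreal M"
    using hardy2D by blast
  \<comment> \<open>the difference quotient of \<open>E\<close> at its zero, which stays bounded\<close>
  define q where "q h = E (of_real x + h) / h" for h
  have "(E has_field_derivative deriv E (of_real x)) (at (of_real x))"
    using E_entire unfolding entire_def by (intro holomorphic_derivI) auto
  then have q: "(q \<longlongrightarrow> deriv E (of_real x)) (at 0)"
    unfolding q_def DERIV_def by (simp add: E0)
  have "1 \<le> 9 * M * (y * (cmod (q (\<i> * of_real y)))^2)" if y: "y > 0" for y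
  proof -
    let ?z = "of_real x + \<i> * of_real y"
    have "(cmod (1 / E ?z))^2 * Im ?z \<le> 9 * M"
      using y by (intro hardy_pointwise_bound[OF M(2,1,3)]) auto
    moreover have "E ?z \<noteq> 0" using y by (intro E_nonzero_upper) simp
    ultimately have "y \<le> 9 * M * (cmod (E ?z))^2" by (simp add: norm_divide power_divide divide_le_eq)
    also have "E ?z = \<i> * of_real y * q (\<i> * of_real y)" using y by (simp add: q_def)
    also have "(cmod (\<i> * of_real y * q (\<i> * of_real y)))^2 = y^2 * (cmod (q (\<i> * of_real y)))^2"
      by (simp add: norm_mult power_mult_distrib)
    finally show ?thesis using y by (simp add: power2_eq_square mult_ac)
  qed
  then have ev: "\<forall>\<^sub>F y in at_right 0. 1 \<le> 9 * M * (y * (cmod (q (\<i> * of_real y)))^2)"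
    by (auto simp: eventually_at_right_field intro!: exI[of _ 1])
  have f0: "filterlim (\<lambda>y. \<i> * of_real y) (at (0::complex)) (at_right 0)"
    unfolding filterlim_at by (auto intro!: tendsto_eq_intros simp: eventually_at_right_field intro: exI[of _ 1])
  have "((\<lambda>y. 9 * M * (y * (cmod (q (\<i> * of_real y)))^2)) \<longlongrightarrow> 9 * M * (0 * (cmod (deriv E (of_real x)))^2)) (at_right 0)"
    by (intro tendsto_intros filterlim_compose[OF q f0])
  then have "1 \<le> 9 * M * (0 * (cmod (deriv E (of_real x)))^2)"
    by (rule tendsto_lowerbound[OF _ ev]) simp
  then show False by simp
qed

lemma E_nonzero: "0 \<le> Im z \<Longrightarrow> E z \<noteq> 0"
  using E_nonzero_upper[of z] E_nonzero_real[of "Re z"]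
  by (cases "Im z = 0") (auto simp: complex_is_Real_iff)

lemma quotient_continuous: "entire F \<Longrightarrow> continuous_on {w. 0 \<le> Im w} (quot F)"
  using E_nonzero by (intro continuous_on_divide entire_continuous_on E_entire) auto

lemma quotient_holomorphic: "entire F \<Longrightarrow> quot F holomorphic_on upper_half_plane"
  using E_entire E_nonzero_upper unfolding entire_def upper_half_plane_def
  by (intro holomorphic_on_divide) (auto intro: holomorphic_on_subset)

lemma slice_measurable:
  assumes "entire F" "0 \<le> y"
  shows "(\<lambda>x. (cmod (quot F (Complex x y)))^2) \<in> borel_measurable borel"
proof (rule borel_measurable_continuous_onI)
  have "continuous_on UNIV (\<lambda>x. quot F (Complex x y))"
    using assms(2) by (intro continuous_on_compose2[OF quotient_continuous[OF assms(1)]])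
       (auto simp: Complex_eq intro!: continuous_intros)
  then show "continuous_on UNIV (\<lambda>x. (cmod (quot F (Complex x y)))^2)"
    by (intro continuous_on_power continuous_on_norm)
qed

lemma real_line_measurable:
  assumes "entire F"
  shows "(\<lambda>t. quot F (of_real t)) \<in> borel_measurable borel"
proof (rule borel_measurable_continuous_onI)
  show "continuous_on UNIV (\<lambda>x. quot F (of_real x))"
    by (intro continuous_on_compose2[OF quotient_continuous[OF assms]]) (auto intro!: continuous_intros)
qed

text \<open>
  The slices converge pointwise to the boundary values because \<open>E\<close> has no zeros on the real line.
\<close>

lemma boundary_nn_integral_le:
  assumes F: "entire F"
    and bd: "\<And>y. y > 0 \<Longrightarrow> slice_energy (quot F) y \<le> ennreal M"
  shows "(\<integral>\<^sup>+x. ennreal ((cmod (quot F (of_real x)))^2) \<partial>lborel) \<le> ennreal M"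
proof (rule nn_integral_le_of_tendsto[where
      u = "\<lambda>n x. (cmod (quot F (Complex x (1 / Suc n))))^2"])
  fix n show "(\<lambda>x. (cmod (quot F (Complex x (1 / Suc n))))^2) \<in> borel_measurable lborel"
    using slice_measurable[OF F, of "1 / Suc n"] by simp
  show "slice_energy (quot F) (1 / Suc n) \<le> ennreal M"
    by (rule bd) simp
next
  fix x :: real
  have "(\<lambda>n. of_real x + \<i> * of_real (1 / Suc n)) \<longlonglongrightarrow> (of_real x + \<i> * of_real 0 :: complex)"
    using LIMSEQ_inverse_real_of_nat by (intro tendsto_intros) (simp add: inverse_eq_divide)
  then have l: "(\<lambda>n. Complex x (1 / Suc n)) \<longlonglongrightarrow> of_real x" by (simp add: Complex_eq)
  have "isCont F (of_real x)" "isCont E (of_real x)"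
    using entire_continuous_on[OF F, of UNIV] entire_continuous_on[OF E_entire, of UNIV]
    by (auto simp: continuous_on_eq_continuous_at)
  then show "(\<lambda>n. (cmod (quot F (Complex x (1 / Suc n))))^2)
      \<longlonglongrightarrow> (cmod (quot F (of_real x)))^2"
    by (intro tendsto_intros isCont_tendsto_compose[OF _ l] E_nonzero_real)
qed

text \<open>
  Membership in the Hardy space gives only some bound on the slices; the boundary norm is the
  sharp one.
\<close>

lemma
  assumes F: "F \<in> de_branges E"
  shows energy_integrable: "integrable lborel (\<lambda>t. (cmod (quot F (of_real t)))^2)"
    and slice_le_energy: "y > 0 \<Longrightarrow>
      slice_energy (quot F) y \<le> ennreal (energy E F)"
proof -
  have ent: "entire F" and h: "quot F \<in> hardy2" using F by (auto simp: de_branges_def)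
  from h obtain M where M: "0 \<le> M"
    "\<And>y. y > 0 \<Longrightarrow> slice_energy (quot F) y \<le> ennreal M"
    using hardy2D by blast
  have nn: "(\<integral>\<^sup>+x. ennreal ((cmod (quot F (of_real x)))^2) \<partial>lborel) \<le> ennreal M"
    by (rule boundary_nn_integral_le[OF ent M(2)])
  have meas: "(\<lambda>t. (cmod (quot F (of_real t)))^2) \<in> borel_measurable lborel"
    using real_line_measurable[OF ent] by simp
  show int: "integrable lborel (\<lambda>t. (cmod (quot F (of_real t)))^2)"
  proof (rule integrableI_nonneg[OF meas])
    show "(\<integral>\<^sup>+x. ennreal ((cmod (quot F (of_real x)))^2) \<partial>lborel) < \<infinity>"
      using nn by (rule order.strict_trans1) simp
  qed auto
  have N: "(\<integral>\<^sup>+x. ennreal ((cmod (quot F (of_real x)))^2) \<partial>lborel) \<le> ennreal (energy E F)"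
    unfolding energy_def by (subst nn_integral_eq_integral[OF int]) auto
  show "slice_energy (quot F) y \<le> ennreal (energy E F)"
    if "y > 0"
    by (rule hardy_norm_le_boundary_norm[OF quotient_continuous[OF ent] quotient_holomorphic[OF ent] M(2)
          N M(1) energy_nonneg that])
qed

lemma energy_bound_upper:
  assumes F: "F \<in> de_branges E" and z: "0 < Im z"
  shows "(cmod (F z))^2 * Im z \<le> 9 * energy E F * (cmod (E z))^2"
proof -
  have "(cmod (quot F z))^2 * Im z \<le> 9 * energy E F"
    by (rule hardy_pointwise_bound[OF quotient_holomorphic energy_nonneg slice_le_energy z])
       (use F in \<open>auto simp: de_branges_entire\<close>)
  then show ?thesis
    using E_nonzero_upper[OF z] by (simp add: norm_divide power_divide divide_le_eq)
qed

text \<open>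
  The bounds in the two half-planes blow up at the real line like \<open>|Im z|\<^sup>-\<^sup>1\<^sup>/\<^sup>2\<close>. On the circle
  \<open>|z| = S\<close> the factor \<open>z\<^sup>2 - S\<^sup>2\<close> has modulus \<open>2 S |Im z|\<close> and compensates for this, so the
  maximum principle applies to the product.
\<close>

lemma energy_bound_local:
  assumes R: "R > 0"
  shows "\<exists>C\<ge>0. \<forall>F\<in>de_branges E. \<forall>z. cmod z \<le> R \<longrightarrow> (cmod (F z))^2 \<le> C * energy E F"
proof -
  define S where "S = 2 * R"
  have S: "S > 0" using R by (simp add: S_def)
  have "compact (E ` cball 0 S)" by (intro compact_continuous_image entire_continuous_on E_entire compact_cball)
  then obtain B where B: "\<And>z. cmod z \<le> S \<Longrightarrow> cmod (E z) \<le> B"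
    using compact_imp_bounded bounded_iff by (metis imageI mem_cball_0)
  have B0: "B \<ge> 0" using B[of 0] S order_trans[OF norm_ge_zero B[of 0]] by simp
  define C where "C = 36 * S ^ 3 * B^2 / (3 * R^2)^2"
  have "(cmod (F z))^2 \<le> C * energy E F" if F: "F \<in> de_branges E" and z: "cmod z \<le> R" for F z
  proof -
    have ent: "entire F" using F by (rule de_branges_entire)
    define k where "k w = F w * (w^2 - of_real (S^2))" for w
    \<comment> \<open>the lower half-plane is reached through \<open>sharp F\<close>\<close>
    have strip: "(cmod (F w))^2 * \<bar>Im w\<bar> \<le> 9 * energy E F * B^2" if w: "cmod w \<le> S" for w
    proof -
      have B2: "9 * energy E F * (cmod (E v))^2 \<le> 9 * energy E F * B^2" if "cmod v \<le> S" for v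
        using B[OF that] by (intro mult_left_mono power_mono) auto
      consider "Im w > 0" | "Im w < 0" | "Im w = 0" by linarith
      then show ?thesis
      proof cases
        case 1 then show ?thesis using energy_bound_upper[OF F 1] B2[OF w] by simp
      next
        case 2
        have "cmod (sharp F (cnj w)) = cmod (F w)" by (simp add: sharp_def)
        then show ?thesis
          using 2 energy_bound_upper[OF de_branges_sharp[OF F], of "cnj w"] B2[of "cnj w"] w by simp
      qed simp
    qed
    define K where "K = sqrt (36 * S ^ 3 * B^2 * energy E F)"
    have circle: "cmod (k w) \<le> K" if w: "cmod w = S" for w
    proof -
      have "w^2 - of_real (S^2) = w * (w - cnj w)"
        using w by (simp add: algebra_simps power2_eq_square complex_norm_square[symmetric] flip: of_real_mult)
      also have "w - cnj w = \<i> * of_real (2 * Im w)" by (simp add: complex_eq_iff)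
      finally have "cmod (w^2 - of_real (S^2)) = S * (2 * \<bar>Im w\<bar>)" using w by (simp add: norm_mult)
      then have "(cmod (k w))^2 = 4 * S^2 * \<bar>Im w\<bar> * ((cmod (F w))^2 * \<bar>Im w\<bar>)"
        by (simp add: k_def norm_mult power_mult_distrib power2_eq_square)
      also have "\<dots> \<le> 4 * S^2 * S * (9 * energy E F * B^2)"
      proof (rule mult_mono)
        show "4 * S^2 * \<bar>Im w\<bar> \<le> 4 * S^2 * S"
          using abs_Im_le_cmod[of w] w by (intro mult_left_mono) auto
      qed (use S w strip[of w] in auto)
      also have "\<dots> = 36 * S ^ 3 * B^2 * energy E F" by (simp add: power2_eq_square power3_eq_cube)
      finally show ?thesis unfolding K_def by (rule real_le_rsqrt)
    qed
    have "cmod (k z) \<le> K"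
    proof (rule maximum_modulus_frontier[where S = "cball 0 S" and f = k])
      show "k holomorphic_on interior (cball 0 S)"
        using ent unfolding k_def entire_def by (auto intro!: holomorphic_intros intro: holomorphic_on_subset)
      show "continuous_on (closure (cball 0 S)) k"
        unfolding k_def by (intro continuous_intros entire_continuous_on ent)
      show "cmod (k w) \<le> K" if "w \<in> frontier (cball 0 S)" for w
        using that by (intro circle) auto
      show "z \<in> cball 0 S" using z R by (simp add: S_def)
    qed auto
    then have "(cmod (k z))^2 \<le> 36 * S ^ 3 * B^2 * energy E F"
      using S power_mono[of "cmod (k z)" K 2] by (simp add: K_def)
    moreover have "3 * R^2 \<le> cmod (z^2 - of_real (S^2))"
    proof -
      have "cmod (of_real (S^2)) - cmod (z^2) \<le> cmod (of_real (S^2) - z^2)" by (rule norm_triangle_ineq2)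
      moreover have "cmod (z^2) \<le> R^2" using z by (simp add: norm_power power_mono)
      ultimately show ?thesis by (simp add: S_def norm_minus_commute power_mult_distrib norm_power)
    qed
    then have "(cmod (F z))^2 * (3 * R^2)^2 \<le> (cmod (k z))^2"
      unfolding k_def norm_mult power_mult_distrib[of "cmod (F z)"]
      by (intro mult_left_mono power_mono) auto
    ultimately show ?thesis using R by (simp add: C_def field_simps)
  qed
  moreover have "C \<ge> 0" using S by (simp add: C_def)
  ultimately show ?thesis by blast
qed

text \<open>
  Fatou's lemma on every horizontal line, and on the real line for the norm.
\<close>

lemma de_branges_closed_pointwise:
  assumes F: "\<And>n. F n \<in> de_branges E" and bd: "\<And>n. energy E (F n) \<le> B"
    and lim: "\<And>z. (\<lambda>n. F n z) \<longlonglongrightarrow> G z" and G: "entire G"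
  shows "G \<in> de_branges E" "energy E G \<le> B"
proof -
  have B0: "B \<ge> 0" using bd[of 0] energy_nonneg order_trans by blast
  have hardy: "quot G \<in> hardy2"
    if F: "\<And>n. F n \<in> de_branges E" and bd: "\<And>n. energy E (F n) \<le> B"
      and lim: "\<And>z. (\<lambda>n. F n z) \<longlonglongrightarrow> G z" and G: "entire G" for F :: "nat \<Rightarrow> complex \<Rightarrow> complex" and G
  proof (rule hardy2I[OF quotient_holomorphic[OF G]])
    fix y :: real assume y: "y > 0"
    show "slice_energy (quot G) y \<le> ennreal B"
    proof (rule nn_integral_le_of_tendsto[where u = "\<lambda>n x. (cmod (quot (F n) (Complex x y)))^2"])
      show "(\<lambda>x. (cmod (quot (F n) (Complex x y)))^2) \<in> borel_measurable lborel" for n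
        using slice_measurable[OF de_branges_entire[OF F], of y n] y by simp
      show "slice_energy (quot (F n)) y \<le> ennreal B" for n
        using slice_le_energy[OF F y, of n] ennreal_leI[OF bd[of n]] by (rule order_trans)
      show "(\<lambda>n. (cmod (quot (F n) (Complex x y)))^2) \<longlonglongrightarrow> (cmod (quot G (Complex x y)))^2" for x
        using E_nonzero_upper[of "Complex x y"] y by (intro tendsto_intros lim) auto
    qed
  qed
  have "(\<lambda>z. sharp G z / E z) \<in> hardy2"
  proof (rule hardy[where F = "\<lambda>n. sharp (F n)"])
    show "(\<lambda>n. sharp (F n) z) \<longlonglongrightarrow> sharp G z" for z
      unfolding sharp_def by (intro tendsto_intros lim)
  qed (use F bd G in \<open>auto intro: de_branges_sharp entire_sharp\<close>)
  with hardy[OF F bd lim G] G show GM: "G \<in> de_branges E" by (simp add: de_branges_def)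
  have "ennreal (energy E G) = (\<integral>\<^sup>+t. ennreal ((cmod (quot G (of_real t)))^2) \<partial>lborel)"
    unfolding energy_def by (subst nn_integral_eq_integral[OF energy_integrable[OF GM]]) auto
  also have "\<dots> \<le> ennreal B"
  proof (rule nn_integral_le_of_tendsto[where u = "\<lambda>n t. (cmod (quot (F n) (of_real t)))^2"])
    show "(\<lambda>t. (cmod (quot (F n) (of_real t)))^2) \<in> borel_measurable lborel" for n
      using real_line_measurable[OF de_branges_entire[OF F], of n] by simp
    show "(\<integral>\<^sup>+t. ennreal ((cmod (quot (F n) (of_real t)))^2) \<partial>lborel) \<le> ennreal B" for n
      using bd[of n] energy_integrable[OF F, of n]
      by (subst nn_integral_eq_integral) (auto simp: energy_def intro!: ennreal_leI)
    show "(\<lambda>n. (cmod (quot (F n) (of_real t)))^2) \<longlonglongrightarrow> (cmod (quot G (of_real t)))^2" for t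
      by (intro tendsto_intros lim E_nonzero_real)
  qed
  finally show "energy E G \<le> B" using B0 by (simp add: ennreal_le_iff)
qed

lemma hardy2_quotient_add:
  assumes "quot F \<in> hardy2" "quot G \<in> hardy2" "entire F" "entire G"
  shows "(\<lambda>z. (F z + c * G z) / E z) \<in> hardy2"
proof -
  from assms(1) obtain M where M: "0 \<le> M"
    "\<And>y. y > 0 \<Longrightarrow> slice_energy (quot F) y \<le> ennreal M"
    using hardy2D by blast
  from assms(2) obtain N where N: "0 \<le> N"
    "\<And>y. y > 0 \<Longrightarrow> slice_energy (quot G) y \<le> ennreal N"
    using hardy2D by blast
  show ?thesis
  proof (rule hardy2I)
    show "(\<lambda>z. (F z + c * G z) / E z) holomorphic_on upper_half_plane"
      using assms(3,4) by (intro quotient_holomorphic) (auto simp: entire_def intro!: holomorphic_intros)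
    fix y :: real assume y: "y > 0"
    let ?f = "\<lambda>x. quot F (Complex x y)" and ?g = "\<lambda>x. quot G (Complex x y)"
    have [measurable]: "(\<lambda>x. (cmod (?f x))^2) \<in> borel_measurable borel"
      "(\<lambda>x. (cmod (?g x))^2) \<in> borel_measurable borel"
      using slice_measurable assms(3,4) y by auto
    have "(\<integral>\<^sup>+x. ennreal ((cmod ((F (Complex x y) + c * G (Complex x y)) / E (Complex x y)))^2) \<partial>lborel)
      \<le> (\<integral>\<^sup>+x. ennreal 2 * ennreal ((cmod (?f x))^2)
          + ennreal (2 * (cmod c)^2) * ennreal ((cmod (?g x))^2) \<partial>lborel)"
    proof (intro nn_integral_mono)
      fix x
      let ?a = "?f x" and ?b = "c * (?g x)"
      have "(cmod (?a + ?b))^2 \<le> (cmod ?a + cmod ?b)^2" by (intro power_mono norm_triangle_ineq) auto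
      also have "\<dots> \<le> 2 * (cmod ?a)^2 + 2 * (cmod ?b)^2"
        using sum_squares_bound[of "cmod ?a" "cmod ?b"] by (simp add: power2_sum)
      also have "\<dots> = 2 * (cmod ?a)^2 + 2 * (cmod c)^2 * (cmod (?g x))^2"
        unfolding norm_mult power_mult_distrib by simp
      finally have "(cmod ((F (Complex x y) + c * G (Complex x y)) / E (Complex x y)))^2
          \<le> 2 * (cmod ?a)^2 + 2 * (cmod c)^2 * (cmod (?g x))^2"
        unfolding add_divide_distrib by simp
      moreover have "ennreal 2 * ennreal A + ennreal k * ennreal A' = ennreal (2 * A + k * A')"
        if "A \<ge> 0" "k \<ge> 0" "A' \<ge> 0" for A k A'
        using that by (simp add: ennreal_mult)
      ultimately show "ennreal ((cmod ((F (Complex x y) + c * G (Complex x y)) / E (Complex x y)))^2)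
         \<le> ennreal 2 * ennreal ((cmod (?f x))^2)
          + ennreal (2 * (cmod c)^2) * ennreal ((cmod (?g x))^2)"
        by (simp only: ennreal_leI zero_le_power2 mult_nonneg_nonneg zero_le_numeral)
    qed
    also have "\<dots> = ennreal 2 * (slice_energy (quot F) y)
        + ennreal (2 * (cmod c)^2) * (slice_energy (quot G) y)"
      by (subst nn_integral_add) (auto simp: nn_integral_cmult)
    also have "\<dots> \<le> ennreal 2 * ennreal M + ennreal (2 * (cmod c)^2) * ennreal N"
      using M(2)[OF y] N(2)[OF y] by (intro add_mono mult_left_mono) auto
    also have "\<dots> = ennreal (2 * M + 2 * (cmod c)^2 * N)"
      using M(1) N(1) by (simp add: ennreal_mult)
    finally show "(\<integral>\<^sup>+x. ennreal ((cmod ((F (Complex x y) + c * G (Complex x y)) / E (Complex x y)))^2) \<partial>lborel)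
        \<le> ennreal (2 * M + 2 * (cmod c)^2 * N)" .
  qed
qed

lemma de_branges_add_cmult:
  assumes "F \<in> de_branges E" "G \<in> de_branges E"
  shows "(\<lambda>z. F z + c * G z) \<in> de_branges E"
proof -
  have "sharp (\<lambda>z. F z + c * G z) = (\<lambda>z. sharp F z + cnj c * sharp G z)" by (simp add: sharp_def fun_eq_iff)
  moreover have "entire (\<lambda>z. F z + c * G z)"
    using assms by (auto simp: de_branges_def entire_def intro!: holomorphic_intros)
  ultimately show ?thesis
    using assms hardy2_quotient_add[of F G] hardy2_quotient_add[of "sharp F" "sharp G"] entire_sharp
    by (auto simp: de_branges_def)
qed

lemma zero_mem: "(\<lambda>z. 0) \<in> de_branges E"
  using poly_mem[of 0] by (simp add: poly_0[abs_def] del: poly_0)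

lemma de_branges_sum:
  assumes "finite J" "\<And>n. n \<in> J \<Longrightarrow> g n \<in> de_branges E"
  shows "(\<lambda>z. \<Sum>n\<in>J. a n * g n z) \<in> de_branges E"
  using assms
proof (induction J rule: finite_induct)
  case empty then show ?case by (simp add: zero_mem)
next
  case (insert x J)
  then have "(\<lambda>z. (\<Sum>n\<in>J. a n * g n z) + a x * g x z) \<in> de_branges E"
    by (intro de_branges_add_cmult) auto
  then show ?case using insert by (simp add: add.commute)
qed

lemma de_branges_diff_sum:
  assumes "F \<in> de_branges E" "finite J" "\<And>n. n \<in> J \<Longrightarrow> g n \<in> de_branges E"
  shows "(\<lambda>z. F z - (\<Sum>n\<in>J. a n * g n z)) \<in> de_branges E"
  using de_branges_add_cmult[OF assms(1) de_branges_sum[OF assms(2), of g a], of "-1"] assms(3) by simp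

end

section \<open>Expansions in a spectral basis\<close>

context polynomial_de_branges begin

lemma inner_integrable:
  assumes "F \<in> de_branges E" "G \<in> de_branges E"
  shows "integrable lborel (\<lambda>t. quot F (of_real t) * cnj (quot G (of_real t)))"
proof -
  define u where "u t = quot F (of_real t)" for t :: real
  define v where "v t = quot G (of_real t)" for t :: real
  have [measurable]: "u \<in> borel_measurable borel" "v \<in> borel_measurable borel"
    using assms unfolding u_def[abs_def] v_def[abs_def] by (auto intro!: real_line_measurable de_branges_entire)
  have [measurable]: "cnj \<in> borel_measurable borel"
    by (intro borel_measurable_continuous_onI continuous_intros)
  have "integrable lborel (\<lambda>t. u t * cnj (v t))"
  proof (rule Bochner_Integration.integrable_bound)
    show "integrable lborel (\<lambda>t. (cmod (u t))^2 + (cmod (v t))^2)"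
      unfolding u_def v_def using assms by (intro Bochner_Integration.integrable_add energy_integrable)
    show "AE t in lborel. cmod (u t * cnj (v t)) \<le> norm ((cmod (u t))^2 + (cmod (v t))^2)"
    proof (rule AE_I2)
      fix t :: real
      have "a * b \<le> a^2 + b^2" if "0 \<le> a" "0 \<le> b" for a b :: real
        using sum_squares_bound[of a b] zero_le_mult_iff[of a b] that by linarith
      then show "cmod (u t * cnj (v t)) \<le> norm ((cmod (u t))^2 + (cmod (v t))^2)"
        by (simp add: norm_mult)
    qed
  qed measurable
  then show ?thesis by (simp only: u_def v_def)
qed

lemma db_inner_diff_cmult:
  assumes "F \<in> de_branges E" "G \<in> de_branges E" "H \<in> de_branges E"
  shows "db_inner E (\<lambda>z. F z - c * G z) H = db_inner E F H - c * db_inner E G H"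
proof -
  define u where "u t = quot F (of_real t) * cnj (quot H (of_real t))" for t :: real
  define v where "v t = quot G (of_real t) * cnj (quot H (of_real t))" for t :: real
  have I: "integrable lborel u" "integrable lborel v"
    unfolding u_def[abs_def] v_def[abs_def] using assms by (blast intro: inner_integrable)+
  have "db_inner E (\<lambda>z. F z - c * G z) H = (LINT t|lborel. u t - c * v t)"
    unfolding db_inner_def u_def v_def
    by (intro Bochner_Integration.integral_cong) (auto simp: diff_divide_distrib algebra_simps)
  also have "\<dots> = (LINT t|lborel. u t) - c * (LINT t|lborel. v t)"
    using I by (simp add: Bochner_Integration.integral_diff)
  finally show ?thesis by (simp only: db_inner_def u_def v_def)
qed

lemma energy_diff_cmult:
  assumes "F \<in> de_branges E" "G \<in> de_branges E"
  shows "energy E (\<lambda>z. F z - c * G z) = energy E F - 2 * Re (cnj c * db_inner E F G) + (cmod c)^2 * energy E G"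
proof -
  define u where "u t = quot F (of_real t)" for t :: real
  define v where "v t = quot G (of_real t)" for t :: real
  have I: "integrable lborel (\<lambda>t. (cmod (u t))^2)" "integrable lborel (\<lambda>t. (cmod (v t))^2)"
     "integrable lborel (\<lambda>t. u t * cnj (v t))"
    unfolding u_def v_def
    using energy_integrable[OF assms(1)] energy_integrable[OF assms(2)] inner_integrable[OF assms] by simp_all
  have J: "integrable lborel (\<lambda>t. cnj c * (u t * cnj (v t)))" using I(3) by (rule integrable_mult_right)
  have alg: "(cmod (a - c * b))^2 = (cmod a)^2 - 2 * Re (cnj c * (a * cnj b)) + (cmod c)^2 * (cmod b)^2" for a b
    unfolding cmod_power2 by (simp add: algebra_simps power2_eq_square)
  have "energy E (\<lambda>z. F z - c * G z) = (LINT t|lborel. (cmod (u t - c * v t))^2)"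
    unfolding energy_def u_def v_def
    by (intro Bochner_Integration.integral_cong) (auto simp: diff_divide_distrib)
  also have "\<dots> = (LINT t|lborel. (cmod (u t))^2) - 2 * (LINT t|lborel. Re (cnj c * (u t * cnj (v t))))
       + (cmod c)^2 * (LINT t|lborel. (cmod (v t))^2)"
    unfolding alg using I(1,2) integrable_Re[OF J]
    by (simp add: Bochner_Integration.integral_add Bochner_Integration.integral_diff
        del: times_complex.sel)
  also have "(LINT t|lborel. Re (cnj c * (u t * cnj (v t)))) = Re (cnj c * (LINT t|lborel. u t * cnj (v t)))"
    using integral_Re[OF J] by (simp only: integral_mult_right_zero)
  finally show ?thesis by (simp only: db_inner_def energy_def u_def v_def)
qed

lemma energy_zero [simp]: "energy E (\<lambda>z. 0) = 0" by (simp add: energy_def)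

lemma energy_eq_0D:
  assumes "F \<in> de_branges E" "energy E F = 0"
  shows "F z = 0"
proof -
  obtain C where "\<forall>F\<in>de_branges E. \<forall>w. cmod w \<le> cmod z + 1 \<longrightarrow> (cmod (F w))^2 \<le> C * energy E F"
    using energy_bound_local[of "cmod z + 1"] norm_ge_zero[of z] by (metis add_nonneg_pos zero_less_one)
  then have "(cmod (F z))^2 \<le> C * energy E F" using assms(1) by simp
  then show ?thesis using assms(2) by simp
qed

end

locale spectral_basis = polynomial_de_branges E for E +
  fixes I :: "'i set" and t \<nu> :: "'i \<Rightarrow> real" and A :: "complex \<Rightarrow> complex"
  assumes A_entire: "entire A"
    and zeros: "{z. A z = 0} = (\<lambda>n. of_real (t n)) ` I"
    and inj: "inj_on t I"
    and simple: "\<And>n. n \<in> I \<Longrightarrow> deriv A (of_real (t n)) \<noteq> 0"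
    and weight_pos: "\<And>n. n \<in> I \<Longrightarrow> 0 < \<nu> n"
    and basis: "db_orthonormal_basis E I (\<lambda>n. spectral_function A (t n) (\<nu> n))"
begin

abbreviation g :: "'i \<Rightarrow> complex \<Rightarrow> complex" where
  "g n \<equiv> spectral_function A (t n) (\<nu> n)"

abbreviation coef :: "(complex \<Rightarrow> complex) \<Rightarrow> 'i \<Rightarrow> complex" where
  "coef F n \<equiv> db_inner E F (g n)"

abbreviation residual ::
    "(complex \<Rightarrow> complex) \<Rightarrow> ('i \<Rightarrow> complex) \<Rightarrow> 'i set \<Rightarrow> complex \<Rightarrow> complex" where
  "residual F a J \<equiv> \<lambda>z. F z - (\<Sum>n\<in>J. a n * g n z)"

lemma g_mem: "n \<in> I \<Longrightarrow> g n \<in> de_branges E"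
  using basis by (simp add: db_orthonormal_basis_def)

lemma g_orthonormal: "m \<in> I \<Longrightarrow> n \<in> I \<Longrightarrow> db_inner E (g m) (g n) = (if m = n then 1 else 0)"
  using basis by (simp add: db_orthonormal_basis_def)

lemma energy_g: "n \<in> I \<Longrightarrow> energy E (g n) = 1"
proof -
  assume n: "n \<in> I"
  have "of_real (energy E (g n)) = db_inner E (g n) (g n)"
    unfolding energy_def db_inner_def complex_norm_square[symmetric] of_real_power[symmetric]
    by (rule integral_complex_of_real[symmetric])
  also have "\<dots> = 1" using g_orthonormal[OF n n] by simp
  finally show ?thesis by simp
qed

lemma coef_diff_sum:
  assumes F: "F \<in> de_branges E" and "finite J" "J \<subseteq> I" "n \<in> I" "n \<notin> J"
  shows "db_inner E (residual F a J) (g n) = coef F n"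
  using assms(2-)
proof (induction J rule: finite_induct)
  case (insert k J)
  have "db_inner E (residual F a (insert k J)) (g n)
      = db_inner E (\<lambda>z. (F z - (\<Sum>k\<in>J. a k * g k z)) - a k * g k z) (g n)"
    using insert by (simp add: algebra_simps)
  also have "\<dots> = coef F n"
    using insert F g_mem
    by (subst db_inner_diff_cmult) (auto intro!: de_branges_diff_sum simp: g_orthonormal)
  finally show ?case .
qed simp

text \<open>
  Pythagoras: the approximation error splits into the distance to the span and the error in the
  coefficients, so the Fourier coefficients are optimal.
\<close>

lemma energy_diff_expansion:
  assumes F: "F \<in> de_branges E" and "finite J" "J \<subseteq> I"
  shows "energy E (residual F a J)
     = energy E F - (\<Sum>n\<in>J. (cmod (coef F n))^2) + (\<Sum>n\<in>J. (cmod (coef F n - a n))^2)"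
  using assms(2-)
proof (induction J rule: finite_induct)
  case (insert k J)
  have k: "k \<in> I" using insert by simp
  have alg: "- 2 * Re (cnj a * x) + (cmod a)^2 = (cmod (x - a))^2 - (cmod x)^2" for a x
    unfolding cmod_power2 by (simp add: algebra_simps power2_eq_square)
  have "energy E (residual F a (insert k J))
      = energy E (\<lambda>z. (F z - (\<Sum>n\<in>J. a n * g n z)) - a k * g k z)"
    using insert by (simp add: algebra_simps)
  also have "\<dots> = energy E (residual F a J) - 2 * Re (cnj (a k) * coef F k) + (cmod (a k))^2"
    using insert F g_mem k
    by (subst energy_diff_cmult) (auto intro!: de_branges_diff_sum simp: coef_diff_sum energy_g)
  also have "\<dots> = energy E (residual F a J) + (cmod (coef F k - a k))^2 - (cmod (coef F k))^2"
    using alg[of "a k" "coef F k"] by simp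
  finally show ?case using insert by simp
qed simp

lemma bessel:
  assumes "F \<in> de_branges E" "finite J" "J \<subseteq> I"
  shows "(\<Sum>n\<in>J. (cmod (coef F n))^2) \<le> energy E F"
  using energy_diff_expansion[OF assms, of "coef F"] energy_nonneg[of E "\<lambda>z. F z - (\<Sum>n\<in>J. coef F n * g n z)"]
  by simp

text \<open>
  Density of the span yields one good approximation; Fourier coefficients do better, and further
  enlarging the index set only decreases the error.
\<close>

lemma expansion_converges:
  assumes F: "F \<in> de_branges E" and e: "e > 0"
  obtains J where "finite J" "J \<subseteq> I"
    "\<forall>J'. finite J' \<longrightarrow> J' \<subseteq> I \<longrightarrow> J \<subseteq> J' \<longrightarrow> energy E (residual F (coef F) J') < e"
proof -
  have "0 < sqrt e" using e by simp
  from basis[unfolded db_orthonormal_basis_def, THEN conjunct2, THEN conjunct2, rule_format, OF F this]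
  obtain J a where J: "finite J" "J \<subseteq> I" "db_norm E (residual F a J) < sqrt e"
    by (elim exE conjE)
  then have "energy E (residual F a J) < e"
    by (simp add: db_norm_eq_sqrt_energy)
  then have le: "energy E F - (\<Sum>n\<in>J. (cmod (coef F n))^2) < e"
    using energy_diff_expansion[OF F J(1,2), of a] sum_nonneg[of J "\<lambda>n. (cmod (coef F n - a n))^2"] by simp
  show ?thesis
  proof (rule that[OF J(1,2)], intro allI impI)
    fix J' assume J': "finite J'" "J' \<subseteq> I" "J \<subseteq> J'"
    have "(\<Sum>n\<in>J. (cmod (coef F n))^2) \<le> (\<Sum>n\<in>J'. (cmod (coef F n))^2)"
      using J' by (intro sum_mono2) auto
    then show "energy E (residual F (coef F) J') < e"
      using le energy_diff_expansion[OF F J'(1,2), of "coef F"] by simp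
  qed
qed

lemma energy_le_of_coef_bound:
  assumes F: "F \<in> de_branges E"
    and bd: "\<And>J. finite J \<Longrightarrow> J \<subseteq> I \<Longrightarrow> (\<Sum>n\<in>J. (cmod (coef F n))^2) \<le> B"
  shows "energy E F \<le> B"
proof (rule field_le_epsilon)
  fix e :: real assume e: "e > 0"
  obtain J where J: "finite J" "J \<subseteq> I"
     "\<forall>J'. finite J' \<longrightarrow> J' \<subseteq> I \<longrightarrow> J \<subseteq> J' \<longrightarrow> energy E (residual F (coef F) J') < e"
    by (rule expansion_converges[OF F e])
  then show "energy E F \<le> B + e"
    using J(3)[rule_format, OF J(1,2) subset_refl] energy_diff_expansion[OF F J(1,2), of "coef F"] bd[OF J(1,2)] by simp
qed

lemma expansion_pointwise:
  assumes F: "F \<in> de_branges E" and e: "e > 0"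
  obtains J where "finite J" "J \<subseteq> I"
    "\<forall>J'. finite J' \<longrightarrow> J' \<subseteq> I \<longrightarrow> J \<subseteq> J' \<longrightarrow> (cmod (F z - (\<Sum>n\<in>J'. coef F n * g n z)))^2 \<le> e"
proof -
  obtain C where C: "C \<ge> 0" "\<forall>F\<in>de_branges E. \<forall>w. cmod w \<le> cmod z + 1 \<longrightarrow> (cmod (F w))^2 \<le> C * energy E F"
    using energy_bound_local[of "cmod z + 1"] norm_ge_zero[of z] by (metis add_nonneg_pos zero_less_one)
  have eC: "e / (C + 1) > 0" using e C by simp
  obtain J where J: "finite J" "J \<subseteq> I"
     "\<forall>J'. finite J' \<longrightarrow> J' \<subseteq> I \<longrightarrow> J \<subseteq> J' \<longrightarrow> energy E (residual F (coef F) J') < e / (C + 1)"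
    by (rule expansion_converges[OF F eC])
  show ?thesis
  proof (rule that[OF J(1,2)], intro allI impI)
    fix J' assume J': "finite J'" "J' \<subseteq> I" "J \<subseteq> J'"
    have "(cmod (F z - (\<Sum>n\<in>J'. coef F n * g n z)))^2 \<le> C * energy E (residual F (coef F) J')"
    proof (rule C(2)[rule_format])
      show "(residual F (coef F) J') \<in> de_branges E"
        using J'(2) g_mem by (intro de_branges_diff_sum F J'(1)) auto
    qed simp
    also have "\<dots> \<le> (C + 1) * (e / (C + 1))"
      using J(3)[rule_format, OF J'] C(1) by (intro mult_mono) auto
    also have "\<dots> = e" using C(1) by simp
    finally show "(cmod (F z - (\<Sum>n\<in>J'. coef F n * g n z)))^2 \<le> e" .
  qed
qed

lemma A_zero_iff: "A z = 0 \<longleftrightarrow> (\<exists>n\<in>I. z = of_real (t n))"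
  using zeros by blast

lemma g_times_linear: "n \<in> I \<Longrightarrow> g n z * (z - of_real (t n)) = of_real (sqrt (\<nu> n)) * A z"
  using A_zero_iff by (auto simp: spectral_function_def)

lemma g_at_other: "n \<in> I \<Longrightarrow> k \<in> I \<Longrightarrow> k \<noteq> n \<Longrightarrow> g k (of_real (t n)) = 0"
proof -
  assume n: "n \<in> I" and k: "k \<in> I" "k \<noteq> n"
  have "A (of_real (t n)) = 0" using n A_zero_iff by blast
  moreover have "t n \<noteq> t k" using inj n k by (auto dest: inj_onD)
  ultimately show ?thesis using g_times_linear[OF k(1), of "of_real (t n)"] by simp
qed

lemma g_at_self: "g n (of_real (t n)) = of_real (sqrt (\<nu> n)) * deriv A (of_real (t n))"
  by (simp add: spectral_function_def)

lemma g_at_self_nonzero: "n \<in> I \<Longrightarrow> g n (of_real (t n)) \<noteq> 0"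
  using simple weight_pos[of n] by (simp add: g_at_self)

text \<open>
  All basis functions but one vanish at a node, and convergence in norm implies pointwise
  convergence.
\<close>

lemma coef_eq_value:
  assumes F: "F \<in> de_branges E" and n: "n \<in> I"
  shows "F (of_real (t n)) = coef F n * g n (of_real (t n))"
proof -
  have "(cmod (F (of_real (t n)) - coef F n * g n (of_real (t n))))^2 \<le> 0 + e" if e: "e > 0" for e
  proof -
    obtain J where J: "finite J" "J \<subseteq> I"
      "\<forall>J'. finite J' \<longrightarrow> J' \<subseteq> I \<longrightarrow> J \<subseteq> J' \<longrightarrow> (cmod (F (of_real (t n)) - (\<Sum>k\<in>J'. coef F k * g k (of_real (t n)))))^2 \<le> e"
      by (rule expansion_pointwise[OF F e, of "of_real (t n)"])
    have "(\<Sum>k\<in>insert n J. coef F k * g k (of_real (t n))) = (\<Sum>k\<in>{n}. coef F k * g k (of_real (t n)))"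
      using J n g_at_other by (intro sum.mono_neutral_right) auto
    then show ?thesis using J(3)[rule_format, of "insert n J"] J(1,2) n by auto
  qed
  then have "(cmod (F (of_real (t n)) - coef F n * g n (of_real (t n))))^2 \<le> 0" by (rule field_le_epsilon)
  then show ?thesis by simp
qed

text \<open>
  Cauchy-Schwarz for the expansion at \<open>z\<close>; applied to \<open>F = 1\<close> this is a lower bound for \<open>A\<close>.
\<close>

lemma evaluation_bound:
  assumes F: "F \<in> de_branges E" and z: "A z \<noteq> 0"
    and bd: "\<And>J. finite J \<Longrightarrow> J \<subseteq> I \<Longrightarrow> (\<Sum>n\<in>J. \<nu> n / (cmod (z - of_real (t n)))^2) \<le> B"
  shows "(cmod (F z))^2 \<le> energy E F * B * (cmod (A z))^2"
proof -
  have B: "B \<ge> 0" using bd[of "{}"] by simp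
  define K where "K = sqrt (energy E F * B * (cmod (A z))^2)"
  have "cmod (F z) \<le> K + e" if e: "e > 0" for e
  proof -
    have e2: "e^2 > 0" using e by simp
    obtain J where J: "finite J" "J \<subseteq> I"
      "\<forall>J'. finite J' \<longrightarrow> J' \<subseteq> I \<longrightarrow> J \<subseteq> J' \<longrightarrow> (cmod (F z - (\<Sum>k\<in>J'. coef F k * g k z)))^2 \<le> e^2"
      by (rule expansion_pointwise[OF F e2, of z])
    have d: "cmod (F z - (\<Sum>k\<in>J. coef F k * g k z)) \<le> e"
      using J(3)[rule_format, OF J(1,2) subset_refl] e by (simp add: abs_le_square_iff[symmetric])
    have gz: "(cmod (g n z))^2 = (cmod (A z))^2 * (\<nu> n / (cmod (z - of_real (t n)))^2)" if "n \<in> I" for n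
    proof -
      have "z \<noteq> of_real (t n)" using z A_zero_iff that by auto
      then show ?thesis using weight_pos[OF that]
        by (simp add: spectral_function_def norm_mult norm_divide power_mult_distrib power_divide)
    qed
    have "(cmod (\<Sum>k\<in>J. coef F k * g k z))^2 \<le> (\<Sum>k\<in>J. cmod (coef F k) * cmod (g k z))^2"
      by (intro power_mono order_trans[OF norm_sum]) (auto simp: norm_mult)
    also have "\<dots> \<le> (\<Sum>k\<in>J. (cmod (coef F k))^2) * (\<Sum>k\<in>J. (cmod (g k z))^2)"
      by (rule Cauchy_Schwarz_ineq_sum)
    also have "(\<Sum>k\<in>J. (cmod (g k z))^2) = (cmod (A z))^2 * (\<Sum>n\<in>J. \<nu> n / (cmod (z - of_real (t n)))^2)"
      unfolding sum_distrib_left using J(2) gz by (intro sum.cong) auto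
    also have "(\<Sum>k\<in>J. (cmod (coef F k))^2) * \<dots> \<le> energy E F * ((cmod (A z))^2 * B)"
      using bessel[OF F J(1,2)] bd[OF J(1,2)] weight_pos J(2)
      by (intro mult_mono mult_nonneg_nonneg sum_nonneg) (auto simp: less_imp_le subset_iff)
    finally have "cmod (\<Sum>k\<in>J. coef F k * g k z) \<le> K"
      unfolding K_def by (intro real_le_rsqrt) (simp add: mult_ac)
    then show ?thesis using d norm_triangle_ineq2[of "F z" "\<Sum>k\<in>J. coef F k * g k z"] by linarith
  qed
  then have "cmod (F z) \<le> K" by (rule field_le_epsilon)
  then show ?thesis using B power_mono[of "cmod (F z)" K 2] by (simp add: K_def)
qed

text \<open>
  Otherwise the polynomial vanishing at all nodes would have energy \<open>0\<close>.
\<close>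

lemma infinite_index: "infinite I"
proof
  assume fin: "finite I"
  define p where "p = (\<Prod>n\<in>I. [:- of_real (t n), 1:] :: complex poly)"
  have p: "poly p z = (\<Prod>n\<in>I. z - of_real (t n))" for z
    unfolding p_def by (simp add: poly_prod)
  have "coef (poly p) n = 0" if n: "n \<in> I" for n
  proof -
    have "poly p (of_real (t n)) = 0" unfolding p using fin n by auto
    then show ?thesis using coef_eq_value[OF poly_mem n, of p] g_at_self_nonzero[OF n] by simp
  qed
  then have "energy E (poly p) \<le> 0" by (intro energy_le_of_coef_bound poly_mem) (auto intro!: sum_nonpos)
  then have "poly p z = 0" for z
    using energy_eq_0D[OF poly_mem, of p] energy_nonneg[of E "poly p"] by (metis order_antisym)
  moreover obtain z where "z \<notin> (\<lambda>n. of_real (t n) :: complex) ` I"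
    using fin ex_new_if_finite[of "(\<lambda>n. of_real (t n) :: complex) ` I"] infinite_UNIV_char_0 by blast
  ultimately show False using fin p[of z] by auto
qed

end

section \<open>Lacunary point sequences and matrices with geometric decay\<close>

text \<open>
  In truncated subtraction, \<open>(n - k) + (k - n)\<close> is the distance of \<open>n\<close> and \<open>k\<close>.
\<close>

lemma sum_power_dist_le:
  fixes \<theta> :: real
  assumes "0 < \<theta>" "\<theta> < 1" "finite S"
  shows "(\<Sum>k\<in>S. \<theta> ^ ((n - k) + (k - n))) \<le> 2 / (1 - \<theta>)"
proof -
  have geo: "(\<Sum>j\<in>J. \<theta> ^ j) \<le> 1 / (1 - \<theta>)" if "finite J" for J
    using sum_le_suminf[OF summable_geometric[of \<theta>] that] suminf_geometric[of \<theta>] assms by simp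
  have "(\<Sum>k\<in>S. \<theta> ^ ((n - k) + (k - n)))
      = (\<Sum>k\<in>{k\<in>S. k \<le> n}. \<theta> ^ ((n - k) + (k - n))) + (\<Sum>k\<in>{k\<in>S. n < k}. \<theta> ^ ((n - k) + (k - n)))"
    using assms(3) by (subst sum.union_disjoint[symmetric]) (auto intro!: sum.cong)
  also have "(\<Sum>k\<in>{k\<in>S. k \<le> n}. \<theta> ^ ((n - k) + (k - n))) = (\<Sum>j\<in>(\<lambda>k. n - k) ` {k\<in>S. k \<le> n}. \<theta> ^ j)"
    by (subst sum.reindex) (auto intro!: inj_onI sum.cong)
  also have "(\<Sum>k\<in>{k\<in>S. n < k}. \<theta> ^ ((n - k) + (k - n))) = (\<Sum>j\<in>(\<lambda>k. k - n) ` {k\<in>S. n < k}. \<theta> ^ j)"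
    by (subst sum.reindex) (auto intro!: inj_onI sum.cong)
  also have "(\<Sum>j\<in>(\<lambda>k. n - k) ` {k\<in>S. k \<le> n}. \<theta> ^ j) + \<dots> \<le> 1 / (1 - \<theta>) + 1 / (1 - \<theta>)"
    using assms(3) by (intro add_mono geo) auto
  finally show ?thesis by simp
qed

text \<open>
  Geometric decay off the diagonal bounds all row and column sums, and Cauchy-Schwarz does the
  rest. Restriction to finite index sets avoids convergence questions; the constant is uniform.
\<close>

lemma schur_test:
  fixes b :: "nat \<Rightarrow> nat \<Rightarrow> complex" and a :: "nat \<Rightarrow> complex"
  assumes \<theta>: "0 < \<theta>" "\<theta> < 1" and C: "0 \<le> C"
    and b: "\<And>m n. cmod (b m n) \<le> C * \<theta> ^ ((m - n) + (n - m))"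
    and fin: "finite S" "finite J"
  shows "(\<Sum>m\<in>S. (cmod (\<Sum>n\<in>J. b m n * a n))^2) \<le> (C * (2 / (1 - \<theta>)))^2 * (\<Sum>n\<in>J. (cmod (a n))^2)"
proof -
  define D where "D = C * (2 / (1 - \<theta>))"
  have D: "D \<ge> 0" using \<theta> C by (simp add: D_def)
  have row: "(\<Sum>n\<in>J. cmod (b m n)) \<le> D" for m
  proof -
    have "(\<Sum>n\<in>J. cmod (b m n)) \<le> (\<Sum>n\<in>J. C * \<theta> ^ ((m - n) + (n - m)))" by (intro sum_mono b)
    also have "\<dots> \<le> D" unfolding D_def sum_distrib_left[symmetric]
      using sum_power_dist_le[OF \<theta> fin(2), of m] C by (intro mult_left_mono)
    finally show ?thesis .
  qed
  have col: "(\<Sum>m\<in>S. cmod (b m n)) \<le> D" for n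
  proof -
    have "(\<Sum>m\<in>S. cmod (b m n)) \<le> (\<Sum>m\<in>S. C * \<theta> ^ ((n - m) + (m - n)))"
      by (intro sum_mono order_trans[OF b]) (simp add: add.commute)
    also have "\<dots> \<le> D" unfolding D_def sum_distrib_left[symmetric]
      using sum_power_dist_le[OF \<theta> fin(1), of n] C by (intro mult_left_mono)
    finally show ?thesis .
  qed
  have "(cmod (\<Sum>n\<in>J. b m n * a n))^2 \<le> D * (\<Sum>n\<in>J. cmod (b m n) * (cmod (a n))^2)" for m
  proof -
    have "(cmod (\<Sum>n\<in>J. b m n * a n))^2 \<le> (\<Sum>n\<in>J. sqrt (cmod (b m n)) * (sqrt (cmod (b m n)) * cmod (a n)))^2"
      by (intro power_mono order_trans[OF norm_sum]) (auto simp: norm_mult mult.assoc[symmetric])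
    also have "\<dots> \<le> (\<Sum>n\<in>J. (sqrt (cmod (b m n)))^2) * (\<Sum>n\<in>J. (sqrt (cmod (b m n)) * cmod (a n))^2)"
      by (rule Cauchy_Schwarz_ineq_sum)
    also have "\<dots> = (\<Sum>n\<in>J. cmod (b m n)) * (\<Sum>n\<in>J. cmod (b m n) * (cmod (a n))^2)"
      by (simp add: power_mult_distrib)
    also have "\<dots> \<le> D * (\<Sum>n\<in>J. cmod (b m n) * (cmod (a n))^2)"
      by (intro mult_right_mono row sum_nonneg) auto
    finally show ?thesis .
  qed
  then have "(\<Sum>m\<in>S. (cmod (\<Sum>n\<in>J. b m n * a n))^2) \<le> (\<Sum>m\<in>S. D * (\<Sum>n\<in>J. cmod (b m n) * (cmod (a n))^2))"
    by (intro sum_mono)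
  also have "\<dots> = D * (\<Sum>n\<in>J. (\<Sum>m\<in>S. cmod (b m n)) * (cmod (a n))^2)"
    unfolding sum_distrib_left[symmetric] sum_distrib_right by (subst sum.swap) simp
  also have "\<dots> \<le> D * (\<Sum>n\<in>J. D * (cmod (a n))^2)"
    using D by (intro mult_left_mono sum_mono mult_right_mono col) auto
  also have "\<dots> = D^2 * (\<Sum>n\<in>J. (cmod (a n))^2)"
    by (simp add: sum_distrib_left power2_eq_square mult.assoc)
  finally show ?thesis by (simp add: D_def)
qed

text \<open>
  A tail controlled by its first term shrinks by a fixed factor when that term is removed.
\<close>

lemma geometric_decay_of_tail_bound:
  fixes a :: "nat \<Rightarrow> real"
  assumes a: "\<And>n. a n > 0" and c: "c \<ge> 1"
    and tail: "\<And>n M. n \<le> M \<Longrightarrow> (\<Sum>k=n..M. a k) \<le> c * a n"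
    and nM: "n \<le> M"
  shows "a M \<le> c * (1 - 1 / c) ^ (M - n) * a n"
proof -
  have "(\<Sum>k=m..M. a k) \<le> (1 - 1 / c) ^ (m - n) * (\<Sum>k=n..M. a k)" if "n \<le> m" "m \<le> M" for m
    using that
  proof (induction m rule: dec_induct)
    case (step m)
    have split: "(\<Sum>k=m..M. a k) = a m + (\<Sum>k=Suc m..M. a k)"
      using step by (intro sum.atLeast_Suc_atMost) auto
    have "(\<Sum>k=m..M. a k) / c \<le> a m" using tail[of m M] step c by (simp add: divide_le_eq mult.commute)
    moreover have "(1 - 1/c) * (\<Sum>k=m..M. a k) = (\<Sum>k=m..M. a k) - (\<Sum>k=m..M. a k) / c"
      by (simp add: left_diff_distrib)
    ultimately have "(\<Sum>k=Suc m..M. a k) \<le> (1 - 1/c) * (\<Sum>k=m..M. a k)"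
      using split by linarith
    also have "\<dots> \<le> (1 - 1/c) * ((1 - 1 / c) ^ (m - n) * (\<Sum>k=n..M. a k))"
      using step c by (intro mult_left_mono step.IH) auto
    finally show ?case using step by (simp add: Suc_diff_le mult.assoc)
  qed simp
  from this[OF nM order_refl] have "a M \<le> (1 - 1 / c) ^ (M - n) * (\<Sum>k=n..M. a k)" by simp
  also have "\<dots> \<le> (1 - 1 / c) ^ (M - n) * (c * a n)"
    using c by (intro mult_left_mono tail nM) auto
  finally show ?thesis by (simp add: mult_ac)
qed

text \<open>
  The mirror image: a partial sum controlled by its last term.
\<close>

lemma geometric_growth_of_partial_sum_bound:
  fixes a :: "nat \<Rightarrow> real"
  assumes a: "\<And>n. a n > 0" and c: "c \<ge> 1"
    and head: "\<And>n. (\<Sum>k\<le>n. a k) \<le> c * a n"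
    and mn: "m \<le> n"
  shows "a m \<le> c * (1 - 1 / c) ^ (n - m) * a n"
proof -
  have "(\<Sum>k\<le>m. a k) \<le> (1 - 1 / c) ^ (n - m) * (\<Sum>k\<le>n. a k)"
    using mn
  proof (induction n rule: dec_induct)
    case (step n)
    have "(\<Sum>k\<le>Suc n. a k) / c \<le> a (Suc n)" using head[of "Suc n"] c by (simp add: divide_le_eq mult.commute)
    moreover have "(1 - 1/c) * (\<Sum>k\<le>Suc n. a k) = (\<Sum>k\<le>Suc n. a k) - (\<Sum>k\<le>Suc n. a k) / c"
      by (simp add: left_diff_distrib)
    moreover have "(\<Sum>k\<le>Suc n. a k) = (\<Sum>k\<le>n. a k) + a (Suc n)" by simp
    ultimately have "(\<Sum>k\<le>n. a k) \<le> (1 - 1/c) * (\<Sum>k\<le>Suc n. a k)"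
      by linarith
    then have "(1 - 1 / c) ^ (n - m) * (\<Sum>k\<le>n. a k) \<le> (1 - 1 / c) ^ (n - m) * ((1 - 1/c) * (\<Sum>k\<le>Suc n. a k))"
      using c by (intro mult_left_mono) auto
    with step show ?case by (simp add: Suc_diff_le mult_ac)
  qed simp
  also have "\<dots> \<le> (1 - 1 / c) ^ (n - m) * (c * a n)"
    using c by (intro mult_left_mono head) auto
  finally have "(\<Sum>k\<le>m. a k) \<le> c * (1 - 1 / c) ^ (n - m) * a n" by (simp add: mult_ac)
  moreover have "a m \<le> (\<Sum>k\<le>m. a k)" using a by (intro member_le_sum) (auto simp: less_imp_le)
  ultimately show ?thesis by linarith
qed

text \<open>
  For \<open>n > 0\<close>, \<open>r n\<close> is the modulus of the node \<open>s n\<close>; \<open>r 0\<close> merely dominates \<open>|s 0|\<close>, so that it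
  can be positive when \<open>s 0 = 0\<close>. Growth is required over two steps since nodes of opposite sign
  may have equal moduli.
\<close>

locale lacunary_points =
  fixes s r :: "nat \<Rightarrow> real" and q \<kappa> :: real
  assumes r_pos: "\<And>n. 0 < r n" and r_mono: "\<And>m n. m \<le> n \<Longrightarrow> r m \<le> r n"
    and q: "1 < q" and growth: "\<And>n. q * r n \<le> r (n + 2)"
    and s_le: "\<And>n. \<bar>s n\<bar> \<le> r n" and s_eq: "\<And>n. 0 < n \<Longrightarrow> \<bar>s n\<bar> = r n"
    and \<kappa>: "0 < \<kappa>" "\<kappa> \<le> 1"
    and separated: "\<And>n k. n \<noteq> k \<Longrightarrow> \<kappa> * max (r n) (r k) \<le> \<bar>s n - s k\<bar>"
begin

definition \<theta> :: real where "\<theta> = 1 / sqrt q"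

lemma \<theta>: "0 < \<theta>" "\<theta> < 1"
  using q by (auto simp: \<theta>_def)

text \<open>
  Two steps multiply \<open>r\<close> by at least \<open>q\<close>; the factor \<open>sqrt q\<close> pays for an odd number of steps.
\<close>

lemma ratio_decay: "k \<le> m \<Longrightarrow> r k \<le> sqrt q * \<theta> ^ (m - k) * r m"
proof -
  assume km: "k \<le> m"
  have even: "q ^ j * r k \<le> r (k + 2 * j)" for j
  proof (induction j)
    case (Suc j)
    have "q ^ Suc j * r k \<le> q * r (k + 2 * j)" using Suc q by (simp add: mult.assoc)
    also have "\<dots> \<le> r (k + 2 * Suc j)" using growth[of "k + 2 * j"] by simp
    finally show ?case .
  qed simp
  define j where "j = (m - k) div 2"
  have "r (k + 2 * j) \<le> r m" using km by (intro r_mono) (simp add: j_def)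
  with even[of j] have le: "q ^ j * r k \<le> r m" by linarith
  have q\<theta>: "q ^ j * \<theta> ^ (2 * j) = 1"
    using q by (simp add: \<theta>_def power_mult power_divide flip: power_mult_distrib)
  have "r k = \<theta> ^ (2 * j) * (q ^ j * r k)" using q\<theta> by (simp add: mult_ac)
  also have "\<dots> \<le> \<theta> ^ (2 * j) * r m" using le \<theta> by (intro mult_left_mono) auto
  also have "\<theta> ^ (2 * j) \<le> sqrt q * \<theta> ^ (m - k)"
  proof (cases "even (m - k)")
    case True
    then have "2 * j = m - k" by (simp add: j_def)
    then show ?thesis using q \<theta> by simp
  next
    case False
    then have "m - k = Suc (2 * j)" unfolding j_def by presburger
    then show ?thesis using q by (simp add: \<theta>_def)
  qed
  finally show ?thesis using r_pos[of m] by (simp add: mult_right_mono)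
qed

text \<open>
  Chosen so that one exponential covers both near nodes, whose relative distance is only known to
  be at least \<open>\<kappa>\<close>, and far nodes, whose relative distance tends to \<open>1\<close> geometrically.
\<close>

definition L where "L = 2 * sqrt q * (1 + ln (1 / \<kappa>))"

lemma L_nonneg: "L \<ge> 0"
  using q \<kappa> by (simp add: L_def)

text \<open>
  The exponential form is what survives an infinite product: the exponents are summable, whereas
  infinitely many factors \<open>\<kappa>\<close> would multiply to \<open>0\<close>.
\<close>

lemma separation_exp:
  assumes "n \<noteq> k"
  shows "exp (- L * \<theta> ^ ((n - k) + (k - n))) * max (r n) (r k) \<le> \<bar>s n - s k\<bar>"
proof -
  define d where "d = (n - k) + (k - n)"
  define x where "x = sqrt q * \<theta> ^ d"
  have x0: "x \<ge> 0" using q \<theta> by (simp add: x_def)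
  have min_le: "min (r n) (r k) \<le> x * max (r n) (r k)"
  proof (cases "n \<le> k")
    case True then show ?thesis using ratio_decay[OF True] r_mono[OF True] by (simp add: x_def d_def)
  next
    case False
    then have "k \<le> n" by simp
    then show ?thesis using ratio_decay[of k n] r_mono[of k n] by (simp add: x_def d_def)
  qed
  \<comment> \<open>index \<open>0\<close> is treated separately because of \<open>|s 0| \<le> r 0\<close>\<close>
  have diff: "max (r n) (r k) - min (r n) (r k) \<le> \<bar>s n - s k\<bar>"
    using assms s_le[of n] s_le[of k] s_eq[of n] s_eq[of k] r_mono[of 0 n] r_mono[of 0 k]
    by (cases "n = 0"; cases "k = 0") auto
  have mx: "max (r n) (r k) > 0" using r_pos[of n] by simp
  have l\<kappa>: "ln (1 / \<kappa>) \<ge> 0" using \<kappa> by simp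
  have Lx: "L * \<theta> ^ d = 2 * x * (1 + ln (1 / \<kappa>))" by (simp add: L_def x_def mult_ac)
  show ?thesis
  proof (cases "x \<le> 1 / 2")
    case True
    have "- x - 2 * x^2 \<le> ln (1 - x)" using True x0 by (rule ln_one_minus_pos_lower_bound[rotated])
    moreover have "x^2 \<le> x / 2" using True x0 mult_left_mono[of x "1/2" x] by (simp add: power2_eq_square)
    ultimately have "- 2 * x \<le> ln (1 - x)" by simp
    then have "exp (- 2 * x) \<le> 1 - x" using True by (simp add: ln_ge_iff)
    moreover have "- L * \<theta> ^ d \<le> - 2 * x" using Lx l\<kappa> x0 by (simp add: algebra_simps)
    ultimately have "exp (- L * \<theta> ^ d) \<le> 1 - x" by (meson exp_le_cancel_iff order_trans)
    then have "exp (- L * \<theta> ^ d) * max (r n) (r k) \<le> (1 - x) * max (r n) (r k)"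
      using mx by (intro mult_right_mono) auto
    also have "\<dots> \<le> max (r n) (r k) - min (r n) (r k)" using min_le by (simp add: algebra_simps)
    finally show ?thesis using diff by (simp add: d_def)
  next
    case False
    then have "ln (1 / \<kappa>) \<le> 2 * x * ln (1 / \<kappa>)" using l\<kappa> mult_right_mono[of 1 "2 * x" "ln (1/\<kappa>)"] by simp
    then have "ln (1 / \<kappa>) \<le> L * \<theta> ^ d" unfolding Lx using x0 by (simp add: algebra_simps)
    then have "exp (- L * \<theta> ^ d) \<le> exp (- ln (1 / \<kappa>))" by simp
    also have "\<dots> = \<kappa>" using \<kappa> by (simp add: ln_div)
    finally have "exp (- L * \<theta> ^ d) * max (r n) (r k) \<le> \<kappa> * max (r n) (r k)"
      using mx by (intro mult_right_mono) auto
    then show ?thesis using separated[OF assms] by (simp add: d_def)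
  qed
qed

text \<open>
  The factors with \<open>k < n\<close> are close to \<open>r n / r k\<close> and those with \<open>k > n\<close> close to \<open>1\<close>; the
  total loss is a constant uniform in \<open>n\<close> and \<open>N\<close>.
\<close>

lemma prod_distance_lower:
  assumes "n < N"
  shows "exp (- L * (2 / (1 - \<theta>))) * (\<Prod>k<n. r n / r k) \<le> (\<Prod>k\<in>{..<N} - {n}. \<bar>s n - s k\<bar> / r k)"
proof -
  let ?K = "{..<N} - {n}" and ?d = "\<lambda>k. (n - k) + (k - n)"
  have "(\<Prod>k<n. r n / r k) = (\<Prod>k\<in>?K. max (r n) (r k) / r k)"
  proof (rule prod.mono_neutral_cong_left)
    show "\<forall>k\<in>?K - {..<n}. max (r n) (r k) / r k = 1"
      using r_mono[of n] r_pos less_imp_neq[OF r_pos] by (auto simp: max_def)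
    show "r n / r k = max (r n) (r k) / r k" if "k \<in> {..<n}" for k
      using r_mono[of k n] that by (simp add: max_def)
  qed (use assms in auto)
  moreover have "exp (- L * (2 / (1 - \<theta>))) \<le> (\<Prod>k\<in>?K. exp (- L * \<theta> ^ ?d k))"
  proof -
    have "L * (\<Sum>k\<in>?K. \<theta> ^ ?d k) \<le> L * (2 / (1 - \<theta>))"
      by (intro mult_left_mono sum_power_dist_le \<theta> L_nonneg) auto
    then have "- L * (2 / (1 - \<theta>)) \<le> (\<Sum>k\<in>?K. - L * \<theta> ^ ?d k)"
      by (simp add: sum_distrib_left sum_negf)
    then show ?thesis by (simp add: exp_sum[symmetric])
  qed
  ultimately have "exp (- L * (2 / (1 - \<theta>))) * (\<Prod>k<n. r n / r k)
      \<le> (\<Prod>k\<in>?K. exp (- L * \<theta> ^ ?d k)) * (\<Prod>k\<in>?K. max (r n) (r k) / r k)"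
    using r_pos by (simp only:) (intro mult_right_mono prod_nonneg; auto simp: less_imp_le max_def)
  also have "\<dots> = (\<Prod>k\<in>?K. exp (- L * \<theta> ^ ?d k) * max (r n) (r k) / r k)"
    by (simp add: prod.distrib[symmetric])
  also have "\<dots> \<le> (\<Prod>k\<in>?K. \<bar>s n - s k\<bar> / r k)"
  proof (intro prod_mono conjI)
    fix k assume k: "k \<in> ?K"
    show "exp (- L * \<theta> ^ ?d k) * max (r n) (r k) / r k \<le> \<bar>s n - s k\<bar> / r k"
      using separation_exp[of n k] k r_pos[of k] by (intro divide_right_mono) auto
    show "0 \<le> exp (- L * \<theta> ^ ?d k) * max (r n) (r k) / r k"
      using r_pos[of n] r_pos[of k] by (auto simp: max_def)
  qed
  finally show ?thesis .
qed

text \<open>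
  A factor with \<open>k < m\<close> is \<open>r m / r k\<close> and all others are \<open>1\<close>, up to relative errors that are
  geometrically small in the distance of \<open>k\<close> and \<open>m\<close>.
\<close>

lemma prod_growth_upper:
  assumes "finite S"
  shows "(\<Prod>k\<in>S. 1 + r m / r k) \<le> exp (sqrt q * (2 / (1 - \<theta>))) * (\<Prod>k\<in>{k\<in>S. k < m}. r m / r k)"
proof -
  let ?d = "\<lambda>k. (m - k) + (k - m)"
  have fac: "1 + r m / r k \<le> exp (sqrt q * \<theta> ^ ?d k) * (if k < m then r m / r k else 1)" for k
  proof (cases "k < m")
    case True
    have "r k / r m \<le> sqrt q * \<theta> ^ ?d k" using ratio_decay[of k m] True r_pos[of m] by (simp add: divide_le_eq)
    then have "1 + r k / r m \<le> exp (sqrt q * \<theta> ^ ?d k)" using exp_ge_add_one_self[of "sqrt q * \<theta> ^ ?d k"] by linarith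
    then have "(1 + r k / r m) * (r m / r k) \<le> exp (sqrt q * \<theta> ^ ?d k) * (r m / r k)"
      using r_pos[of k] r_pos[of m] by (intro mult_right_mono) auto
    moreover have "(1 + r k / r m) * (r m / r k) = 1 + r m / r k"
      using r_pos[of k] r_pos[of m] by (simp add: field_simps)
    ultimately show ?thesis using True by simp
  next
    case False
    have "r m / r k \<le> sqrt q * \<theta> ^ ?d k" using ratio_decay[of m k] False r_pos[of k] by (simp add: divide_le_eq)
    then have "1 + r m / r k \<le> exp (sqrt q * \<theta> ^ ?d k)"
      using exp_ge_add_one_self[of "sqrt q * \<theta> ^ ?d k"] by linarith
    then show ?thesis using False by simp
  qed
  have "(\<Prod>k\<in>S. 1 + r m / r k) \<le> (\<Prod>k\<in>S. exp (sqrt q * \<theta> ^ ?d k) * (if k < m then r m / r k else 1))"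
    using r_pos by (intro prod_mono conjI fac) (auto intro!: add_nonneg_nonneg simp: less_imp_le)
  also have "\<dots> = exp (sqrt q * (\<Sum>k\<in>S. \<theta> ^ ?d k)) * (\<Prod>k\<in>S. if k < m then r m / r k else 1)"
    using assms by (simp add: prod.distrib exp_sum sum_distrib_left)
  also have "(\<Prod>k\<in>S. if k < m then r m / r k else 1) = (\<Prod>k\<in>{k\<in>S. k < m}. r m / r k)"
    using assms by (simp add: prod.inter_filter)
  also have "exp (sqrt q * (\<Sum>k\<in>S. \<theta> ^ ?d k)) * \<dots> \<le> exp (sqrt q * (2 / (1 - \<theta>))) * \<dots>"
  proof (intro mult_right_mono prod_nonneg)
    have "sqrt q * (\<Sum>k\<in>S. \<theta> ^ ?d k) \<le> sqrt q * (2 / (1 - \<theta>))"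
      using q by (intro mult_left_mono sum_power_dist_le \<theta> assms) auto
    then show "exp (sqrt q * (\<Sum>k\<in>S. \<theta> ^ ?d k)) \<le> exp (sqrt q * (2 / (1 - \<theta>)))" by simp
  qed (use r_pos in \<open>auto simp: less_imp_le\<close>)
  finally show ?thesis .
qed

text \<open>
  The sum of \<open>1 / r k\<close> converges, so all but finitely many factors contribute at most
  \<open>exp(e\<rho>/2)\<close>; the finitely many others grow polynomially.
\<close>

lemma prod_subexponential:
  assumes e: "e > 0"
  obtains \<rho>0 where "\<rho>0 > 0" "\<And>\<rho> N. \<rho> \<ge> \<rho>0 \<Longrightarrow> (\<Prod>k<N. 1 + \<rho> / r k) \<le> exp (e * \<rho>)"
proof -
  have inv: "1 / r k \<le> sqrt q / r 0 * \<theta> ^ k" for k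
    using ratio_decay[of 0 k] r_pos[of 0] r_pos[of k] by (simp add: field_simps)
  have "summable (\<lambda>k. sqrt q / r 0 * \<theta> ^ k)" using \<theta> by (intro summable_mult summable_geometric) auto
  then have summ: "summable (\<lambda>k. 1 / r k)"
    using inv r_pos by (elim summable_comparison_test'[where N = 0]) (auto simp: less_imp_le)
  from suminf_exist_split[OF _ summ, of "e / 2"] e
  obtain K where K: "norm (\<Sum>i. 1 / r (i + K)) < e / 2" by auto
  define a where "a = e / (2 * (real K + 1))"
  have a: "a > 0" using e by (simp add: a_def)
  define \<rho>0 where "\<rho>0 = 2 / (a^2 * r 0)"
  show ?thesis
  proof (rule that)
    show "\<rho>0 > 0" using a r_pos[of 0] by (simp add: \<rho>0_def)
    fix \<rho> :: real and N assume "\<rho>0 \<le> \<rho>"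
    with \<open>\<rho>0 > 0\<close> have \<rho>: "\<rho>0 \<le> \<rho>" "\<rho> > 0" by auto
    have one: "1 + \<rho> / r k \<le> exp (a * \<rho>)" for k
    proof -
      have "\<rho> / r k \<le> \<rho> / r 0" using r_mono[of 0 k] r_pos \<rho> by (intro divide_left_mono) auto
      also have "\<dots> \<le> (a * \<rho>)^2 / 2"
        using \<rho> a r_pos[of 0] by (simp add: \<rho>0_def field_simps power2_eq_square)
      finally have "\<rho> / r k \<le> (a * \<rho>)^2 / 2" .
      moreover have "0 \<le> a * \<rho>" using a \<rho> by simp
      ultimately show ?thesis using exp_lower_Taylor_quadratic[of "a * \<rho>"] by linarith
    qed
    have nn: "0 \<le> 1 + \<rho> / r k" for k using \<rho> r_pos[of k] by (simp add: add_nonneg_nonneg less_imp_le)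
    have "(\<Prod>k<N. 1 + \<rho> / r k) \<le> (\<Prod>k<K + N. 1 + \<rho> / r k)"
      using \<rho> r_pos by (intro prod_mono2) (auto simp: less_imp_le add_nonneg_nonneg)
    also have "\<dots> = (\<Prod>k<K. 1 + \<rho> / r k) * (\<Prod>i<N. 1 + \<rho> / r (i + K))"
      by (induction N) (simp_all add: add.commute mult.assoc)
    also have "\<dots> \<le> exp (a * \<rho>) ^ K * exp (\<rho> * (e / 2))"
    proof (intro mult_mono)
      show "(\<Prod>k<K. 1 + \<rho> / r k) \<le> exp (a * \<rho>) ^ K"
        using prod_mono[of "{..<K}" "\<lambda>k. 1 + \<rho> / r k" "\<lambda>_. exp (a * \<rho>)"] one nn by simp
      have "(\<Prod>i<N. 1 + \<rho> / r (i + K)) \<le> (\<Prod>i<N. exp (\<rho> * (1 / r (i + K))))"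
        using nn by (intro prod_mono) (auto simp: exp_ge_add_one_self)
      also have "\<dots> = exp (\<rho> * (\<Sum>i<N. 1 / r (i + K)))" by (simp add: exp_sum sum_distrib_left)
      also have "(\<Sum>i<N. 1 / r (i + K)) \<le> (\<Sum>i. 1 / r (i + K))"
        using summ r_pos by (intro sum_le_suminf) (auto simp: less_imp_le intro: summable_ignore_initial_segment)
      then have "exp (\<rho> * (\<Sum>i<N. 1 / r (i + K))) \<le> exp (\<rho> * (e / 2))"
        using K \<rho> by (intro iffD2[OF exp_le_cancel_iff] mult_left_mono) auto
      finally show "(\<Prod>i<N. 1 + \<rho> / r (i + K)) \<le> exp (\<rho> * (e / 2))" .
    qed (use nn in \<open>auto intro!: prod_nonneg\<close>)
    also have "\<dots> = exp (a * \<rho> * K + \<rho> * (e / 2))" by (simp add: exp_of_nat_mult[symmetric] exp_add mult_ac)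
    also have "\<dots> \<le> exp (e * \<rho>)"
    proof -
      have "a * real K \<le> e / 2" using e by (simp add: a_def field_simps)
      then have "a * real K * \<rho> \<le> e / 2 * \<rho>" using \<rho> by (intro mult_right_mono) auto
      then show ?thesis by (simp add: mult_ac)
    qed
    finally show "(\<Prod>k<N. 1 + \<rho> / r k) \<le> exp (e * \<rho>)" .
  qed
qed

text \<open>
  Nodes may come in pairs of nearly equal modulus, but of two consecutive gaps at least one is
  large.
\<close>

lemma large_gap:
  obtains N where "N0 < N" "sqrt q * r (N - 1) \<le> r N"
proof (cases "sqrt q * r N0 \<le> r (N0 + 1)")
  case True then show ?thesis using that[of "N0 + 1"] by simp
next
  case False
  then have "sqrt q * r (N0 + 1) \<le> sqrt q * (sqrt q * r N0)" using q by (intro mult_left_mono) auto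
  also have "\<dots> = q * r N0" using q by (simp flip: mult.assoc)
  also have "\<dots> \<le> r (N0 + 2)" by (rule growth)
  finally show ?thesis using that[of "N0 + 2"] by simp
qed

lemma r_unbounded: "\<exists>n0. \<forall>n\<ge>n0. B \<le> r n"
proof -
  have "((\<lambda>n. sqrt q * \<theta> ^ n * B) \<longlonglongrightarrow> sqrt q * 0 * B)"
    using \<theta> by (intro tendsto_intros LIMSEQ_power_zero) auto
  then have "\<forall>\<^sub>F n in sequentially. sqrt q * \<theta> ^ n * B < r 0"
    using r_pos[of 0] by (intro order_tendstoD(2)) auto
  then obtain n0 where n0: "\<And>n. n \<ge> n0 \<Longrightarrow> sqrt q * \<theta> ^ n * B < r 0" by (auto simp: eventually_sequentially)
  have "B \<le> r n" if "n \<ge> n0" for n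
  proof -
    have "sqrt q * \<theta> ^ n * B \<le> sqrt q * \<theta> ^ n * r n" using n0[OF that] ratio_decay[of 0 n] by simp
    then show ?thesis using q \<theta> by simp
  qed
  then show ?thesis by blast
qed

end

section \<open>Product structure of the generating function\<close>

text \<open>
  The map \<open>h \<mapsto> h / (2 M - h)\<close> sends the half-plane \<open>Re h \<le> M\<close> to the closed unit disc and fixes
  \<open>0\<close>, so the Schwarz lemma applies. Dividing by \<open>c > 1\<close> produces the open disc.
\<close>

lemma borel_caratheodory:
  fixes h :: "complex \<Rightarrow> complex"
  assumes hol: "h holomorphic_on ball 0 R" and h0: "h 0 = 0"
    and M: "0 < M" and bd: "\<And>z. cmod z < R \<Longrightarrow> Re (h z) \<le> M"
    and z: "cmod z < R"
  shows "cmod (h z) \<le> 2 * M * cmod z / (R - cmod z)"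
proof -
  have R: "R > 0" using z norm_ge_zero[of z] by linarith
  define w where "w u = h u / (2 * of_real M - h u)" for u
  have den: "2 * of_real M - h u \<noteq> 0" if "cmod u < R" for u
  proof
    assume "2 * of_real M - h u = 0"
    then have "Re (h u) = 2 * M" by (simp add: complex_eq_iff)
    then show False using bd[OF that] M by simp
  qed
  have w_less: "cmod (w u) \<le> 1" if "cmod u < R" for u
  proof -
    have "(cmod (h u))^2 \<le> (cmod (2 * of_real M - h u))^2"
      using bd[OF that] M unfolding cmod_power2 by (simp add: power2_eq_square algebra_simps)
    then have "cmod (h u) \<le> cmod (2 * of_real M - h u)" by (rule power2_le_imp_le) simp
    then show ?thesis using den[OF that] by (simp add: w_def norm_divide divide_le_eq)
  qed
  have w_Schwarz: "cmod (w z) \<le> c * (cmod z / R)" if c: "c > 1" for c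
  proof -
    have "cmod ((\<lambda>u. w (of_real R * u) / of_real c) (z / of_real R)) \<le> cmod (z / of_real R)"
    proof (rule Schwarz_Lemma(1))
      have sub: "cmod (of_real R * u) < R" if "cmod u < 1" for u
        using that R by (simp add: norm_mult)
      have "(\<lambda>u. h (of_real R * u)) holomorphic_on ball 0 1"
        using sub by (intro holomorphic_on_compose_gen[OF _ hol, unfolded o_def] holomorphic_intros) auto
      then show "(\<lambda>u. w (of_real R * u) / of_real c) holomorphic_on ball 0 1"
        unfolding w_def using c sub den by (intro holomorphic_intros) auto
      show "w (of_real R * 0) / of_real c = 0" by (simp add: w_def h0)
      show "cmod (w (of_real R * u) / of_real c) < 1" if "cmod u < 1" for u
        using w_less[OF sub[OF that]] c by (simp add: norm_divide)
      show "cmod (z / of_real R) < 1" using z R by (simp add: norm_divide)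
    qed
    then show ?thesis using z R c by (simp add: norm_divide field_simps)
  qed
  have "cmod (w z) \<le> cmod z / R"
  proof (rule field_le_epsilon)
    fix e :: real assume e: "e > 0"
    have "cmod z / R \<le> 1" using z R by simp
    then have "e * (cmod z / R) \<le> e" using e mult_left_le[of "cmod z / R" e] by simp
    moreover have "(1 + e) * (cmod z / R) = cmod z / R + e * (cmod z / R)" by (simp only: distrib_right mult_1)
    ultimately show "cmod (w z) \<le> cmod z / R + e" using w_Schwarz[of "1 + e"] e by linarith
  qed
  then have "R * cmod (h z) \<le> cmod z * cmod (2 * of_real M - h z)"
    using den[OF z] R by (simp add: w_def norm_divide field_simps)
  also have "\<dots> \<le> cmod z * (2 * M + cmod (h z))"
    using norm_triangle_ineq4[of "2 * of_real M" "h z"] M by (intro mult_left_mono) (auto simp: norm_mult)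
  finally show ?thesis using z by (simp add: field_simps)
qed

locale lacunary_spectral_basis =
  spectral_basis E "UNIV :: nat set" s \<nu> A + lacunary_points s r q \<kappa>
  for E A s \<nu> r q \<kappa> +
  assumes weight_summable: "summable (\<lambda>n. \<nu> n / (1 + (s n)^2))"
begin

lemma A_at_node: "A (of_real (s n)) = 0"
  using A_zero_iff by blast

lemma node_eq_iff: "s n = s k \<longleftrightarrow> n = k"
  using inj by (auto dest: injD)

lemma \<nu>_pos: "0 < \<nu> n"
  using weight_pos by simp

definition \<phi> :: "nat \<Rightarrow> complex \<Rightarrow> complex" where
  "\<phi> k z = (z - of_real (s k)) / of_real (r k)"

lemma cmod_\<phi>_node: "cmod (\<phi> k (of_real (s n))) = \<bar>s n - s k\<bar> / r k"
  using r_pos[of k] unfolding \<phi>_def norm_divide of_real_diff[symmetric] norm_of_real by simp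

lemma cmod_\<phi>_le: "cmod (\<phi> k z) \<le> 1 + cmod z / r k"
proof -
  have "cmod (\<phi> k z) = cmod (z - of_real (s k)) / r k"
    using r_pos[of k] by (simp add: \<phi>_def norm_divide)
  also have "\<dots> \<le> (cmod z + r k) / r k"
    using norm_triangle_ineq4[of z "of_real (s k)"] s_le[of k] r_pos[of k] by (intro divide_right_mono) auto
  finally show ?thesis using r_pos[of k] by (simp add: add_divide_distrib)
qed

lemma \<phi>_holomorphic: "\<phi> k holomorphic_on S"
  using r_pos[of k] unfolding \<phi>_def[abs_def] by (intro holomorphic_intros) simp

lemma \<phi>_eq_0_iff: "\<phi> k z = 0 \<longleftrightarrow> z = of_real (s k)"
  using r_pos[of k] by (simp add: \<phi>_def)

lemma prod_\<phi>_le: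
  assumes "cmod z \<le> x" "finite S"
  shows "cmod (\<Prod>k\<in>S. \<phi> k z) \<le> (\<Prod>k\<in>S. 1 + x / r k)"
  unfolding prod_norm[symmetric]
proof (intro prod_mono conjI norm_ge_zero)
  fix k
  have "cmod z / r k \<le> x / r k" using assms(1) r_pos[of k] by (intro divide_right_mono) auto
  then show "cmod (\<phi> k z) \<le> 1 + x / r k" using cmod_\<phi>_le[of k z] by linarith
qed

text \<open>
  The entire function left after dividing \<open>A\<close> by its first \<open>N\<close> linear factors; the value at the
  removed zero is the removable singularity.
\<close>

primrec cofactor :: "nat \<Rightarrow> complex \<Rightarrow> complex" where
  "cofactor 0 = A"
| "cofactor (Suc N) = (\<lambda>z. if z = of_real (s N) then of_real (r N) * deriv (cofactor N) (of_real (s N))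
      else cofactor N z / \<phi> N z)"

lemma cofactor_properties:
  "cofactor N holomorphic_on UNIV \<and> (\<forall>z. A z = (\<Prod>k<N. \<phi> k z) * cofactor N z)"
proof (induction N)
  case 0
  then show ?case using A_entire by (simp add: entire_def)
next
  case (Suc N)
  let ?a = "of_real (s N) :: complex" and ?B = "cofactor N"
  have hol: "?B holomorphic_on UNIV" and eq: "\<And>z. A z = (\<Prod>k<N. \<phi> k z) * ?B z" using Suc by blast+
  have "(\<Prod>k<N. \<phi> k ?a) \<noteq> 0" by (simp add: \<phi>_eq_0_iff node_eq_iff)
  then have B0: "?B ?a = 0" using eq[of ?a] unfolding A_at_node by simp
  define G where "G z = cofactor (Suc N) z / of_real (r N)" for z
  have "G holomorphic_on UNIV"
  proof (rule pole_theorem_0[OF hol])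
    show "?B z = (z - ?a) * G z" if "z \<in> UNIV - {?a}" for z
      using that r_pos[of N] by (simp add: G_def \<phi>_def)
    show "G ?a = deriv ?B ?a" using r_pos[of N] by (simp add: G_def)
  qed (simp_all add: B0)
  then have "(\<lambda>z. of_real (r N) * G z) holomorphic_on UNIV" by (intro holomorphic_intros)
  moreover have "(\<lambda>z. of_real (r N) * G z) = cofactor (Suc N)"
    using r_pos[of N] by (auto simp: G_def fun_eq_iff simp del: cofactor.simps)
  ultimately have "cofactor (Suc N) holomorphic_on UNIV" by metis
  moreover have "A z = (\<Prod>k<Suc N. \<phi> k z) * cofactor (Suc N) z" for z
  proof (cases "z = ?a")
    case True
    then show ?thesis using A_at_node[of N] \<phi>_eq_0_iff[of N z] by (simp del: cofactor.simps)
  next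
    case False
    then have "\<phi> N z * cofactor (Suc N) z = ?B z" by (simp add: \<phi>_eq_0_iff)
    then show ?thesis unfolding eq[of z] prod.lessThan_Suc by (simp only: mult.assoc)
  qed
  ultimately show ?case by blast
qed

lemma cofactor_holomorphic: "cofactor N holomorphic_on S"
  using cofactor_properties holomorphic_on_subset by blast

lemma A_factorization: "A z = (\<Prod>k<N. \<phi> k z) * cofactor N z"
  using cofactor_properties by blast

text \<open>
  Omitting the linear factor of node \<open>n\<close> instead of dividing by it makes the formula valid at the
  node itself.
\<close>

lemma spectral_function_factorization:
  assumes "n < N"
  shows "g n z = of_real (sqrt (\<nu> n) / r n) * (\<Prod>k\<in>{..<N} - {n}. \<phi> k z) * cofactor N z"
proof -
  define H where "H z = (\<Prod>k\<in>{..<N} - {n}. \<phi> k z) * cofactor N z / of_real (r n)" for z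
  then have holH: "H holomorphic_on UNIV"
    unfolding H_def using r_pos[of n]
    by (intro holomorphic_intros cofactor_holomorphic \<phi>_holomorphic) auto
  have AH: "A z = (z - of_real (s n)) * H z" for z
  proof -
    have "(\<Prod>k<N. \<phi> k z) = \<phi> n z * (\<Prod>k\<in>{..<N} - {n}. \<phi> k z)"
      using assms by (intro prod.remove) auto
    then show ?thesis using A_factorization[of z N] r_pos[of n] by (simp add: H_def \<phi>_def)
  qed
  have "((\<lambda>z. (z - of_real (s n)) * H z) has_field_derivative H (of_real (s n))) (at (of_real (s n)))"
    using holomorphic_derivI[OF holH, of "of_real (s n)"] by (auto intro!: derivative_eq_intros)
  then have "deriv A (of_real (s n)) = H (of_real (s n))"
    unfolding AH[abs_def] by (rule DERIV_imp_deriv)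
  then have "g n z = of_real (sqrt (\<nu> n)) * H z"
    using AH[of z] by (simp add: spectral_function_def)
  then show ?thesis by (simp add: H_def)
qed

text \<open>
  The zeros of \<open>A\<close> are simple, so those among the first \<open>N\<close> are used up by the linear factors.
\<close>

lemma cofactor_nonzero:
  assumes "cmod z < r N" "0 < N"
  shows "cofactor N z \<noteq> 0"
proof
  assume 0: "cofactor N z = 0"
  then have "A z = 0" using A_factorization[of z N] by simp
  then obtain n where z: "z = of_real (s n)" using A_zero_iff by blast
  show False
  proof (cases "n < N")
    case True
    then have "g n z = 0" using spectral_function_factorization[OF True, of z] 0 by simp
    then show False using g_at_self_nonzero[of n] z by simp
  next
    case False
    then have "r N \<le> \<bar>s n\<bar>" using r_mono[of N n] s_eq[of n] assms(2) by simp
    then show False using assms z by simp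
  qed
qed

text \<open>
  The index \<open>1\<close> skips the node of smallest modulus, which may be \<open>0\<close>.
\<close>

definition \<beta> where "\<beta> = cmod (cofactor 1 0)"

text \<open>
  The linear factors of positive index have modulus \<open>1\<close> at the origin.
\<close>

lemma cofactor_at_0: "1 \<le> N \<Longrightarrow> cmod (cofactor N 0) = \<beta>"
proof (induction N rule: dec_induct)
  case (step N)
  have sN: "\<bar>s N\<bar> = r N" "s N \<noteq> 0" using step s_eq[of N] r_pos[of N] by auto
  have "\<phi> N 0 \<noteq> 0" using sN by (simp add: \<phi>_eq_0_iff)
  moreover have "cmod (\<phi> N 0) = 1" using sN r_pos[of N] by (simp add: \<phi>_def norm_divide)
  ultimately show ?case using step sN by (simp add: norm_divide)
qed (simp add: \<beta>_def)

lemma \<beta>_pos: "\<beta> > 0"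
  using cofactor_nonzero[of 0 1] r_pos[of 1] by (simp add: \<beta>_def)

definition gap where "gap = sqrt (sqrt q)"

lemma gap: "1 < gap" "gap * gap = sqrt q"
  using q by (auto simp: gap_def)

text \<open>
  The constant \<open>1\<close> belongs to the space, and all nodes are at a distance from a circle well
  inside a large gap that is comparable to both radii, so that \<open>evaluation_bound\<close> has a uniform
  constant.
\<close>

lemma A_lower_bound_on_gap_circles:
  obtains c0 where "c0 > 0"
    "\<And>N z. 0 < N \<Longrightarrow> sqrt q * r (N - 1) \<le> r N \<Longrightarrow> 1 \<le> gap * r (N - 1) \<Longrightarrow>
       cmod z = gap * r (N - 1) \<Longrightarrow> c0 \<le> cmod (A z)"
proof -
  define \<eta> where "\<eta> = 1 - 1 / gap"
  have \<eta>: "\<eta> > 0" using gap by (simp add: \<eta>_def)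
  define \<Sigma> where "\<Sigma> = (\<Sum>n. \<nu> n / (1 + (s n)^2))"
  define B where "B = 2 / \<eta>^2 * \<Sigma>"
  define K where "K = energy E (poly [:1:])"
  have main: "1 \<le> K * B * (cmod (A z))^2"
    if N: "0 < N" "sqrt q * r (N - 1) \<le> r N" "1 \<le> gap * r (N - 1)" and z: "cmod z = gap * r (N - 1)" for N z
  proof -
    define \<rho> where "\<rho> = gap * r (N - 1)"
    have rN: "gap * \<rho> \<le> r N" using N(2) gap(2) by (simp add: \<rho>_def mult.assoc[symmetric])
    have dist: "\<eta> * max \<rho> (r k) \<le> cmod (z - of_real (s k))" for k
    proof (cases "k < N")
      case True
      have "r k \<le> r (N - 1)" using True by (intro r_mono) auto
      then have rk: "r k \<le> \<rho> / gap" using gap by (simp add: \<rho>_def)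
      have "\<rho> / gap \<le> \<rho>" using gap r_pos[of "N - 1"] by (simp add: \<rho>_def)
      then have "max \<rho> (r k) = \<rho>" using rk by simp
      moreover have "\<rho> - r k \<le> cmod (z - of_real (s k))"
        using norm_triangle_ineq2[of z "of_real (s k)"] s_le[of k] z by (simp add: \<rho>_def)
      ultimately show ?thesis using rk by (simp add: \<eta>_def left_diff_distrib)
    next
      case False
      then have "r N \<le> r k" by (intro r_mono) auto
      then have rk: "gap * \<rho> \<le> r k" using rN by simp
      then have \<rho>: "\<rho> \<le> r k / gap" using gap by (simp add: pos_le_divide_eq mult.commute)
      have "r k / gap \<le> r k" using gap r_pos[of k] by (simp add: divide_le_eq)
      then have "max \<rho> (r k) = r k" using \<rho> by simp
      moreover have "r k - \<rho> \<le> cmod (z - of_real (s k))"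
        using norm_triangle_ineq2[of "of_real (s k)" z] s_eq[of k] z False N(1)
        by (simp add: \<rho>_def norm_minus_commute)
      ultimately show ?thesis using \<rho> by (simp add: \<eta>_def left_diff_distrib)
    qed
    have \<rho>1: "\<rho> \<ge> 1" using N(3) by (simp add: \<rho>_def)
    have Az: "A z \<noteq> 0"
    proof
      assume "A z = 0"
      then obtain k where "z = of_real (s k)" using A_zero_iff by blast
      then have "\<eta> * max \<rho> (r k) \<le> 0" using dist[of k] by simp
      moreover have "0 < \<eta> * max \<rho> (r k)" using \<eta> \<rho>1 by (intro mult_pos_pos) auto
      ultimately show False by linarith
    qed
    have "(cmod (poly [:1:] z))^2 \<le> energy E (poly [:1:]) * B * (cmod (A z))^2"
    proof (rule evaluation_bound[OF poly_mem Az])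
      fix J :: "nat set" assume J: "finite J"
      have "\<nu> n / (cmod (z - of_real (s n)))^2 \<le> 2 / \<eta>^2 * (\<nu> n / (1 + (s n)^2))" for n
      proof -
        define m where "m = max \<rho> (r n)"
        have m: "1 \<le> m" "\<bar>s n\<bar> \<le> m" using \<rho>1 s_le[of n] by (auto simp: m_def)
        have "1 + (s n)^2 \<le> 2 * m^2"
          using power_mono[OF m(1), of 2] power_mono[OF m(2), of 2] by simp
        then have "\<eta>^2 / 2 * (1 + (s n)^2) \<le> (\<eta> * m)^2" using \<eta> by (simp add: power_mult_distrib)
        also have "\<dots> \<le> (cmod (z - of_real (s n)))^2"
          using dist[of n] \<eta> m by (intro power_mono) (auto simp: m_def)
        finally have le: "\<eta>^2 / 2 * (1 + (s n)^2) \<le> (cmod (z - of_real (s n)))^2" .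
        have pos: "0 < \<eta>^2 / 2 * (1 + (s n)^2)" using \<eta> by (intro mult_pos_pos) (auto simp: add_pos_nonneg)
        have "\<nu> n / (cmod (z - of_real (s n)))^2 \<le> \<nu> n / (\<eta>^2 / 2 * (1 + (s n)^2))"
          by (rule divide_left_mono[OF le less_imp_le[OF \<nu>_pos] mult_pos_pos[OF order_less_le_trans[OF pos le] pos]])
        then show ?thesis by (simp add: field_simps)
      qed
      then have "(\<Sum>n\<in>J. \<nu> n / (cmod (z - of_real (s n)))^2) \<le> 2 / \<eta>^2 * (\<Sum>n\<in>J. \<nu> n / (1 + (s n)^2))"
        unfolding sum_distrib_left by (intro sum_mono)
      also have "\<dots> \<le> B"
        unfolding B_def \<Sigma>_def using \<nu>_pos J
        by (intro mult_left_mono sum_le_suminf weight_summable) (auto simp: less_imp_le add_nonneg_nonneg)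
      finally show "(\<Sum>n\<in>J. \<nu> n / (cmod (z - of_real (s n)))^2) \<le> B" .
    qed
    then show ?thesis by (simp add: K_def)
  qed
  have KB: "K * B \<ge> 0"
    unfolding K_def B_def \<Sigma>_def using \<nu>_pos
    by (intro mult_nonneg_nonneg suminf_nonneg weight_summable) (auto simp: less_imp_le add_nonneg_nonneg)
  show ?thesis
  proof (rule that[of "1 / sqrt (K * B + 1)"])
    show "0 < 1 / sqrt (K * B + 1)" using KB by simp
    fix N z assume N: "0 < N" "sqrt q * r (N - 1) \<le> r N" "1 \<le> gap * r (N - 1)" "cmod z = gap * r (N - 1)"
    have "1 \<le> (K * B + 1) * (cmod (A z))^2" using main[OF N] by (simp add: distrib_right add_increasing2)
    then have "sqrt 1 \<le> sqrt ((K * B + 1) * (cmod (A z))^2)" by (intro real_sqrt_le_mono)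
    then have "1 \<le> sqrt (K * B + 1) * cmod (A z)" by (simp add: real_sqrt_mult)
    then show "1 / sqrt (K * B + 1) \<le> cmod (A z)" using KB by (simp add: divide_le_eq mult.commute)
  qed
qed

text \<open>
  On a large gap circle \<open>|z| = \<rho>\<close>, \<open>1 / cofactor N = \<Prod> \<phi> / A\<close> has size at most \<open>exp (o(\<rho>))\<close>. Its
  logarithm therefore has real part \<open>o(\<rho>)\<close> in the disc, and Borel-Caratheodory makes it small at
  any fixed point. The bounds hold for infinitely many \<open>N\<close> only, which is enough because \<open>N\<close> is
  auxiliary in all applications.
\<close>

lemma cofactor_bounded:
  "\<exists>N\<ge>N0. \<beta> / 2 \<le> cmod (cofactor N z) \<and> cmod (cofactor N z) \<le> 2 * \<beta>"
proof -
  obtain c0 where c0: "c0 > 0"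
    "\<And>N z. 0 < N \<Longrightarrow> sqrt q * r (N - 1) \<le> r N \<Longrightarrow> 1 \<le> gap * r (N - 1) \<Longrightarrow>
       cmod z = gap * r (N - 1) \<Longrightarrow> c0 \<le> cmod (A z)"
    by (rule A_lower_bound_on_gap_circles) blast
  define x where "x = cmod z + 1"
  have x: "x \<ge> 1" by (simp add: x_def)
  \<comment> \<open>makes the final bound on the logarithm equal to \<open>ln 2\<close>\<close>
  define e where "e = ln 2 / (8 * x)"
  have e: "e > 0" using x by (simp add: e_def)
  obtain \<rho>0 where \<rho>0: "\<rho>0 > 0" "\<And>\<rho> N. \<rho> \<ge> \<rho>0 \<Longrightarrow> (\<Prod>k<N. 1 + \<rho> / r k) \<le> exp (e * \<rho>)"
    by (rule prod_subexponential[OF e]) blast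
  \<comment> \<open>large enough for the growth estimate, for \<open>2 |z| < \<rho>\<close>, and to absorb \<open>\<beta> / c0\<close>\<close>
  define \<rho>1 where "\<rho>1 = max (max 1 \<rho>0) (max (2 * x) (ln (\<beta> / c0) / e))"
  obtain n0 where n0: "\<And>n. n \<ge> n0 \<Longrightarrow> \<rho>1 \<le> r n" using r_unbounded by blast
  obtain N where N: "n0 + N0 < N" "sqrt q * r (N - 1) \<le> r N" by (rule large_gap)
  define \<rho> where "\<rho> = gap * r (N - 1)"
  have "\<rho>1 \<le> r (N - 1)" using N(1) by (intro n0) auto
  also have "\<dots> \<le> \<rho>" using gap r_pos[of "N - 1"] by (simp add: \<rho>_def)
  finally have "\<rho>1 \<le> \<rho>" .
  then have \<rho>: "1 \<le> \<rho>" "\<rho>0 \<le> \<rho>" "2 * x \<le> \<rho>" "ln (\<beta> / c0) / e \<le> \<rho>" by (auto simp: \<rho>1_def)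
  have rN: "\<rho> < r N"
  proof -
    have "\<rho> < gap * \<rho>" using gap \<rho> by simp
    also have "\<dots> \<le> r N" using N(2) gap(2) by (simp add: \<rho>_def mult.assoc[symmetric])
    finally show ?thesis .
  qed
  let ?B = "cofactor N"
  have Bnz: "?B u \<noteq> 0" if "cmod u \<le> \<rho>" for u using that rN N(1) by (intro cofactor_nonzero) auto
  have circle: "cmod (1 / ?B u) \<le> exp (e * \<rho>) / c0" if u: "cmod u = \<rho>" for u
  proof -
    have "c0 \<le> cmod (A u)" using N \<rho> u by (intro c0(2)[of N]) (auto simp: \<rho>_def)
    also have "cmod (A u) \<le> exp (e * \<rho>) * cmod (?B u)"
      unfolding A_factorization[of u N] norm_mult
      using prod_\<phi>_le[of u \<rho> "{..<N}"] \<rho>0(2)[OF \<rho>(2), of N] u by (intro mult_right_mono) auto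
    finally show ?thesis using c0(1) Bnz[of u] u by (simp add: norm_divide field_simps)
  qed
  have disc: "cmod (1 / ?B u) \<le> exp (e * \<rho>) / c0" if u: "cmod u \<le> \<rho>" for u
  proof (rule maximum_modulus_frontier[where S = "cball 0 \<rho>" and f = "\<lambda>u. 1 / ?B u"])
    show "(\<lambda>u. 1 / ?B u) holomorphic_on interior (cball 0 \<rho>)"
      using Bnz by (intro holomorphic_intros cofactor_holomorphic) auto
    have "(\<lambda>u. 1 / ?B u) holomorphic_on cball 0 \<rho>"
      using Bnz by (intro holomorphic_intros cofactor_holomorphic) auto
    then show "continuous_on (closure (cball 0 \<rho>)) (\<lambda>u. 1 / ?B u)"
      by (simp add: holomorphic_on_imp_continuous_on)
    show "cmod (1 / ?B v) \<le> exp (e * \<rho>) / c0" if "v \<in> frontier (cball 0 \<rho>)" for v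
      using that \<rho> by (intro circle) auto
  qed (use u in auto)
  obtain h1 where h1: "h1 holomorphic_on ball 0 \<rho>" "\<And>u. u \<in> ball 0 \<rho> \<Longrightarrow> 1 / ?B u = exp (h1 u)"
  proof (rule contractible_imp_holomorphic_log)
    show "(\<lambda>u. 1 / ?B u) holomorphic_on ball 0 \<rho>"
      using Bnz by (intro holomorphic_intros cofactor_holomorphic) auto
    show "contractible (ball (0::complex) \<rho>)" by (simp add: convex_imp_contractible)
    show "1 / ?B u \<noteq> 0" if "u \<in> ball 0 \<rho>" for u using that Bnz[of u] by simp
  next
    fix h1 assume "h1 holomorphic_on ball 0 \<rho>" "\<And>u. u \<in> ball 0 \<rho> \<Longrightarrow> 1 / ?B u = exp (h1 u)"
    then show thesis by (rule that)
  qed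
  define h where "h u = h1 u - h1 0" for u
  have B0: "cmod (?B 0) = \<beta>" using N(1) by (intro cofactor_at_0) auto
  have exph: "exp (Re (h u)) = \<beta> * cmod (1 / ?B u)" if "cmod u < \<rho>" for u
  proof -
    have "exp (h u) = (1 / ?B u) / (1 / ?B 0)"
      using h1(2)[of u] h1(2)[of 0] that \<rho> unfolding h_def exp_diff by simp
    then have "exp (h u) = ?B 0 / ?B u" by simp
    then have "cmod (exp (h u)) = \<beta> / cmod (?B u)" by (simp add: norm_divide B0)
    then show ?thesis by (simp add: norm_divide)
  qed
  \<comment> \<open>since \<open>\<beta> / c0 \<le> exp (e \<rho>)\<close> by the choice of \<open>\<rho>1\<close>\<close>
  have Reh: "Re (h u) \<le> 2 * e * \<rho>" if u: "cmod u < \<rho>" for u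
  proof -
    have "exp (Re (h u)) \<le> \<beta> * (exp (e * \<rho>) / c0)"
      unfolding exph[OF u] using disc[of u] u \<beta>_pos by (intro mult_left_mono) auto
    also have "\<dots> = exp (ln (\<beta> / c0)) * exp (e * \<rho>)" using \<beta>_pos c0(1) by simp
    also have "\<dots> = exp (ln (\<beta> / c0) + e * \<rho>)" by (simp add: exp_add)
    finally have "Re (h u) \<le> ln (\<beta> / c0) + e * \<rho>" by simp
    moreover have "ln (\<beta> / c0) \<le> e * \<rho>" using \<rho>(4) e by (simp add: divide_le_eq mult.commute)
    ultimately show ?thesis by simp
  qed
  have zx1: "cmod z \<le> x" by (simp add: x_def)
  have zx2: "2 * cmod z \<le> \<rho>" using \<rho>(3) zx1 by linarith
  have zx3: "cmod z < \<rho>" using zx2 \<rho>(1) norm_ge_zero[of z] by linarith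
  note zx = zx1 zx2 zx3
  have "cmod (h z) \<le> 2 * (2 * e * \<rho>) * cmod z / (\<rho> - cmod z)"
  proof (rule borel_caratheodory[OF _ _ _ Reh zx(3)])
    show "h holomorphic_on ball 0 \<rho>" unfolding h_def using h1(1) by (intro holomorphic_intros)
    show "0 < 2 * e * \<rho>" using e \<rho> by simp
  qed (simp_all add: h_def)
  also have "\<dots> \<le> 2 * (2 * e * \<rho>) * cmod z / (\<rho> / 2)"
    using zx \<rho> e by (intro divide_left_mono mult_nonneg_nonneg mult_pos_pos) auto
  also have "\<dots> = 8 * e * cmod z" using \<rho> by simp
  also have "\<dots> \<le> 8 * e * x" using zx e by (intro mult_left_mono) auto
  also have "\<dots> = ln 2" using x by (simp add: e_def)
  finally have "\<bar>Re (h z)\<bar> \<le> ln 2" using abs_Re_le_cmod[of "h z"] by linarith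
  then have "- ln 2 \<le> Re (h z)" "Re (h z) \<le> ln 2" by linarith+
  then have "exp (- ln 2) \<le> exp (Re (h z))" "exp (Re (h z)) \<le> exp (ln 2)"
    by (simp_all only: exp_le_cancel_iff)
  then have "1 / 2 \<le> \<beta> / cmod (?B z)" "\<beta> / cmod (?B z) \<le> 2"
    unfolding exph[OF zx(3)] by (auto simp: norm_divide exp_minus)
  moreover have "cmod (?B z) > 0" using Bnz[of z] zx by simp
  ultimately have "\<beta> / 2 \<le> cmod (?B z)" "cmod (?B z) \<le> 2 * \<beta>" by (auto simp: field_simps)
  moreover have "N \<ge> N0" using N(1) by simp
  ultimately show ?thesis by blast
qed

end

section \<open>A weighted norm on Taylor coefficients\<close>

definition taylor :: "(complex \<Rightarrow> complex) \<Rightarrow> nat \<Rightarrow> complex" where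
  "taylor F m = (deriv ^^ m) F 0 / fact m"

lemma taylor_sums: "entire F \<Longrightarrow> (\<lambda>m. taylor F m * z ^ m) sums F z"
  using holomorphic_power_series[of F 0 "cmod z + 1" z]
  by (auto simp: taylor_def entire_def intro: holomorphic_on_subset)

lemma taylor_bound:
  assumes "entire F" "0 < x" "\<And>z. cmod z = x \<Longrightarrow> cmod (F z) \<le> B"
  shows "cmod (taylor F m) \<le> B / x ^ m"
proof -
  have "cmod ((deriv ^^ m) F 0) \<le> fact m * B / x ^ m"
    using assms by (intro Cauchy_inequality entire_continuous_on) (auto simp: entire_def intro: holomorphic_on_subset)
  then show ?thesis by (simp add: taylor_def norm_divide divide_le_eq mult_ac)
qed

lemma taylor_add_cmult:
  assumes "entire F" "entire G"
  shows "taylor (\<lambda>z. F z + c * G z) m = taylor F m + c * taylor G m"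
proof -
  have "(deriv ^^ m) (\<lambda>z. F z + c * G z) 0 = (deriv ^^ m) F 0 + (deriv ^^ m) (\<lambda>z. c * G z) 0"
    using assms by (intro higher_deriv_add[where S = UNIV]) (auto simp: entire_def intro!: holomorphic_intros)
  also have "(deriv ^^ m) (\<lambda>z. c * G z) 0 = c * (deriv ^^ m) G 0"
    using assms by (intro higher_deriv_cmult[where A = UNIV]) (auto simp: entire_def)
  finally show ?thesis by (simp add: taylor_def add_divide_distrib)
qed

lemma taylor_sum:
  assumes "finite J" "\<And>n. n \<in> J \<Longrightarrow> entire (f n)"
  shows "entire (\<lambda>z. \<Sum>n\<in>J. a n * f n z) \<and> taylor (\<lambda>z. \<Sum>n\<in>J. a n * f n z) m = (\<Sum>n\<in>J. a n * taylor (f n) m)"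
  using assms
proof (induction J rule: finite_induct)
  case empty
  show ?case by (simp add: taylor_def entire_def)
next
  case (insert x J)
  have e: "entire (\<lambda>z. \<Sum>n\<in>J. a n * f n z)" "entire (f x)" using insert by auto
  have "(\<lambda>z. \<Sum>n\<in>insert x J. a n * f n z) = (\<lambda>z. (\<Sum>n\<in>J. a n * f n z) + a x * f x z)"
    using insert by (auto simp: add.commute)
  moreover have "entire (\<lambda>z. (\<Sum>n\<in>J. a n * f n z) + a x * f x z)"
    using e unfolding entire_def by (intro holomorphic_on_add holomorphic_on_mult holomorphic_on_const)
  ultimately show ?case using taylor_add_cmult[OF e, of "a x" m] insert by (simp add: add.commute)
qed

context polynomial_de_branges begin

lemma taylor_bounded:
  "\<exists>C\<ge>0. \<forall>F\<in>de_branges E. (cmod (taylor F m))^2 \<le> C * energy E F"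
proof -
  obtain C where C: "C \<ge> 0" "\<forall>F\<in>de_branges E. \<forall>z. cmod z \<le> 1 \<longrightarrow> (cmod (F z))^2 \<le> C * energy E F"
    using energy_bound_local[of 1] by auto
  have "(cmod (taylor F m))^2 \<le> C * energy E F" if F: "F \<in> de_branges E" for F
  proof -
    have "cmod (taylor F m) \<le> sqrt (C * energy E F) / 1 ^ m"
      using C(2) F by (intro taylor_bound de_branges_entire real_le_rsqrt) auto
    then show ?thesis using C(1) power_mono[of "cmod (taylor F m)" "sqrt (C * energy E F)" 2] by simp
  qed
  then show ?thesis using C(1) by blast
qed

end

text \<open>
  Truncation of the two sums in the regularity condition to finitely many terms suffices for
  geometric estimates and avoids questions of summability.
\<close>

locale regular_lacunary_basis = lacunary_spectral_basis E A s \<nu> r q \<kappa> for E A s \<nu> r q \<kappa> +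
  fixes c :: real
  assumes c: "1 < c"
    and head_sum: "\<And>n. (\<Sum>k\<le>n. \<nu> k) \<le> c * \<nu> n"
    and tail_sum: "\<And>n M. n \<le> M \<Longrightarrow> (\<Sum>k=n..M. \<nu> k / (r k)^2) \<le> c * (\<nu> n / (r n)^2)"
begin

lemma g_entire: "entire (g n)"
  by (rule de_branges_entire[OF g_mem]) simp

definition \<sigma> :: real where "\<sigma> = sqrt (1 - 1 / c)"

lemma \<sigma>: "0 < \<sigma>" "\<sigma> < 1"
  using c by (auto simp: \<sigma>_def)

lemma sqrt_weight_growth: "m \<le> n \<Longrightarrow> sqrt (\<nu> m) \<le> sqrt c * \<sigma> ^ (n - m) * sqrt (\<nu> n)"
proof -
  assume "m \<le> n"
  then have "\<nu> m \<le> c * (1 - 1 / c) ^ (n - m) * \<nu> n"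
    using c by (intro geometric_growth_of_partial_sum_bound \<nu>_pos head_sum) auto
  then have "sqrt (\<nu> m) \<le> sqrt (c * (1 - 1 / c) ^ (n - m) * \<nu> n)" by (rule real_sqrt_le_mono)
  then show ?thesis by (simp add: \<sigma>_def real_sqrt_mult real_sqrt_power)
qed

lemma sqrt_weight_decay: "n \<le> m \<Longrightarrow> sqrt (\<nu> m) / r m \<le> sqrt c * \<sigma> ^ (m - n) * (sqrt (\<nu> n) / r n)"
proof -
  assume "n \<le> m"
  moreover have "0 < \<nu> k / (r k)^2" for k using \<nu>_pos[of k] r_pos[of k] by simp
  ultimately have "\<nu> m / (r m)^2 \<le> c * (1 - 1 / c) ^ (m - n) * (\<nu> n / (r n)^2)"
    using c tail_sum geometric_decay_of_tail_bound[of "\<lambda>k. \<nu> k / (r k)^2" c n m] by simp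
  then have "sqrt (\<nu> m / (r m)^2) \<le> sqrt (c * (1 - 1 / c) ^ (m - n) * (\<nu> n / (r n)^2))" by (rule real_sqrt_le_mono)
  then show ?thesis using r_pos[of m] r_pos[of n]
    by (simp add: \<sigma>_def real_sqrt_mult real_sqrt_power real_sqrt_divide)
qed

definition R :: "nat \<Rightarrow> real" where "R m = (\<Prod>k<m. r k)"

lemma R_pos: "0 < R m"
  unfolding R_def using r_pos by (intro prod_pos) auto

lemma R_Suc: "R (Suc m) = R m * r m"
  by (simp add: R_def)

lemma R_ratio_upper: "m \<le> n \<Longrightarrow> R (Suc n) \<le> R (Suc m) * r n ^ (n - m)"
proof (induction n rule: dec_induct)
  case (step n)
  have "R (Suc (Suc n)) \<le> R (Suc m) * r n ^ (n - m) * r (Suc n)"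
    unfolding R_Suc[of "Suc n"] using step r_pos[of "Suc n"] by (intro mult_right_mono) auto
  also have "\<dots> \<le> R (Suc m) * r (Suc n) ^ (n - m) * r (Suc n)"
    using r_mono[of n "Suc n"] r_pos R_pos
    by (intro mult_right_mono mult_left_mono power_mono) (auto simp: less_imp_le)
  finally show ?case using step by (simp add: Suc_diff_le mult_ac)
qed simp

lemma R_ratio_lower: "n < m \<Longrightarrow> R (Suc n) * r n ^ (m - n - 1) * r m \<le> R (Suc m)"
proof (induction m)
  case (Suc m)
  show ?case
  proof (cases "n = m")
    case True
    then show ?thesis by (simp add: R_Suc)
  next
    case False
    then have nm: "n < m" using Suc by simp
    have "R (Suc n) * r n ^ (Suc m - n - 1) = R (Suc n) * r n ^ (m - n - 1) * r n"
      using nm by (simp add: Suc_diff_Suc flip: power_Suc2)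
    also have "\<dots> \<le> R (Suc n) * r n ^ (m - n - 1) * r m"
      using r_mono[of n m] nm R_pos[of "Suc n"] r_pos[of n] by (intro mult_left_mono) auto
    also have "\<dots> \<le> R (Suc m)" using Suc.IH nm by simp
    finally show ?thesis
      unfolding R_Suc[of "Suc m"] using r_pos[of "Suc m"] by (intro mult_right_mono) auto
  qed
qed simp

text \<open>
  The size of \<open>z\<^sup>m\<close> in the space, up to constants.
\<close>

definition w :: "nat \<Rightarrow> real" where "w m = R (Suc m) / sqrt (\<nu> m)"

lemma w_pos: "0 < w m"
  using R_pos \<nu>_pos by (simp add: w_def)

definition c_low where "c_low = exp (- L * (2 / (1 - \<theta>))) * \<beta> / 2"

lemma c_low_pos: "c_low > 0"
  using \<beta>_pos by (simp add: c_low_def)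

text \<open>
  At the node \<open>s n\<close>, the factors with \<open>k < n\<close> have size \<open>r n / r k\<close> and those with \<open>k > n\<close> have
  size \<open>1\<close>.
\<close>

lemma spectral_function_lower:
  "c_low * sqrt (\<nu> n) * r n ^ n / R (Suc n) \<le> cmod (g n (of_real (s n)))"
proof -
  obtain N where N: "Suc n \<le> N" "\<beta> / 2 \<le> cmod (cofactor N (of_real (s n)))"
    using cofactor_bounded by metis
  have "cmod (\<Prod>k\<in>{..<N} - {n}. \<phi> k (of_real (s n))) = (\<Prod>k\<in>{..<N} - {n}. \<bar>s n - s k\<bar> / r k)"
    by (simp only: prod_norm[symmetric] cmod_\<phi>_node)
  moreover have "exp (- L * (2 / (1 - \<theta>))) * (r n ^ n / R n) \<le> (\<Prod>k\<in>{..<N} - {n}. \<bar>s n - s k\<bar> / r k)"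
    using prod_distance_lower[of n N] N(1) by (simp add: R_def prod_dividef)
  ultimately have P: "exp (- L * (2 / (1 - \<theta>))) * (r n ^ n / R n) \<le> cmod (\<Prod>k\<in>{..<N} - {n}. \<phi> k (of_real (s n)))"
    by simp
  have "c_low * sqrt (\<nu> n) * r n ^ n / R (Suc n)
      = (sqrt (\<nu> n) / r n) * (exp (- L * (2 / (1 - \<theta>))) * (r n ^ n / R n)) * (\<beta> / 2)"
    unfolding R_Suc c_low_def by (simp add: field_simps)
  also have "\<dots> \<le> (sqrt (\<nu> n) / r n) * cmod (\<Prod>k\<in>{..<N} - {n}. \<phi> k (of_real (s n))) * cmod (cofactor N (of_real (s n)))"
    using P N(2) \<beta>_pos \<nu>_pos[of n] r_pos[of n] R_pos[of n]
    by (intro mult_mono mult_left_mono P) (auto intro!: mult_nonneg_nonneg divide_nonneg_nonneg)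
  also have "\<dots> = cmod (g n (of_real (s n)))"
    using N(1) r_pos[of n] \<nu>_pos[of n]
    by (subst spectral_function_factorization[of n N]) (simp_all add: norm_mult norm_divide)
  finally show ?thesis .
qed

definition c_up where "c_up = exp (sqrt q * (2 / (1 - \<theta>))) * (2 * \<beta>)"

lemma c_up_pos: "c_up > 0"
  using \<beta>_pos by (simp add: c_up_def)

text \<open>
  On \<open>|z| \<le> r m\<close> only the factors with \<open>k < m\<close> count; the factor of the node \<open>n\<close> itself is
  missing, which matters only for \<open>n < m\<close>.
\<close>

lemma spectral_function_upper:
  assumes z: "cmod z \<le> r m"
  shows "cmod (g n z) \<le> c_up * (sqrt (\<nu> n) / r n) * ((if n < m then r n / r m else 1) * (r m ^ m / R m))"
proof -
  obtain N where N: "max (Suc n) m \<le> N" "cmod (cofactor N z) \<le> 2 * \<beta>"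
    using cofactor_bounded by metis
  have "{k \<in> {..<N} - {n}. k < m} = {..<m} - {n}" using N(1) by auto
  moreover have "(\<Prod>k\<in>{..<m} - {n}. r m / r k) = (if n < m then r n / r m else 1) * (\<Prod>k<m. r m / r k)"
  proof (cases "n < m")
    case True
    then have "(\<Prod>k<m. r m / r k) = (r m / r n) * (\<Prod>k\<in>{..<m} - {n}. r m / r k)"
      by (intro prod.remove) auto
    then show ?thesis using True r_pos[of n] r_pos[of m] by simp
  qed simp
  moreover have "(\<Prod>k<m. r m / r k) = r m ^ m / R m" by (simp add: R_def prod_dividef)
  moreover have "cmod (\<Prod>k\<in>{..<N} - {n}. \<phi> k z) \<le> (\<Prod>k\<in>{..<N} - {n}. 1 + r m / r k)"
    by (rule prod_\<phi>_le[OF z]) simp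
  ultimately have P: "cmod (\<Prod>k\<in>{..<N} - {n}. \<phi> k z)
      \<le> exp (sqrt q * (2 / (1 - \<theta>))) * ((if n < m then r n / r m else 1) * (r m ^ m / R m))"
    using prod_growth_upper[of "{..<N} - {n}" m] by simp
  have "cmod (g n z) = (sqrt (\<nu> n) / r n) * cmod (\<Prod>k\<in>{..<N} - {n}. \<phi> k z) * cmod (cofactor N z)"
    using N(1) r_pos[of n] \<nu>_pos[of n]
    by (subst spectral_function_factorization[of n N]) (simp_all add: norm_mult norm_divide)
  also have "\<dots> \<le> (sqrt (\<nu> n) / r n) * (exp (sqrt q * (2 / (1 - \<theta>))) * ((if n < m then r n / r m else 1) * (r m ^ m / R m))) * (2 * \<beta>)"
    using P N(2) \<nu>_pos[of n] r_pos R_pos[of m] \<beta>_pos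
    by (intro mult_mono mult_left_mono P mult_nonneg_nonneg divide_nonneg_nonneg) (auto simp: less_imp_le)
  finally show ?thesis by (simp add: c_up_def mult_ac)
qed

text \<open>
  Cauchy's estimate on the circle of radius \<open>r m\<close>. The quotient of weights left over is governed
  by the growth of \<open>\<nu>\<close> for \<open>n < m\<close> and by the decay of \<open>\<nu> / r\<^sup>2\<close> for \<open>n \<ge> m\<close>.
\<close>

lemma taylor_spectral_function:
  "cmod (taylor (g n) m) * w m \<le> c_up * sqrt c * \<sigma> ^ ((m - n) + (n - m))"
proof -
  let ?i = "if n < m then r n / r m else 1"
  have "cmod (taylor (g n) m) \<le> c_up * (sqrt (\<nu> n) / r n) * (?i * (r m ^ m / R m)) / r m ^ m"
    using r_pos[of m] by (intro taylor_bound spectral_function_upper g_entire) auto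
  also have "\<dots> = c_up * (sqrt (\<nu> n) / r n) * (?i / R m)" using r_pos[of m] by simp
  finally have "cmod (taylor (g n) m) * w m \<le> c_up * (sqrt (\<nu> n) / r n) * (?i / R m) * w m"
    using w_pos[of m] by (intro mult_right_mono) auto
  also have "\<dots> = c_up * ((sqrt (\<nu> n) / r n) * ?i * (r m / sqrt (\<nu> m)))"
    using R_pos[of m] by (simp add: w_def R_Suc)
  also have "(sqrt (\<nu> n) / r n) * ?i * (r m / sqrt (\<nu> m)) \<le> sqrt c * \<sigma> ^ ((m - n) + (n - m))"
  proof (cases "n < m")
    case True
    have "(sqrt (\<nu> n) / r n) * ?i * (r m / sqrt (\<nu> m)) = sqrt (\<nu> n) / sqrt (\<nu> m)"
      using True r_pos[of n] r_pos[of m] by simp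
    also have "\<dots> \<le> sqrt c * \<sigma> ^ (m - n)"
      using sqrt_weight_growth[of n m] True \<nu>_pos[of m] by (simp add: divide_le_eq)
    finally show ?thesis using True by simp
  next
    case False
    have p: "sqrt (\<nu> m) / r m > 0" using \<nu>_pos[of m] r_pos[of m] by simp
    have "(sqrt (\<nu> n) / r n) * ?i * (r m / sqrt (\<nu> m)) = (sqrt (\<nu> n) / r n) / (sqrt (\<nu> m) / r m)"
      using False by simp
    also have "\<dots> \<le> sqrt c * \<sigma> ^ (n - m)"
      using sqrt_weight_decay[of m n] False p by (simp only: pos_divide_le_eq not_less)
    finally show ?thesis using False by simp
  qed
  finally show ?thesis using c_up_pos by (simp add: mult_ac)
qed

text \<open>
  The spectral coefficients of the normalised monomials. The powers of \<open>r n\<close> are balanced against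
  the products \<open>R\<close>, which leaves the same quotients of weights as for the Taylor coefficients of
  the basis functions.
\<close>

lemma monomial_spectral_coefficient:
  "\<bar>s n\<bar> ^ m / (cmod (g n (of_real (s n))) * w m) \<le> sqrt c / c_low * \<sigma> ^ ((m - n) + (n - m))"
proof -
  let ?X = "r n ^ m * R (Suc n) / (r n ^ n * R (Suc m)) * (sqrt (\<nu> m) / sqrt (\<nu> n))"
  define low where "low = c_low * sqrt (\<nu> n) * r n ^ n / R (Suc n)"
  have low: "low > 0" using c_low_pos \<nu>_pos[of n] r_pos[of n] R_pos by (simp add: low_def)
  have "\<bar>s n\<bar> ^ m / (cmod (g n (of_real (s n))) * w m) \<le> r n ^ m / (low * w m)"
    using s_le[of n] spectral_function_lower[of n] low w_pos[of m]
    by (intro frac_le power_mono mult_right_mono) (auto simp: low_def[symmetric])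
  also have "\<dots> = (1 / c_low) * ?X"
    by (simp add: low_def w_def mult_ac)
  finally have bound: "\<bar>s n\<bar> ^ m / (cmod (g n (of_real (s n))) * w m)
      \<le> (1 / c_low) * ?X" .
  have "?X \<le> sqrt c * \<sigma> ^ ((m - n) + (n - m))"
  proof (cases "m \<le> n")
    case True
    have "r n ^ m * R (Suc n) \<le> r n ^ m * (R (Suc m) * r n ^ (n - m))"
      using R_ratio_upper[OF True] r_pos[of n] by (intro mult_left_mono) auto
    also have "\<dots> = r n ^ n * R (Suc m)" using True by (simp add: power_add[symmetric])
    finally have "r n ^ m * R (Suc n) / (r n ^ n * R (Suc m)) \<le> 1" using r_pos[of n] R_pos[of "Suc m"] by simp
    then have "?X \<le> 1 * (sqrt (\<nu> m) / sqrt (\<nu> n))"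
      using \<nu>_pos by (intro mult_right_mono) (auto simp: less_imp_le)
    also have "\<dots> \<le> sqrt c * \<sigma> ^ (n - m)"
      using sqrt_weight_growth[OF True] \<nu>_pos[of n] by (simp add: divide_le_eq)
    finally show ?thesis using True by simp
  next
    case False
    then have nm: "n < m" by simp
    have "r n ^ m * R (Suc n) * r m = r n ^ n * r n * (R (Suc n) * r n ^ (m - n - 1) * r m)"
    proof -
      have "r n ^ m = r n ^ n * r n * r n ^ (m - n - 1)"
        using nm power_add[of "r n" "n + 1" "m - n - 1"] by (simp add: mult_ac)
      then show ?thesis by simp
    qed
    also have "\<dots> \<le> r n ^ n * r n * R (Suc m)"
      using R_ratio_lower[OF nm] r_pos[of n] by (intro mult_left_mono) auto
    finally have "r n ^ m * R (Suc n) / (r n ^ n * R (Suc m)) \<le> r n / r m"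
      using r_pos[of n] r_pos[of m] R_pos[of "Suc m"] by (simp add: field_simps)
    then have "?X
        \<le> r n / r m * (sqrt (\<nu> m) / sqrt (\<nu> n))"
      using \<nu>_pos by (intro mult_right_mono) (auto simp: less_imp_le)
    also have "\<dots> = (sqrt (\<nu> m) / r m) / (sqrt (\<nu> n) / r n)" by simp
    also have "\<dots> \<le> sqrt c * \<sigma> ^ (m - n)"
    proof -
      have "sqrt (\<nu> n) / r n > 0" using \<nu>_pos[of n] r_pos[of n] by simp
      then show ?thesis using sqrt_weight_decay[of n m] nm by (simp only: pos_divide_le_eq less_imp_le)
    qed
    finally show ?thesis using nm by simp
  qed
  then have "(1 / c_low) * ?X
      \<le> (1 / c_low) * (sqrt c * \<sigma> ^ ((m - n) + (n - m)))"
    using c_low_pos by (intro mult_left_mono) auto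
  with bound show ?thesis by simp
qed

definition D_up where "D_up = (sqrt c / c_low * (2 / (1 - \<sigma>)))^2"
definition D_low where "D_low = (c_up * sqrt c * (2 / (1 - \<sigma>)))^2"

text \<open>
  The spectral coefficients of a polynomial are its values at the nodes divided by those of the
  basis functions, hence the image of its coefficients under the matrix estimated above.
\<close>

lemma energy_poly_le:
  "energy E (\<lambda>z. \<Sum>m<N. a m * z ^ m) \<le> D_up * (\<Sum>m<N. (w m)^2 * (cmod (a m))^2)"
proof -
  let ?p = "\<lambda>z. \<Sum>m<N. a m * z ^ m"
  have "?p = poly (\<Sum>m<N. monom (a m) m)" by (auto simp: poly_sum poly_monom)
  then have mem: "?p \<in> de_branges E" using poly_mem by simp
  show ?thesis
  proof (rule energy_le_of_coef_bound[OF mem])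
    fix J :: "nat set" assume J: "finite J"
    define b where "b n m = of_real (s n) ^ m / (g n (of_real (s n)) * of_real (w m))" for n m
    have cf: "coef ?p n = (\<Sum>m<N. b n m * (of_real (w m) * a m))" for n
    proof -
      have "coef ?p n = (\<Sum>m<N. a m * of_real (s n) ^ m) / g n (of_real (s n))"
        using coef_eq_value[OF mem, of n] g_at_self_nonzero[of n] by (simp add: field_simps)
      also have "\<dots> = (\<Sum>m<N. b n m * (of_real (w m) * a m))"
        unfolding sum_divide_distrib
        by (intro sum.cong) (use w_pos[THEN less_imp_neq] in \<open>auto simp: b_def\<close>)
      finally show ?thesis .
    qed
    have "(\<Sum>n\<in>J. (cmod (coef ?p n))^2) \<le> D_up * (\<Sum>m<N. (cmod (of_real (w m) * a m))^2)"
      unfolding cf D_up_def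
    proof (rule schur_test[OF \<sigma> _ _ J])
      show "0 \<le> sqrt c / c_low" using c c_low_pos by simp
      show "cmod (b n m) \<le> sqrt c / c_low * \<sigma> ^ ((n - m) + (m - n))" for n m
        using monomial_spectral_coefficient[of n m] w_pos[of m]
        by (simp add: b_def norm_divide norm_mult norm_power add.commute)
    qed simp
    then show "(\<Sum>n\<in>J. (cmod (coef ?p n))^2) \<le> D_up * (\<Sum>m<N. (w m)^2 * (cmod (a m))^2)"
      by (simp add: norm_mult power_mult_distrib)
  qed
qed

lemma taylor_energy_finite_sum:
  assumes J: "finite J"
  shows "(\<Sum>m<N. (w m)^2 * (cmod (taylor (\<lambda>z. \<Sum>n\<in>J. a n * g n z) m))^2) \<le> D_low * (\<Sum>n\<in>J. (cmod (a n))^2)"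
proof -
  define b where "b m n = of_real (w m) * taylor (g n) m" for m n
  have "of_real (w m) * taylor (\<lambda>z. \<Sum>n\<in>J. a n * g n z) m = (\<Sum>n\<in>J. b m n * a n)" for m
    using taylor_sum[of J g a m] J g_entire by (simp add: b_def sum_distrib_left mult_ac)
  then have "(w m)^2 * (cmod (taylor (\<lambda>z. \<Sum>n\<in>J. a n * g n z) m))^2 = (cmod (\<Sum>n\<in>J. b m n * a n))^2" for m
    by (simp add: norm_mult power_mult_distrib flip: \<open>\<And>m. _ = (\<Sum>n\<in>J. b m n * a n)\<close>)
  moreover have "(\<Sum>m<N. (cmod (\<Sum>n\<in>J. b m n * a n))^2) \<le> D_low * (\<Sum>n\<in>J. (cmod (a n))^2)"
    unfolding D_low_def
  proof (rule schur_test[OF \<sigma> _ _ _ J])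
    show "0 \<le> c_up * sqrt c" using c c_up_pos by simp
    show "cmod (b m n) \<le> c_up * sqrt c * \<sigma> ^ ((m - n) + (n - m))" for m n
      using taylor_spectral_function[of n m] w_pos[of m] by (simp add: b_def norm_mult mult.commute)
  qed simp
  ultimately show ?thesis by simp
qed

text \<open>
  The estimate for finite combinations of basis functions passes to the closure because each
  Taylor coefficient is a bounded functional; the factor \<open>2\<close> stems from splitting squares.
\<close>

lemma taylor_energy_le:
  assumes F: "F \<in> de_branges E"
  shows "(\<Sum>m<N. (w m)^2 * (cmod (taylor F m))^2) \<le> 2 * D_low * energy E F"
proof -
  obtain C where C: "\<And>m. 0 \<le> C m" "\<And>m F. F \<in> de_branges E \<Longrightarrow> (cmod (taylor F m))^2 \<le> C m * energy E F"
  proof -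
    have "\<forall>m. \<exists>C. 0 \<le> C \<and> (\<forall>F\<in>de_branges E. (cmod (taylor F m))^2 \<le> C * energy E F)"
      using taylor_bounded by blast
    from choice[OF this] show ?thesis using that by blast
  qed
  \<comment> \<open>the approximation error enters finitely many coefficients with total weight at most \<open>K\<close>\<close>
  define K where "K = (\<Sum>m<N. (w m)^2 * (2 * C m)) + 1"
  have "(\<Sum>m<N. (w m)^2 * (2 * C m)) \<ge> 0" using C(1) by (intro sum_nonneg mult_nonneg_nonneg) auto
  then have K: "K > 0" by (simp add: K_def)
  show ?thesis
  proof (rule field_le_epsilon)
    fix e :: real assume e: "e > 0"
    have eK: "e / K > 0" using e K by simp
    obtain J where J: "finite J" "J \<subseteq> UNIV"
      "\<forall>J'. finite J' \<longrightarrow> J' \<subseteq> UNIV \<longrightarrow> J \<subseteq> J' \<longrightarrow> energy E (\<lambda>z. F z - (\<Sum>n\<in>J'. coef F n * g n z)) < e / K"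
      by (rule expansion_converges[OF F eK])
    define P where "P = (\<lambda>z. \<Sum>n\<in>J. coef F n * g n z)"
    define D where "D = (\<lambda>z. F z - P z)"
    have D: "D \<in> de_branges E" "energy E D < e / K"
      using J de_branges_diff_sum[OF F J(1), of g "coef F"] g_mem by (auto simp: D_def P_def)
    have P: "P \<in> de_branges E" unfolding P_def using J g_mem by (intro de_branges_sum) auto
    have "F = (\<lambda>z. P z + 1 * D z)" by (simp add: D_def)
    then have tF: "taylor F m = taylor P m + taylor D m" for m
      using taylor_add_cmult[OF de_branges_entire[OF P] de_branges_entire[OF D(1)], of 1 m] by simp
    have sq: "(cmod (taylor F m))^2 \<le> 2 * (cmod (taylor P m))^2 + 2 * C m * energy E D" for m
    proof -
      have "(cmod (taylor F m))^2 \<le> (cmod (taylor P m) + cmod (taylor D m))^2"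
        unfolding tF by (intro power_mono norm_triangle_ineq) auto
      also have "\<dots> \<le> 2 * (cmod (taylor P m))^2 + 2 * (cmod (taylor D m))^2"
        using sum_squares_bound[of "cmod (taylor P m)" "cmod (taylor D m)"] by (simp add: power2_sum)
      finally show ?thesis using C(2)[OF D(1), of m] by simp
    qed
    have "(\<Sum>m<N. (w m)^2 * (cmod (taylor F m))^2)
       \<le> (\<Sum>m<N. (w m)^2 * (2 * (cmod (taylor P m))^2 + 2 * C m * energy E D))"
      by (intro sum_mono mult_left_mono sq) auto
    also have "\<dots> = 2 * (\<Sum>m<N. (w m)^2 * (cmod (taylor P m))^2) + (\<Sum>m<N. (w m)^2 * (2 * C m)) * energy E D"
      by (simp add: distrib_left sum.distrib sum_distrib_left sum_distrib_right mult_ac)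
    also have "\<dots> \<le> 2 * (D_low * energy E F) + K * (e / K)"
    proof (intro add_mono mult_left_mono mult_mono)
      have "(\<Sum>m<N. (w m)^2 * (cmod (taylor P m))^2) \<le> D_low * (\<Sum>n\<in>J. (cmod (coef F n))^2)"
        unfolding P_def by (rule taylor_energy_finite_sum[OF J(1)])
      also have "\<dots> \<le> D_low * energy E F"
        using bessel[OF F J(1)] by (intro mult_left_mono) (auto simp: D_low_def)
      finally show "(\<Sum>m<N. (w m)^2 * (cmod (taylor P m))^2) \<le> D_low * energy E F" .
    qed (use D K in \<open>auto simp: K_def\<close>)
    also have "\<dots> = 2 * D_low * energy E F + e" using K by simp
    finally show "(\<Sum>m<N. (w m)^2 * (cmod (taylor F m))^2) \<le> 2 * D_low * energy E F + e" .
  qed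
qed

end

section \<open>Hausdorff operators as coefficient multipliers\<close>

locale hausdorff_kernel =
  fixes \<mu> :: "real measure" and \<Phi> :: "real \<Rightarrow> complex" and \<delta> :: real
  assumes sets_\<mu>: "sets \<mu> = sets (restrict_space borel {0<..})"
    and \<Phi>_measurable [measurable]: "\<Phi> \<in> borel_measurable (completion \<mu>)"
    and \<delta>: "0 < \<delta>"
    and vanishes: "AE u in \<mu>. u < \<delta> \<longrightarrow> \<Phi> u = 0"
begin

lemma dilation_measurable [measurable]:
  assumes F: "entire F"
  shows "(\<lambda>u. F (z / of_real u)) \<in> borel_measurable (completion \<mu>)"
proof -
  have [measurable]: "F \<in> borel_measurable borel"
    by (intro borel_measurable_continuous_onI entire_continuous_on F)
  have "(\<lambda>u::real. F (z / of_real u)) \<in> borel_measurable borel" by measurable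
  then have "(\<lambda>u::real. F (z / of_real u)) \<in> borel_measurable (restrict_space borel {0<..})"
    by (rule measurable_restrict_space1)
  then have "(\<lambda>u::real. F (z / of_real u)) \<in> borel_measurable \<mu>"
    using measurable_cong_sets[OF sets_\<mu> refl] by blast
  then show ?thesis by (rule measurable_completion)
qed

text \<open>
  Only \<open>u \<ge> \<delta>\<close> matters, where \<open>z / u\<close> stays in a disc; this makes all integrands below multiples
  of the integrable function \<open>\<Phi>\<close>.
\<close>

lemma AE_kernel_bound:
  assumes bd: "\<And>u. \<delta> \<le> u \<Longrightarrow> cmod (f u) \<le> B"
  shows "AE u in completion \<mu>. cmod (\<Phi> u * f u) \<le> B * cmod (\<Phi> u)"
  using AE_completion[OF vanishes]
proof eventually_elim
  case (elim u)
  show ?case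
  proof (cases "u < \<delta>")
    case False
    then have "cmod (\<Phi> u) * cmod (f u) \<le> cmod (\<Phi> u) * B" by (intro mult_left_mono bd) auto
    then show ?thesis by (simp add: norm_mult mult.commute)
  qed (use elim in simp)
qed

context
  assumes integrable_\<Phi>: "integrable (completion \<mu>) \<Phi>"
begin

lemma integrable_kernel_mult:
  assumes [measurable]: "f \<in> borel_measurable (completion \<mu>)" and bd: "\<And>u. \<delta> \<le> u \<Longrightarrow> cmod (f u) \<le> B"
  shows "integrable (completion \<mu>) (\<lambda>u. \<Phi> u * f u)"
proof (rule Bochner_Integration.integrable_bound)
  show "integrable (completion \<mu>) (\<lambda>u. B * cmod (\<Phi> u))" using integrable_\<Phi> by (intro integrable_mult_right integrable_norm)
  have "AE u in completion \<mu>. cmod (\<Phi> u * f u) \<le> B * cmod (\<Phi> u)" by (rule AE_kernel_bound[OF bd])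
  then show "AE u in completion \<mu>. cmod (\<Phi> u * f u) \<le> norm (B * cmod (\<Phi> u))"
    by eventually_elim simp
qed measurable

text \<open>
  Termwise integration of the Taylor series. The partial sums are dominated by the absolutely
  convergent series at \<open>|z| / \<delta>\<close> times \<open>|\<Phi>|\<close>.
\<close>

lemma hausdorff_op_sums:
  assumes F: "entire F"
  shows "integrable (completion \<mu>) (\<lambda>u. \<Phi> u * F (z / of_real u))"
    and "(\<lambda>m. moment \<Phi> \<mu> m * taylor F m * z ^ m) sums hausdorff_op \<Phi> \<mu> F z"
proof -
  let ?p = "\<lambda>N u. \<Sum>m<N. taylor F m * (z / of_real u) ^ m"
  define x where "x = cmod z / \<delta>"
  have x0: "x \<ge> 0" using \<delta> by (simp add: x_def)
  have "cmod (of_real x) < cmod (of_real (x + 1))" unfolding norm_of_real using x0 by simp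
  moreover have "summable (\<lambda>m. taylor F m * of_real (x + 1) ^ m)"
    using taylor_sums[OF F, of "of_real (x + 1)"] by (rule sums_summable)
  ultimately have "summable (\<lambda>m. cmod (taylor F m * of_real x ^ m))"
    by (intro powser_insidea[where x = "of_real (x + 1)"])
  then have summ: "summable (\<lambda>m. cmod (taylor F m) * x ^ m)" using x0 by (simp add: norm_mult norm_power)
  define B where "B = (\<Sum>m. cmod (taylor F m) * x ^ m)"
  have zu: "cmod (z / of_real u) \<le> x" if "\<delta> \<le> u" for u
    unfolding x_def norm_divide using that \<delta> by (intro frac_le) auto
  have part: "cmod (?p N u) \<le> B" if "\<delta> \<le> u" for u N
  proof -
    have "cmod (?p N u) \<le> (\<Sum>m<N. cmod (taylor F m) * x ^ m)"
      using zu[OF that] by (intro sum_norm_le) (auto simp: norm_mult norm_power intro!: mult_left_mono power_mono)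
    also have "\<dots> \<le> B" unfolding B_def using x0 by (intro sum_le_suminf summ) auto
    finally show ?thesis .
  qed
  have pow_meas [measurable]: "(\<lambda>u. (z / of_real u) ^ m) \<in> borel_measurable (completion \<mu>)" for m and z :: complex
  proof -
    have "entire (\<lambda>z. z ^ m)" unfolding entire_def by (intro holomorphic_intros)
    from dilation_measurable[OF this, of z] show ?thesis .
  qed
  have lim: "AE u in completion \<mu>. (\<lambda>N. \<Phi> u * ?p N u) \<longlonglongrightarrow> \<Phi> u * F (z / of_real u)"
    using taylor_sums[OF F] by (intro AE_I2 tendsto_mult tendsto_const) (simp add: sums_def)
  have dom: "AE u in completion \<mu>. norm (\<Phi> u * ?p N u) \<le> B * cmod (\<Phi> u)" for N
    by (rule AE_kernel_bound[OF part])
  have intB: "integrable (completion \<mu>) (\<lambda>u. B * cmod (\<Phi> u))" using integrable_\<Phi> by (intro integrable_mult_right integrable_norm)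
  have m1: "(\<lambda>u. \<Phi> u * F (z / of_real u)) \<in> borel_measurable (completion \<mu>)"
    using F by measurable
  have m2: "(\<lambda>u. \<Phi> u * ?p N u) \<in> borel_measurable (completion \<mu>)" for N
    by measurable
  note dc = m1 m2 intB lim dom
  show "integrable (completion \<mu>) (\<lambda>u. \<Phi> u * F (z / of_real u))"
    by (rule integrable_dominated_convergence[OF dc])
  have conv: "(\<lambda>N. LINT u|completion \<mu>. \<Phi> u * ?p N u) \<longlonglongrightarrow> hausdorff_op \<Phi> \<mu> F z"
    unfolding hausdorff_op_def by (rule integral_dominated_convergence[OF dc])
  have "(LINT u|completion \<mu>. \<Phi> u * ?p N u) = (\<Sum>m<N. moment \<Phi> \<mu> m * taylor F m * z ^ m)" for N
  proof -
    have "(LINT u|completion \<mu>. \<Phi> u * ?p N u)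
        = (LINT u|completion \<mu>. (\<Sum>m<N. taylor F m * z ^ m * (\<Phi> u / of_real u ^ m)))"
      by (intro Bochner_Integration.integral_cong) (auto simp: sum_distrib_left power_divide mult_ac)
    also have "\<dots> = (\<Sum>m<N. LINT u|completion \<mu>. taylor F m * z ^ m * (\<Phi> u / of_real u ^ m))"
    proof (intro Bochner_Integration.integral_sum integrable_mult_right)
      fix m
      have "integrable (completion \<mu>) (\<lambda>u. \<Phi> u * (1 / of_real u) ^ m)"
      proof (rule integrable_kernel_mult)
        show "cmod ((1 / of_real u) ^ m) \<le> (1 / \<delta>) ^ m" if "\<delta> \<le> u" for u
          using that \<delta> by (auto simp: norm_power norm_divide intro!: power_mono frac_le)
      qed measurable
      then show "integrable (completion \<mu>) (\<lambda>u. \<Phi> u / of_real u ^ m)" by (simp add: power_one_over)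
    qed
    also have "\<dots> = (\<Sum>m<N. moment \<Phi> \<mu> m * taylor F m * z ^ m)"
      by (simp only: integral_mult_right_zero moment_def mult_ac)
    finally show ?thesis .
  qed
  then show "(\<lambda>m. moment \<Phi> \<mu> m * taylor F m * z ^ m) sums hausdorff_op \<Phi> \<mu> F z"
    using conv by (simp add: sums_def)
qed

end
end

context polynomial_de_branges begin

text \<open>
  Monomials are eigenvectors with eigenvalues \<open>\<lambda>\<^sub>n\<close>, and eigenvalues are bounded by the norm. The
  moments exist because the operator is defined at \<open>z = 1\<close>.
\<close>

lemma hausdorff_bounded_imp_moments:
  assumes bounded: "hausdorff_bounded E \<Phi> \<mu>"
  shows "moment_exists \<Phi> \<mu> n" "bdd_above (range (\<lambda>n. cmod (moment \<Phi> \<mu> n)))"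
proof -
  have mono: "(\<lambda>z. z ^ n) \<in> de_branges E" for n
    using poly_mem[of "monom 1 n"] by (simp add: poly_monom[abs_def])
  show "moment_exists \<Phi> \<mu> n"
  proof -
    have "integrable (completion \<mu>) (\<lambda>u. \<Phi> u * (1 / of_real u) ^ n)"
      using bounded mono[of n] by (auto simp: hausdorff_bounded_def hausdorff_defined_def)
    then show ?thesis by (simp add: moment_exists_def power_one_over)
  qed
  \<comment> \<open>the right-hand side has the shape required by \<open>energy_diff_cmult\<close>\<close>
  have eig: "hausdorff_op \<Phi> \<mu> (\<lambda>z. z ^ n) = (\<lambda>z. 0 - (- moment \<Phi> \<mu> n) * z ^ n)" for n
  proof
    fix z
    have "hausdorff_op \<Phi> \<mu> (\<lambda>z. z ^ n) z = (LINT u|completion \<mu>. z ^ n * (\<Phi> u / of_real u ^ n))"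
      unfolding hausdorff_op_def by (intro Bochner_Integration.integral_cong) (auto simp: power_divide)
    then show "hausdorff_op \<Phi> \<mu> (\<lambda>z. z ^ n) z = 0 - (- moment \<Phi> \<mu> n) * z ^ n"
      by (simp only: integral_mult_right_zero moment_def) simp
  qed
  have "\<exists>C. \<forall>F\<in>de_branges E. db_norm E (hausdorff_op \<Phi> \<mu> F) \<le> C * db_norm E F"
    using bounded by (simp add: hausdorff_bounded_def db_bounded_operator_def)
  then obtain C where C: "\<And>F. F \<in> de_branges E \<Longrightarrow> db_norm E (hausdorff_op \<Phi> \<mu> F) \<le> C * db_norm E F"
    by blast
  have "cmod (moment \<Phi> \<mu> n) \<le> C" for n
  proof -
    have "energy E (\<lambda>z. z ^ n) \<noteq> 0" using energy_eq_0D[OF mono[of n], of 1] by auto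
    then have pos: "db_norm E (\<lambda>z. z ^ n) > 0"
      using energy_nonneg[of E "\<lambda>z. z ^ n"] by (simp add: db_norm_eq_sqrt_energy less_le)
    have "db_inner E (\<lambda>z. 0) (\<lambda>z. z ^ n) = 0" by (simp add: db_inner_def)
    then have "energy E (hausdorff_op \<Phi> \<mu> (\<lambda>z. z ^ n)) = (cmod (moment \<Phi> \<mu> n))^2 * energy E (\<lambda>z. z ^ n)"
      unfolding eig energy_diff_cmult[OF zero_mem mono] by simp
    then have "db_norm E (hausdorff_op \<Phi> \<mu> (\<lambda>z. z ^ n)) = cmod (moment \<Phi> \<mu> n) * db_norm E (\<lambda>z. z ^ n)"
      by (simp add: db_norm_eq_sqrt_energy real_sqrt_mult)
    then show ?thesis using C[OF mono[of n]] pos by simp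
  qed
  then show "bdd_above (range (\<lambda>n. cmod (moment \<Phi> \<mu> n)))" by (intro bdd_aboveI[of _ C]) auto
qed

end

context regular_lacunary_basis begin

text \<open>
  In the weighted norm on Taylor coefficients the estimate is trivial. It is applied to the
  partial sums, which are polynomials, and the limit is taken pointwise.
\<close>

lemma coefficient_multiplier_bounded:
  assumes F: "F \<in> de_branges E" and l: "\<And>m. cmod (l m) \<le> \<Lambda>"
    and G: "\<And>z. (\<lambda>m. l m * taylor F m * z ^ m) sums G z"
  shows "G \<in> de_branges E" "energy E G \<le> D_up * (2 * D_low) * \<Lambda>^2 * energy E F"
proof -
  have \<Lambda>: "\<Lambda> \<ge> 0" using order_trans[OF norm_ge_zero l[of 0]] .
  have D: "0 \<le> D_up" "0 \<le> D_low" by (simp_all add: D_up_def D_low_def)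
  have entG: "entire G"
  proof -
    have "G holomorphic_on ball 0 x" for x
      using G by (intro power_series_holomorphic[where a = "\<lambda>m. l m * taylor F m"]) simp
    then have "G field_differentiable at z" for z
      using holomorphic_on_imp_differentiable_at[of G "ball 0 (cmod z + 1)" z] by simp
    then show ?thesis by (auto simp: entire_def holomorphic_on_def field_differentiable_at_within)
  qed
  define P where "P N z = (\<Sum>m<N. (l m * taylor F m) * z ^ m)" for N z
  have Pmem: "P N \<in> de_branges E" for N
  proof -
    have "P N = poly (\<Sum>m<N. monom (l m * taylor F m) m)" by (auto simp: P_def poly_sum poly_monom)
    then show ?thesis using poly_mem by simp
  qed
  have Pbd: "energy E (P N) \<le> D_up * (2 * D_low) * \<Lambda>^2 * energy E F" for N
  proof -
    have "energy E (P N) \<le> D_up * (\<Sum>m<N. (w m)^2 * (cmod (l m * taylor F m))^2)"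
      using energy_poly_le[of "\<lambda>m. l m * taylor F m" N] by (simp add: P_def[abs_def])
    also have "\<dots> \<le> D_up * (\<Sum>m<N. \<Lambda>^2 * ((w m)^2 * (cmod (taylor F m))^2))"
    proof (intro mult_left_mono sum_mono D)
      fix m
      have "(cmod (l m))^2 \<le> \<Lambda>^2" using l by (intro power_mono) auto
      then have "(cmod (l m))^2 * ((w m)^2 * (cmod (taylor F m))^2) \<le> \<Lambda>^2 * ((w m)^2 * (cmod (taylor F m))^2)"
        by (intro mult_right_mono) auto
      then show "(w m)^2 * (cmod (l m * taylor F m))^2 \<le> \<Lambda>^2 * ((w m)^2 * (cmod (taylor F m))^2)"
        by (simp add: norm_mult power_mult_distrib mult_ac)
    qed
    also have "\<dots> \<le> D_up * (\<Lambda>^2 * (2 * D_low * energy E F))"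
      unfolding sum_distrib_left[symmetric] using taylor_energy_le[OF F, of N] D by (intro mult_left_mono) auto
    finally show ?thesis by (simp add: mult_ac)
  qed
  have lim: "(\<lambda>N. P N z) \<longlonglongrightarrow> G z" for z
    using G[of z] by (simp add: P_def sums_def)
  show "G \<in> de_branges E" "energy E G \<le> D_up * (2 * D_low) * \<Lambda>^2 * energy E F"
    using de_branges_closed_pointwise[OF Pmem Pbd lim entG] by auto
qed

definition D_op where "D_op = sqrt (D_up * (2 * D_low))"

theorem hausdorff_bounded_iff_moments:
  assumes "hausdorff_kernel \<mu> \<Phi> \<delta>"
  shows "hausdorff_bounded E \<Phi> \<mu> \<longleftrightarrow>
      (\<forall>n. moment_exists \<Phi> \<mu> n) \<and> bdd_above (range (\<lambda>n. cmod (moment \<Phi> \<mu> n)))" (is "?L \<longleftrightarrow> ?R")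
    and "hausdorff_bounded E \<Phi> \<mu> \<Longrightarrow>
      db_opnorm E (hausdorff_op \<Phi> \<mu>) \<le> D_op * (SUP n. cmod (moment \<Phi> \<mu> n))"
proof -
  interpret hausdorff_kernel \<mu> \<Phi> \<delta> by fact
  define \<Lambda> where "\<Lambda> = (SUP n. cmod (moment \<Phi> \<mu> n))"
  have D: "0 \<le> D_up" "0 \<le> D_low" by (simp_all add: D_up_def D_low_def)
  have main: "integrable (completion \<mu>) (\<lambda>u. \<Phi> u * F (z / of_real u))"
      "hausdorff_op \<Phi> \<mu> F \<in> de_branges E"
      "db_norm E (hausdorff_op \<Phi> \<mu> F) \<le> D_op * \<Lambda> * db_norm E F"
    if R: ?R and F: "F \<in> de_branges E" for F z
  proof -
    have "moment_exists \<Phi> \<mu> 0" using R by blast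
    then have int: "integrable (completion \<mu>) \<Phi>" by (simp add: moment_exists_def)
    have l: "cmod (moment \<Phi> \<mu> m) \<le> \<Lambda>" for m
      unfolding \<Lambda>_def using R by (intro cSUP_upper) auto
    have \<Lambda>: "\<Lambda> \<ge> 0" using order_trans[OF norm_ge_zero l[of 0]] .
    note sums = hausdorff_op_sums[OF int de_branges_entire[OF F]]
    show "integrable (completion \<mu>) (\<lambda>u. \<Phi> u * F (z / of_real u))" by (rule sums(1))
    show "hausdorff_op \<Phi> \<mu> F \<in> de_branges E"
      by (rule coefficient_multiplier_bounded(1)[OF F l sums(2)])
    have "sqrt (energy E (hausdorff_op \<Phi> \<mu> F)) \<le> sqrt (D_up * (2 * D_low) * \<Lambda>^2 * energy E F)"
      by (intro real_sqrt_le_mono coefficient_multiplier_bounded(2)[OF F l sums(2)])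
    also have "\<dots> = D_op * \<Lambda> * sqrt (energy E F)"
      unfolding D_op_def real_sqrt_mult[of "D_up * (2 * D_low) * \<Lambda>^2"] real_sqrt_mult[of "D_up * (2 * D_low)"]
      using \<Lambda> by simp
    finally show "db_norm E (hausdorff_op \<Phi> \<mu> F) \<le> D_op * \<Lambda> * db_norm E F"
      by (simp add: db_norm_eq_sqrt_energy)
  qed
  have suff: ?L if R: ?R
    unfolding hausdorff_bounded_def hausdorff_defined_def db_bounded_operator_def
  proof (intro conjI ballI allI)
    fix F G and c z assume F: "F \<in> de_branges E" and G: "G \<in> de_branges E"
    show "integrable (completion \<mu>) (\<lambda>u. \<Phi> u * F (z / of_real u))" by (rule main(1)[OF R F])
    show "hausdorff_op \<Phi> \<mu> F \<in> de_branges E" by (rule main(2)[OF R F])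
    show "hausdorff_op \<Phi> \<mu> (\<lambda>z. F z + G z) = (\<lambda>z. hausdorff_op \<Phi> \<mu> F z + hausdorff_op \<Phi> \<mu> G z)"
      unfolding hausdorff_op_def distrib_left
      by (intro ext Bochner_Integration.integral_add main(1)[OF R] F G)
    show "hausdorff_op \<Phi> \<mu> (\<lambda>z. c * F z) = (\<lambda>z. c * hausdorff_op \<Phi> \<mu> F z)"
      unfolding hausdorff_op_def mult.left_commute[of _ c] by (simp only: integral_mult_right_zero)
  next
    show "\<exists>C. \<forall>F\<in>de_branges E. db_norm E (hausdorff_op \<Phi> \<mu> F) \<le> C * db_norm E F"
      using main(3)[OF R] by blast
  qed
  show iff: "?L \<longleftrightarrow> ?R"
  proof
    assume ?L then show ?R using hausdorff_bounded_imp_moments[of \<Phi> \<mu>] by simp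
  qed (rule suff)
  show "db_opnorm E (hausdorff_op \<Phi> \<mu>) \<le> D_op * (SUP n. cmod (moment \<Phi> \<mu> n))" if ?L
  proof -
    have R: ?R by (rule iffD1[OF iff that])
    have "cmod (moment \<Phi> \<mu> 0) \<le> \<Lambda>" unfolding \<Lambda>_def using R by (intro cSUP_upper) auto
    then have "\<Lambda> \<ge> 0" using norm_ge_zero order_trans by blast
    then have K: "0 \<le> D_op * \<Lambda>" using D by (simp add: D_op_def)
    have "db_opnorm E (hausdorff_op \<Phi> \<mu>) \<le> D_op * \<Lambda>"
      unfolding db_opnorm_def
    proof (rule cSUP_least)
      show "{F \<in> de_branges E. db_norm E F \<le> 1} \<noteq> {}"
      proof -
        have "(\<lambda>z. 0) \<in> {F \<in> de_branges E. db_norm E F \<le> 1}"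
          using zero_mem by (simp add: db_norm_eq_sqrt_energy)
        then show ?thesis by blast
      qed
      fix F assume "F \<in> {F \<in> de_branges E. db_norm E F \<le> 1}"
      then have F: "F \<in> de_branges E" "db_norm E F \<le> 1" by auto
      have "db_norm E (hausdorff_op \<Phi> \<mu> F) \<le> D_op * \<Lambda> * db_norm E F"
        by (rule main(3)[OF R F(1)])
      also have "\<dots> \<le> D_op * \<Lambda>" using F(2) K by (rule mult_left_le)
      finally show "db_norm E (hausdorff_op \<Phi> \<mu> F) \<le> D_op * \<Lambda>" .
    qed
    then show ?thesis by (simp add: \<Lambda>_def)
  qed
qed

end

section \<open>Sorting the spectral data\<close>

text \<open>
  Minimal remaining elements are chosen one after another; an element never chosen would have
  infinitely many others below it.
\<close>

lemma sorted_enumeration: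
  fixes f :: "'a \<Rightarrow> real"
  assumes inf: "infinite I" and fin: "\<And>B. finite {i \<in> I. f i \<le> B}"
  obtains e :: "nat \<Rightarrow> 'a" where "bij_betw e UNIV I" "\<And>m n. m \<le> n \<Longrightarrow> f (e m) \<le> f (e n)"
proof -
  define pick where "pick X = (SOME i. i \<in> X \<and> (\<forall>j\<in>X. f i \<le> f j))" for X
  have pick: "pick X \<in> X \<and> (\<forall>j\<in>X. f (pick X) \<le> f j)" if X: "X \<subseteq> I" "X \<noteq> {}" for X
  proof -
    obtain x where x: "x \<in> X" using X by blast
    let ?S = "{i \<in> X. f i \<le> f x}"
    have S: "finite ?S" "?S \<noteq> {}" using finite_subset[OF _ fin[of "f x"], of ?S] X x by auto
    from arg_min_if_finite[OF S, of f] have "arg_min_on f ?S \<in> X" "\<forall>j\<in>X. f (arg_min_on f ?S) \<le> f j"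
      by (auto simp: not_less) (meson le_cases order_trans)
    then have "\<exists>i. i \<in> X \<and> (\<forall>j\<in>X. f i \<le> f j)" by blast
    then show ?thesis unfolding pick_def by (rule someI_ex)
  qed
  define S where "S = rec_nat {} (\<lambda>_ T. insert (pick (I - T)) T)"
  define e where "e n = pick (I - S n)" for n
  have S0: "S 0 = {}" and SSuc: "\<And>n. S (Suc n) = insert (e n) (S n)" by (simp_all add: S_def e_def)
  have finS: "finite (S n)" for n by (induction n) (auto simp: S0 SSuc)
  have ne: "I - S n \<noteq> {}" for n using Diff_infinite_finite[OF finS inf] by (metis finite.emptyI)
  have e: "e n \<in> I" "e n \<notin> S n" "\<And>j. j \<in> I \<Longrightarrow> j \<notin> S n \<Longrightarrow> f (e n) \<le> f j" for n
    using pick[of "I - S n"] ne[of n] by (auto simp: e_def)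
  have S_mono: "S m \<subseteq> S n" if "m \<le> n" for m n using that
    by (induction n rule: dec_induct) (auto simp: SSuc)
  have mem: "e m \<in> S n" if "m < n" for m n
    using S_mono[of "Suc m" n] that by (auto simp: SSuc)
  have S_range: "S n \<subseteq> range e" for n by (induction n) (auto simp: S0 SSuc)
  have inj: "inj e"
  proof (rule injI)
    fix m n assume "e m = e n"
    then show "m = n" using mem[of m n] mem[of n m] e(2)[of n] e(2)[of m] by (cases m n rule: linorder_cases) auto
  qed
  have mono: "f (e m) \<le> f (e n)" if "m \<le> n" for m n
    using e(3)[of "e n" m] e(1)[of n] e(2)[of n] S_mono[OF that] by blast
  have "range e = I"
  proof (rule ccontr)
    assume "range e \<noteq> I"
    then obtain i where i: "i \<in> I" "i \<notin> range e" using e(1) by blast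
    then have "range e \<subseteq> {j \<in> I. f j \<le> f i}" using S_range e(1,3) by blast
    then have "finite (range e)" using fin finite_subset by blast
    then show False using inj by (simp add: finite_image_iff)
  qed
  then show ?thesis using that[of e] inj mono by (simp add: bij_betw_def)
qed

lemma finite_sublevel_of_no_limit_point:
  fixes t :: "'a \<Rightarrow> real"
  assumes "inj_on t I" "\<And>x. \<not> x islimpt t ` I"
  shows "finite {i \<in> I. \<bar>t i\<bar> \<le> B}"
proof (rule ccontr)
  assume "infinite {i \<in> I. \<bar>t i\<bar> \<le> B}"
  moreover have "inj_on t {i \<in> I. \<bar>t i\<bar> \<le> B}" using assms(1) by (rule inj_on_subset) auto
  ultimately have "infinite (t ` {i \<in> I. \<bar>t i\<bar> \<le> B})" by (simp add: finite_image_iff)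
  then have "\<exists>x\<in>{-B..B}. x islimpt t ` {i \<in> I. \<bar>t i\<bar> \<le> B}"
    by (intro Heine_Borel_imp_Bolzano_Weierstrass) auto
  then obtain x where "x islimpt t ` {i \<in> I. \<bar>t i\<bar> \<le> B}" by blast
  then have "x islimpt t ` I" by (rule islimpt_subset) auto
  then show False using assms(2) by blast
qed

text \<open>
  Lacunarity concerns neighbours on the line, so it separates only points on the same side of the
  origin.
\<close>

lemma lacunary_ratio:
  fixes t :: "int \<Rightarrow> real"
  assumes cons: "consecutive I" and mono: "strict_mono_on I t"
    and \<kappa>: "\<kappa> > 0" "\<And>n. n \<in> I \<Longrightarrow> n + 1 \<in> I \<Longrightarrow> \<kappa> * \<bar>t n\<bar> \<le> t (n + 1) - t n"
    and ij: "i \<in> I" "j \<in> I" "i \<noteq> j" and sign: "0 \<le> t i * t j" and le: "\<bar>t i\<bar> \<le> \<bar>t j\<bar>"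
  shows "(1 + \<kappa>) * \<bar>t i\<bar> \<le> \<bar>t j\<bar>"
proof -
  have gap: "\<kappa> * \<bar>t a\<bar> \<le> t b - t a" "t a < t b" if "a \<in> I" "b \<in> I" "a < b" for a b
  proof -
    have a1: "a + 1 \<in> I" using cons that unfolding consecutive_def by fastforce
    have "t (a + 1) \<le> t b"
    proof (cases "a + 1 = b")
      case False
      then have "a + 1 < b" using that(3) by linarith
      then show ?thesis using strict_mono_onD[OF mono a1 that(2)] by simp
    qed simp
    then show "\<kappa> * \<bar>t a\<bar> \<le> t b - t a" using \<kappa>(2)[OF that(1) a1] by linarith
    show "t a < t b" using strict_mono_onD[OF mono that] .
  qed
  consider "i < j" | "j < i" using ij(3) by linarith
  then show ?thesis
  proof cases
    case 1
    note g = gap[OF ij(1,2) 1]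
    have "0 \<le> t i"
    proof (rule ccontr)
      assume "\<not> 0 \<le> t i"
      then have "t j \<le> 0" using sign by (simp add: zero_le_mult_iff)
      then show False using g(2) le by simp
    qed
    then show ?thesis using g by (simp add: algebra_simps)
  next
    case 2
    note g = gap[OF ij(2,1) 2]
    have "t i \<le> 0"
    proof (rule ccontr)
      assume "\<not> t i \<le> 0"
      then have "0 \<le> t j" using sign by (simp add: zero_le_mult_iff)
      then show False using g(2) le by simp
    qed
    then have neg: "\<bar>t i\<bar> = - t i" "\<bar>t j\<bar> = - t j" using g(2) by auto
    then have "\<bar>t i\<bar> \<le> (1 - \<kappa>) * \<bar>t j\<bar>" using g(1) by (simp add: algebra_simps)
    then have "(1 + \<kappa>) * \<bar>t i\<bar> \<le> (1 + \<kappa>) * ((1 - \<kappa>) * \<bar>t j\<bar>)" using \<kappa>(1) by (intro mult_left_mono) auto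
    also have "\<dots> = \<bar>t j\<bar> - \<kappa>^2 * \<bar>t j\<bar>" by (simp add: algebra_simps power2_eq_square)
    also have "\<dots> \<le> \<bar>t j\<bar>" by simp
    finally show ?thesis .
  qed
qed

lemma orthonormal_basis_reindex:
  assumes basis: "db_orthonormal_basis E I g" and bij: "bij_betw e UNIV I"
  shows "db_orthonormal_basis E UNIV (\<lambda>n. g (e n))"
  unfolding db_orthonormal_basis_def
proof (intro conjI ballI allI impI)
  have inj: "inj e" and rng: "range e = I" using bij by (auto simp: bij_betw_def)
  note b = basis[unfolded db_orthonormal_basis_def]
  show "g (e n) \<in> de_branges E" for n using b rng by blast
  show "db_inner E (g (e m)) (g (e n)) = (if m = n then 1 else 0)" for m n
    using b rng inj_eq[OF inj, of m n] by auto
  fix F and \<epsilon> :: real assume F: "F \<in> de_branges E" and \<epsilon>: "0 < \<epsilon>"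
  from b[THEN conjunct2, THEN conjunct2, rule_format, OF F \<epsilon>]
  obtain J a where J: "finite J" "J \<subseteq> I" "db_norm E (\<lambda>z. F z - (\<Sum>n\<in>J. a n * g n z)) < \<epsilon>"
    by (elim exE conjE)
  have im: "e ` (e -` J) = J" using J(2) rng by (simp add: image_vimage_eq Int_absorb2)
  have "(\<Sum>n\<in>J. a n * g n z) = (\<Sum>n\<in>e -` J. a (e n) * g (e n) z)" for z
    using sum.reindex[of e "e -` J" "\<lambda>n. a n * g n z"] inj_on_subset[OF inj subset_UNIV]
    unfolding im by (simp add: o_def)
  then have "db_norm E (\<lambda>z. F z - (\<Sum>n\<in>e -` J. a (e n) * g (e n) z)) < \<epsilon>" using J(3) by simp
  moreover have "finite (e -` J)" using J(1) inj by (rule finite_vimageI)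
  ultimately show "\<exists>J a. finite J \<and> J \<subseteq> UNIV \<and> db_norm E (\<lambda>z. F z - (\<Sum>n\<in>J. a n * g (e n) z)) < \<epsilon>"
    by (intro exI[of _ "e -` J"] exI[of _ "\<lambda>n. a (e n)"]) simp
qed

context polynomial_de_branges begin

text \<open>
  Of three consecutive points in the order of modulus, two lie on the same side of the origin, so
  two steps increase the modulus by a fixed factor. The only obstacle to taking \<open>r n\<close> to be the
  modulus of \<open>s n\<close> is a node at the origin; there \<open>r 0\<close> is half the next modulus, at the cost of
  a larger constant in the tail condition.
\<close>

theorem regular_lacunary_basis_exists:
  fixes I :: "int set" and t \<nu> :: "int \<Rightarrow> real"
  assumes spectral: "spectral_data E I t \<nu>" and regular: "regular_data I t \<nu>" and lac: "lacunary I t"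
  shows "\<exists>A s \<nu>' r q \<kappa> c. regular_lacunary_basis E A s \<nu>' r q \<kappa> c"
proof -
  have cons: "consecutive I" and mono: "strict_mono_on I t" and nolim: "\<And>x. \<not> x islimpt t ` I"
    and \<nu>pos: "\<And>n. n \<in> I \<Longrightarrow> \<nu> n > 0" and \<nu>sum: "(\<lambda>n. \<nu> n / (1 + (t n)^2)) summable_on I"
    using spectral by (auto simp: spectral_data_def)
  obtain A where A: "entire A" "{z. A z = 0} = (\<lambda>n. of_real (t n)) ` I"
      "\<And>n. n \<in> I \<Longrightarrow> deriv A (of_real (t n)) \<noteq> 0"
      "db_orthonormal_basis E I (\<lambda>n. spectral_function A (t n) (\<nu> n))"
    using spectral by (auto simp: spectral_data_def)
  obtain \<kappa>0 where \<kappa>0: "\<kappa>0 > 0" "\<And>n. n \<in> I \<Longrightarrow> n + 1 \<in> I \<Longrightarrow> \<kappa>0 * \<bar>t n\<bar> \<le> t (n + 1) - t n"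
    using lac by (auto simp: lacunary_def)
  obtain c0 where c0: "c0 > 0" "\<And>n. n \<in> I \<Longrightarrow>
        (\<Sum>\<^sub>\<infinity>k\<in>{k\<in>I. \<bar>t k\<bar> \<le> \<bar>t n\<bar>}. \<nu> k) +
        (t n)^2 * (\<Sum>\<^sub>\<infinity>k\<in>{k\<in>I. \<bar>t k\<bar> > \<bar>t n\<bar>}. \<nu> k / (t k)^2) \<le> c0 * \<nu> n"
    using regular by (auto simp: regular_data_def)
  have injt: "inj_on t I" using mono by (rule strict_mono_on_imp_inj_on)
  interpret raw: spectral_basis E I t \<nu> A
    by unfold_locales (use A injt \<nu>pos in auto)
  note fin = finite_sublevel_of_no_limit_point[OF injt nolim]
  obtain e :: "nat \<Rightarrow> int" where e: "bij_betw e UNIV I" "\<And>m n. m \<le> n \<Longrightarrow> \<bar>t (e m)\<bar> \<le> \<bar>t (e n)\<bar>"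
    by (rule sorted_enumeration[OF raw.infinite_index fin]) blast
  have inje: "inj e" and rng: "range e = I" using e(1) by (auto simp: bij_betw_def)
  then have eI: "e n \<in> I" for n by blast
  define s where "s n = t (e n)" for n
  define \<nu>' where "\<nu>' n = \<nu> (e n)" for n
  have s_mono: "m \<le> n \<Longrightarrow> \<bar>s m\<bar> \<le> \<bar>s n\<bar>" for m n using e(2) by (simp add: s_def)
  have s_inj: "s m = s n \<longleftrightarrow> m = n" for m n
    using injt inje eI by (auto simp: s_def inj_on_eq_iff inj_eq)
  have \<nu>'pos: "\<nu>' n > 0" for n using \<nu>pos eI by (simp add: \<nu>'_def)
  define Q where "Q = 1 + \<kappa>0"
  have Q: "Q > 1" using \<kappa>0 by (simp add: Q_def)
  have ratio: "Q * \<bar>s m\<bar> \<le> \<bar>s n\<bar>" if "m < n" "0 \<le> s m * s n" for m n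
    using lacunary_ratio[OF cons mono \<kappa>0 eI eI, of m n] that s_mono[of m n] inj_eq[OF inje, of m n]
    by (simp add: s_def Q_def)
  have growth: "Q * \<bar>s n\<bar> \<le> \<bar>s (n + 2)\<bar>" for n
  proof -
    \<comment> \<open>two of three points lie on the same side of the origin\<close>
    consider "0 \<le> s n * s (n + 1)" | "0 \<le> s n * s (n + 2)" | "0 \<le> s (n + 1) * s (n + 2)"
      by (metis linorder_le_cases zero_le_mult_iff)
    then show ?thesis
    proof cases
      case 1
      then show ?thesis using ratio[of n "n + 1"] s_mono[of "n + 1" "n + 2"] by simp
    next
      case 2
      then show ?thesis using ratio[of n "n + 2"] by simp
    next
      case 3
      have "Q * \<bar>s n\<bar> \<le> Q * \<bar>s (n + 1)\<bar>" using s_mono[of n "n + 1"] Q by (intro mult_left_mono) auto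
      then show ?thesis using ratio[of "n + 1" "n + 2"] 3 by simp
    qed
  qed
  have s_nz: "s n \<noteq> 0" if "n > 0" for n
  proof
    assume "s n = 0"
    then have "s 0 = s n" using s_mono[of 0 n] by simp
    then show False using s_inj[of 0 n] that by simp
  qed
  define r where "r n = (if n = 0 \<and> s 0 = 0 then \<bar>s 1\<bar> / 2 else \<bar>s n\<bar>)" for n
  define q where "q = min Q 2"
  define \<kappa> where "\<kappa> = 1 - 1 / Q"
  have \<kappa>: "0 < \<kappa>" "\<kappa> \<le> 1" using Q by (auto simp: \<kappa>_def)
  have r_eq: "r n = \<bar>s n\<bar>" if "s n \<noteq> 0" for n using that by (auto simp: r_def)
  have r_pos: "0 < r n" for n using s_nz[of n] s_nz[of 1] by (cases "n = 0") (auto simp: r_def)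
  have s_le: "\<bar>s n\<bar> \<le> r n" for n by (simp add: r_def)
  have sep: "\<kappa> * max \<bar>s m\<bar> \<bar>s n\<bar> \<le> \<bar>s m - s n\<bar>" if mn: "m < n" for m n
  proof (cases "0 \<le> s m * s n")
    case True
    have "\<bar>s m\<bar> \<le> \<bar>s n\<bar> / Q" using ratio[OF mn True] Q by (simp add: pos_le_divide_eq mult.commute)
    then have "\<kappa> * \<bar>s n\<bar> \<le> \<bar>s n\<bar> - \<bar>s m\<bar>" by (simp add: \<kappa>_def left_diff_distrib)
    then show ?thesis using s_mono[of m n] mn by simp
  next
    case False
    then have "\<bar>s m - s n\<bar> = \<bar>s m\<bar> + \<bar>s n\<bar>" by (auto simp: zero_le_mult_iff not_le abs_if)
    moreover have "\<kappa> * max \<bar>s m\<bar> \<bar>s n\<bar> \<le> 1 * max \<bar>s m\<bar> \<bar>s n\<bar>" using \<kappa> by (intro mult_right_mono) auto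
    ultimately show ?thesis by linarith
  qed
  have r_mono: "r m \<le> r n" if "m \<le> n" for m n
    using s_mono[OF that] s_mono[of 1 n] that by (cases "m = 0"; cases "n = 0") (auto simp: r_def)
  have sep_r: "\<kappa> * max (r n) (r k) \<le> \<bar>s n - s k\<bar>" if nk: "n \<noteq> k" for n k
  proof -
    have *: "\<kappa> * max (r m) (r n) \<le> \<bar>s m - s n\<bar>" if "m < n" for m n
    proof -
      have "max (r m) (r n) = max \<bar>s m\<bar> \<bar>s n\<bar>"
        using that r_mono[of m n] s_mono[of m n] r_eq[of n] s_nz[of n] by simp
      then show ?thesis using sep[OF that] by simp
    qed
    show ?thesis using *[of n k] *[of k n] nk by (cases "n < k") (auto simp: max.commute abs_minus_commute)
  qed
  have q: "1 < q" "q \<le> Q" "q \<le> 2" using Q by (auto simp: q_def)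
  have growth_r: "q * r n \<le> r (n + 2)" for n
  proof (cases "s n = 0")
    case True
    then have n: "n = 0" using s_nz[of n] by blast
    have "q * r 0 \<le> 2 * r 0" using q r_pos[of 0] by (intro mult_right_mono) auto
    also have "\<dots> = \<bar>s 1\<bar>" using True n by (simp add: r_def)
    also have "\<dots> \<le> \<bar>s 2\<bar>" by (rule s_mono) simp
    also have "\<dots> = r 2" using r_eq[OF s_nz[of 2]] by simp
    finally show ?thesis using n by (simp add: numeral_2_eq_2)
  next
    case False
    have "q * \<bar>s n\<bar> \<le> Q * \<bar>s n\<bar>" using q by (intro mult_right_mono) auto
    then show ?thesis using growth[of n] r_eq[OF False] r_eq[OF s_nz[of "n + 2"]] by simp
  qed
  \<comment> \<open>the two halves of the regularity condition, for finite sums over the sorted points\<close>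
  have reg_finite: "(\<Sum>k\<in>K. \<nu>' k) + (s n)^2 * (\<Sum>k\<in>K'. \<nu>' k / (s k)^2) \<le> c0 * \<nu>' n"
    if K: "finite K" "\<And>k. k \<in> K \<Longrightarrow> \<bar>s k\<bar> \<le> \<bar>s n\<bar>"
      and K': "finite K'" "\<And>k. k \<in> K' \<Longrightarrow> \<bar>s n\<bar> < \<bar>s k\<bar>" "s n \<noteq> 0 \<or> K' = {}" for K K' n
  proof -
    let ?lo = "{k\<in>I. \<bar>t k\<bar> \<le> \<bar>t (e n)\<bar>}" and ?hi = "{k\<in>I. \<bar>t k\<bar> > \<bar>t (e n)\<bar>}"
    have "(\<Sum>k\<in>K. \<nu>' k) = (\<Sum>k\<in>e ` K. \<nu> k)"
      using inje by (simp add: sum.reindex inj_on_subset \<nu>'_def)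
    also have "\<dots> \<le> (\<Sum>k\<in>?lo. \<nu> k)"
      using K eI \<nu>pos by (intro sum_mono2 fin) (auto simp: s_def less_imp_le)
    also have "\<dots> = (\<Sum>\<^sub>\<infinity>k\<in>?lo. \<nu> k)" using fin by simp
    finally have lo: "(\<Sum>k\<in>K. \<nu>' k) \<le> (\<Sum>\<^sub>\<infinity>k\<in>?lo. \<nu> k)" .
    have hi: "(s n)^2 * (\<Sum>k\<in>K'. \<nu>' k / (s k)^2) \<le> (t (e n))^2 * (\<Sum>\<^sub>\<infinity>k\<in>?hi. \<nu> k / (t k)^2)"
    proof (cases "s n = 0")
      case True
      then show ?thesis by (simp add: s_def)
    next
      case False
      have pos: "(s n)^2 > 0" using False by simp
      \<comment> \<open>away from the origin \<open>1 / t\<^sup>2\<close> and \<open>1 / (1 + t\<^sup>2)\<close> are comparable\<close>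
      have "(\<lambda>k. (1 + 1 / (s n)^2) * (\<nu> k / (1 + (t k)^2))) summable_on ?hi"
        using summable_on_subset_banach[OF \<nu>sum, of ?hi] by (intro summable_on_cmult_right) auto
      then have summ: "(\<lambda>k. \<nu> k / (t k)^2) summable_on ?hi"
      proof (rule summable_on_comparison_test)
        fix k assume k: "k \<in> ?hi"
        have t2: "(s n)^2 \<le> (t k)^2" using k power_mono[of "\<bar>s n\<bar>" "\<bar>t k\<bar>" 2] by (simp add: s_def)
        then have tp: "(t k)^2 > 0" using pos by linarith
        have "1 + (t k)^2 \<le> (1 + 1 / (s n)^2) * (t k)^2"
          using t2 pos by (simp add: distrib_right pos_le_divide_eq)
        then have "\<nu> k * (1 + (t k)^2) \<le> \<nu> k * ((1 + 1 / (s n)^2) * (t k)^2)"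
          using k \<nu>pos[of k] by (intro mult_left_mono) auto
        then have "\<nu> k / (t k)^2 \<le> ((1 + 1 / (s n)^2) * \<nu> k) / (1 + (t k)^2)"
        proof (intro mult_imp_le_div_pos)
          show "0 < 1 + (t k)^2" by (simp add: add_pos_nonneg)
          have "\<nu> k * (1 + (t k)^2) / (t k)^2 \<le> (1 + 1 / (s n)^2) * \<nu> k"
            using \<open>\<nu> k * (1 + (t k)^2) \<le> _\<close> tp by (simp only: pos_divide_le_eq mult_ac)
          then show "\<nu> k / (t k)^2 * (1 + (t k)^2) \<le> (1 + 1 / (s n)^2) * \<nu> k" by simp
        qed
        then show "\<nu> k / (t k)^2 \<le> (1 + 1 / (s n)^2) * (\<nu> k / (1 + (t k)^2))" by simp
        show "0 \<le> \<nu> k / (t k)^2" using k \<nu>pos[of k] by simp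
      qed
      have "(\<Sum>k\<in>K'. \<nu>' k / (s k)^2) = (\<Sum>k\<in>e ` K'. \<nu> k / (t k)^2)"
        using inje by (simp add: sum.reindex inj_on_subset \<nu>'_def s_def)
      also have "\<dots> \<le> (\<Sum>\<^sub>\<infinity>k\<in>?hi. \<nu> k / (t k)^2)"
        using K' eI \<nu>pos by (intro finite_sum_le_infsum summ) (auto simp: s_def less_imp_le)
      finally show ?thesis by (simp add: s_def mult_left_mono)
    qed
    show ?thesis using lo hi c0(2)[OF eI[of n]] by (simp add: \<nu>'_def)
  qed
  \<comment> \<open>pays for the tail condition at a node in the origin\<close>
  define x where "x = c0 * \<nu>' 1 / \<nu>' 0"
  have extra: "0 \<le> x" unfolding x_def using c0(1) \<nu>'pos[of 0] \<nu>'pos[of 1] by simp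
  define c where "c = 2 + c0 + x"
  have c: "1 < c" "c0 \<le> c" using c0(1) extra by (auto simp: c_def)
  have head: "(\<Sum>k\<le>n. \<nu>' k) \<le> c * \<nu>' n" for n
  proof -
    have "(\<Sum>k\<le>n. \<nu>' k) \<le> c0 * \<nu>' n" using reg_finite[of "{..n}" n "{}"] s_mono by simp
    also have "\<dots> \<le> c * \<nu>' n" using c \<nu>'pos[of n] by (intro mult_right_mono) auto
    finally show ?thesis .
  qed
  have tail0: "(\<Sum>k=n..M. \<nu>' k / (r k)^2) \<le> c0 * (\<nu>' n / (r n)^2)" if sn: "s n \<noteq> 0" for n M
  proof -
    let ?K = "{k\<in>{n..M}. \<bar>s k\<bar> \<le> \<bar>s n\<bar>}" and ?K' = "{k\<in>{n..M}. \<bar>s n\<bar> < \<bar>s k\<bar>}"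
    have pos: "(s n)^2 > 0" using sn by simp
    have rk: "r k = \<bar>s k\<bar>" if "n \<le> k" for k using r_eq[of k] s_mono[OF that] sn by auto
    have "(s n)^2 * (\<Sum>k=n..M. \<nu>' k / (r k)^2) = (s n)^2 * ((\<Sum>k\<in>?K. \<nu>' k / (s k)^2) + (\<Sum>k\<in>?K'. \<nu>' k / (s k)^2))"
      using rk by (subst sum.union_disjoint[symmetric]) (auto intro!: sum.cong)
    also have "(\<Sum>k\<in>?K. \<nu>' k / (s k)^2) = (\<Sum>k\<in>?K. \<nu>' k / (s n)^2)"
    proof (intro sum.cong refl)
      fix k assume "k \<in> ?K"
      then have "\<bar>s k\<bar> = \<bar>s n\<bar>" using s_mono[of n k] by auto
      then have "(s k)^2 = (s n)^2" using power2_abs by metis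
      then show "\<nu>' k / (s k)^2 = \<nu>' k / (s n)^2" by simp
    qed
    also have "(s n)^2 * ((\<Sum>k\<in>?K. \<nu>' k / (s n)^2) + (\<Sum>k\<in>?K'. \<nu>' k / (s k)^2))
        = (\<Sum>k\<in>?K. \<nu>' k) + (s n)^2 * (\<Sum>k\<in>?K'. \<nu>' k / (s k)^2)"
      using pos by (simp add: distrib_left flip: sum_divide_distrib)
    also have "\<dots> \<le> c0 * \<nu>' n" using sn by (intro reg_finite) auto
    finally show ?thesis using pos rk[of n] by (simp add: pos_le_divide_eq mult.commute)
  qed
  have tail: "(\<Sum>k=n..M. \<nu>' k / (r k)^2) \<le> c * (\<nu>' n / (r n)^2)" if nM: "n \<le> M" for n M
  proof (cases "s n = 0")
    case False
    have "0 \<le> \<nu>' n / (r n)^2" using \<nu>'pos[of n] by simp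
    then have "c0 * (\<nu>' n / (r n)^2) \<le> c * (\<nu>' n / (r n)^2)" using c by (intro mult_right_mono) auto
    then show ?thesis using tail0[OF False, of M] by linarith
  next
    case True
    then have n: "n = 0" using s_nz[of n] by blast
    have r1: "r 1 = 2 * r 0" "r 0 > 0" using True n r_pos[of 0] by (auto simp: r_def)
    have "(\<Sum>k=0..M. \<nu>' k / (r k)^2) = \<nu>' 0 / (r 0)^2 + (\<Sum>k=1..M. \<nu>' k / (r k)^2)"
      by (simp add: sum.atLeast_Suc_atMost)
    also have "(\<Sum>k=1..M. \<nu>' k / (r k)^2) \<le> c0 * (\<nu>' 1 / (r 1)^2)" using s_nz[of 1] by (intro tail0) simp
    also have "c0 * (\<nu>' 1 / (r 1)^2) = x / 4 * (\<nu>' 0 / (r 0)^2)"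
      unfolding x_def r1(1) power_mult_distrib using \<nu>'pos[of 0] by simp
    also have "\<nu>' 0 / (r 0)^2 + \<dots> = (1 + x / 4) * (\<nu>' 0 / (r 0)^2)"
      by (simp only: distrib_right mult_1)
    also have "\<dots> \<le> c * (\<nu>' 0 / (r 0)^2)"
    proof (rule mult_right_mono)
      show "1 + x / 4 \<le> c" using extra c0(1) unfolding c_def by linarith
      show "0 \<le> \<nu>' 0 / (r 0)^2" using \<nu>'pos[of 0] by simp
    qed
    finally show ?thesis using n by simp
  qed
  have "(\<lambda>n. \<nu>' n / (1 + (s n)^2)) summable_on UNIV"
    using \<nu>sum summable_on_reindex_bij_betw[OF e(1), of "\<lambda>n. \<nu> n / (1 + (t n)^2)"] by (simp add: s_def \<nu>'_def)
  then have "summable (\<lambda>n. \<nu>' n / (1 + (s n)^2))"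
    using \<nu>'pos by (subst (asm) summable_on_UNIV_nonneg_real_iff) (auto simp: less_imp_le add_nonneg_nonneg)
  moreover have "{z. A z = 0} = range (\<lambda>n. of_real (s n))"
    unfolding A(2) s_def rng[symmetric] by auto
  moreover have "db_orthonormal_basis E UNIV (\<lambda>n. spectral_function A (s n) (\<nu>' n))"
    using orthonormal_basis_reindex[OF A(4) e(1)] by (simp add: s_def \<nu>'_def)
  moreover have "inj s" using s_inj by (auto intro: injI)
  moreover have "deriv A (of_real (s n)) \<noteq> 0" for n using A(3) eI by (simp add: s_def)
  ultimately have "regular_lacunary_basis E A s \<nu>' r q \<kappa> c"
    using A(1) \<nu>'pos r_pos r_mono q(1) growth_r s_le r_eq s_nz \<kappa> sep_r c(1) head tail
    by unfold_locales auto
  then show ?thesis by blast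
qed

end

section \<open>Boundedness of Hausdorff operators\<close>

theorem theorem6:
  fixes E :: "complex \<Rightarrow> complex"
  assumes "hermite_biehler E"
    and "\<And>p :: complex poly. poly p \<in> de_branges E"
  shows "\<exists>K::real. \<forall>(I :: int set) (t :: int \<Rightarrow> real) (\<nu> :: int \<Rightarrow> real)
           (\<mu> :: real measure) (\<Phi> :: real \<Rightarrow> complex) (\<delta> :: real).
           spectral_data E I t \<nu> \<longrightarrow> regular_data I t \<nu> \<longrightarrow> lacunary I t \<longrightarrow>
           regular_borel_measure \<mu> \<longrightarrow> \<Phi> \<in> borel_measurable (completion \<mu>) \<longrightarrow>
           \<delta> > 0 \<longrightarrow> (AE u in \<mu>. u < \<delta> \<longrightarrow> \<Phi> u = 0) \<longrightarrow>
             (hausdorff_bounded E \<Phi> \<mu> \<longleftrightarrow>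
                (\<forall>n. moment_exists \<Phi> \<mu> n) \<and> bdd_above (range (\<lambda>n. cmod (moment \<Phi> \<mu> n)))) \<and>
             (hausdorff_bounded E \<Phi> \<mu> \<longrightarrow>
                db_opnorm E (hausdorff_op \<Phi> \<mu>) \<le> K * (SUP n. cmod (moment \<Phi> \<mu> n)))"
proof -
  interpret polynomial_de_branges E by unfold_locales (use assms in auto)
  show ?thesis
  proof (cases "\<exists>I t \<nu>. spectral_data E I t \<nu> \<and> regular_data I t \<nu> \<and> lacunary I t")
    case False
    then show ?thesis by (intro exI[of _ 0] allI impI) (elim notE, intro exI conjI)
  next
    case True
    then obtain A s \<nu>' r q \<kappa> c where "regular_lacunary_basis E A s \<nu>' r q \<kappa> c"
      using regular_lacunary_basis_exists by blast
    then interpret regular_lacunary_basis E A s \<nu>' r q \<kappa> c .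
    \<comment> \<open>the constant is that of one fixed choice of data; the conclusion does not mention the data\<close>
    show ?thesis
    proof (intro exI[of _ D_op] allI impI, goal_cases)
      case (1 I t \<nu> \<mu> \<Phi> \<delta>)
      then have "hausdorff_kernel \<mu> \<Phi> \<delta>"
        by unfold_locales (auto simp: regular_borel_measure_def)
      from hausdorff_bounded_iff_moments[OF this] show ?case by blast
    qed
  qed
qed

end
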